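(* Assume the setting in the context. The class $\mathcal{X}_c$ of $\operatorname{mod}\tilde\Lambda$ consists exactly of the following indecomposable $\tilde\Lambda$-modules, where $(k,i)$ runs over all pairs of integers with $1\le k\le r$, $m_k\le i<m_{k+1}$ and $i\equiv m_k\pmod{l_k}$: (1) $\tilde M(i,i)$; (2) $\tilde M(i+1,i+l_k-1)$; (3) $\tilde M(i,i+l_k-1)$; (4) $\tilde M(i+1,i+l_k)$. Moreover, an indecomposable $\tilde M(i,j)\in\mathcal{X}_c$ is a projective object of the abelian category $\mathcal{F}=\operatorname{add}\mathcal{X}_c$ if and only if it is of type (3) or (4).
   Context: $\mathbf{k}$ a field, $n\ge2$. Setting: integers $0=m_1<m_2<\dots<m_{r+1}=m$ and $l_1,\dots,l_r\ge2$; $\Lambda_k=\mathbf{k}A_{[m_k,m_{k+1}]}/R^{l_k}$, where $A_{[a,b]}$ has vertices $a,\dots,b$ and arrows $\alpha_t\colon t\to t-1$, and $R$ is the arrow ideal. Each $\Lambda_k$ has global dimension $n$ and admits an $n\mathbb{Z}$-cluster tilting subcategory; it follows that $n$ is even, $l_k\mid m_{k+1}-m_k$ and $n=2(m_{k+1}-m_k)/l_k$ for all $k$, and at least one $l_k\ge3$. $\Lambda=\Lambda_1\ast\cdots\ast\Lambda_r$ is the gluing (the quotient of $\mathbf{k}A_{[0,m]}$ by the ideal generated by all the $R^{l_k}$ on the pieces and the paths $\alpha_{m_k}\alpha_{m_k+1}$, $2\le k\le r$), and $\tilde\Lambda$ is its self-gluing: $\mathbf{k}\tilde A_m/\tilde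 I$, with $\tilde A_m$ the quiver with vertices $1,\dots,m$, arrows $\alpha_t\colon t\to t-1$ ($2\le t\le m$), $\alpha_1\colon1\to m$, vertex $0$ identified with $m$, and $\tilde I$ generated by the image of the ideal of $\Lambda$ and $\alpha_m\alpha_1$. $\tilde M(i,j)$ ($i\le j$) denotes the uniserial $\tilde\Lambda$-module with basis $b_i,\dots,b_j$, $\alpha_sb_t=b_{t-1}$ if $s\equiv t\pmod m$ and $t-1\ge i$, else $0$; top $\tilde M(j,j)$, socle $\tilde M(i,i)$; $\tilde M(i+m,j+m)=\tilde M(i,j)$. Resolution quiver: vertices the simples, arrow $S_i\to S_j$ iff $S_j\cong\tau\operatorname{soc}P_i$ ($P_i$ projective cover, $\tau$ AR translation); cyclic simples are those on oriented cycles. $\mathcal{X}_c$ is the class of indecomposables $M$ with $\operatorname{top}M$ and $\tau\operatorname{soc}M$ cyclic; $\mathcal{F}=\operatorname{add}\mathcal{X}_c$, which is a wide (hence abelian) subcategory. *)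

theory Defs
  imports "Jordan_Normal_Form.Matrix"
begin

text \<open>ms k = m_k (k = 1..r+1), ls k = l_k (k = 1..r), rr = r.\<close>
record params =
  ms :: "nat \<Rightarrow> nat"
  ls :: "nat \<Rightarrow> nat"
  rr :: nat

definition mm :: "params \<Rightarrow> nat" where
  "mm Q = ms Q (Suc (rr Q))"

text \<open>Vertices of the cyclic quiver: 1..m (vertex 0 is identified with m).\<close>
definition V :: "params \<Rightarrow> nat set" where
  "V Q = {1..mm Q}"

definition vtx :: "params \<Rightarrow> int \<Rightarrow> nat" where
  "vtx Q t = nat ((t - 1) mod int (mm Q)) + 1"

text \<open>Arrow alpha_v goes from vertex v to vertex tgt v (= v-1, resp. m for v = 1).\<close>
definition tgt :: "params \<Rightarrow> nat \<Rightarrow> nat" where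
  "tgt Q v = vtx Q (int v - 1)"

text \<open>The unique arrow ending in vertex v is alpha_(inarr v).\<close>
definition inarr :: "params \<Rightarrow> nat \<Rightarrow> nat" where
  "inarr Q v = vtx Q (int v + 1)"

record 'k rep =
  dimv :: "nat \<Rightarrow> nat"
  mapv :: "nat \<Rightarrow> 'k mat"

fun pathm :: "params \<Rightarrow> 'k::field rep \<Rightarrow> int \<Rightarrow> nat \<Rightarrow> 'k mat" where
  "pathm Q M t 0 = 1\<^sub>m (dimv M (vtx Q t))"
| "pathm Q M t (Suc L) = mapv M (vtx Q (t - int L)) * pathm Q M t L"

definition kills :: "params \<Rightarrow> 'k::field rep \<Rightarrow> int \<Rightarrow> nat \<Rightarrow> bool" where
  "kills Q M t L \<longleftrightarrow> pathm Q M t L = 0\<^sub>m (dimv M (vtx Q (t - int L))) (dimv M (vtx Q t))"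

text \<open>A representation of the bound quiver of the self-gluing: annihilated by the generators
  of the ideal: the paths of length l_k inside the k-th piece, the paths
  alpha_(m_k) alpha_(m_k+1) (2 <= k <= r) and alpha_m alpha_1 (the case k = 1, as m_1 = 0 = m).\<close>
definition is_mod :: "params \<Rightarrow> 'k::field rep \<Rightarrow> bool" where
  "is_mod Q M \<longleftrightarrow>
     (\<forall>v\<in>V Q. mapv M v \<in> carrier_mat (dimv M (tgt Q v)) (dimv M v)) \<and>
     (\<forall>k\<in>{1..rr Q}.
        (\<forall>t. int (ms Q k + ls Q k) \<le> t \<and> t \<le> int (ms Q (Suc k)) \<longrightarrow> kills Q M t (ls Q k)) \<and>
        kills Q M (int (ms Q k) + 1) 2)"

definition morph :: "params \<Rightarrow> (nat \<Rightarrow> 'k::field mat) \<Rightarrow> 'k rep \<Rightarrow> 'k rep \<Rightarrow> bool" where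
  "morph Q f X Y \<longleftrightarrow> (\<forall>v\<in>V Q. f v \<in> carrier_mat (dimv Y v) (dimv X v) \<and>
                         f (tgt Q v) * mapv X v = mapv Y v * f v)"

definition comp :: "(nat \<Rightarrow> 'k::field mat) \<Rightarrow> (nat \<Rightarrow> 'k mat) \<Rightarrow> nat \<Rightarrow> 'k mat" where
  "comp g f = (\<lambda>v. g v * f v)"

definition idm :: "'k::field rep \<Rightarrow> nat \<Rightarrow> 'k mat" where
  "idm X = (\<lambda>v. 1\<^sub>m (dimv X v))"

definition eqon :: "params \<Rightarrow> (nat \<Rightarrow> 'k mat) \<Rightarrow> (nat \<Rightarrow> 'k mat) \<Rightarrow> bool" where
  "eqon Q f g \<longleftrightarrow> (\<forall>v\<in>V Q. f v = g v)"

definition iso :: "params \<Rightarrow> 'k::field rep \<Rightarrow> 'k rep \<Rightarrow> bool" where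
  "iso Q X Y \<longleftrightarrow> (\<exists>f g. morph Q f X Y \<and> morph Q g Y X \<and>
                    eqon Q (comp g f) (idm X) \<and> eqon Q (comp f g) (idm Y))"

definition is_zero :: "params \<Rightarrow> 'k rep \<Rightarrow> bool" where
  "is_zero Q M \<longleftrightarrow> (\<forall>v\<in>V Q. dimv M v = 0)"

definition zero_rep :: "'k::field rep" where
  "zero_rep = \<lparr>dimv = (\<lambda>_. 0), mapv = (\<lambda>_. 0\<^sub>m 0 0)\<rparr>"

definition dsum :: "params \<Rightarrow> 'k::field rep \<Rightarrow> 'k rep \<Rightarrow> 'k rep" where
  "dsum Q X Y = \<lparr>dimv = (\<lambda>v. dimv X v + dimv Y v),
     mapv = (\<lambda>v. four_block_mat (mapv X v) (0\<^sub>m (dimv X (tgt Q v)) (dimv Y v))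
                                (0\<^sub>m (dimv Y (tgt Q v)) (dimv X v)) (mapv Y v))\<rparr>"

definition indec :: "params \<Rightarrow> 'k::field rep \<Rightarrow> bool" where
  "indec Q M \<longleftrightarrow> is_mod Q M \<and> \<not> is_zero Q M \<and>
     \<not> (\<exists>X Y. is_mod Q X \<and> is_mod Q Y \<and> \<not> is_zero Q X \<and> \<not> is_zero Q Y \<and> iso Q M (dsum Q X Y))"

definition surj_m :: "params \<Rightarrow> (nat \<Rightarrow> 'k::field mat) \<Rightarrow> 'k rep \<Rightarrow> 'k rep \<Rightarrow> bool" where
  "surj_m Q f X Y \<longleftrightarrow> (\<forall>v\<in>V Q. \<forall>y\<in>carrier_vec (dimv Y v). \<exists>x\<in>carrier_vec (dimv X v). f v *\<^sub>v x = y)"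

definition inj_m :: "params \<Rightarrow> (nat \<Rightarrow> 'k::field mat) \<Rightarrow> 'k rep \<Rightarrow> 'k rep \<Rightarrow> bool" where
  "inj_m Q f X Y \<longleftrightarrow> (\<forall>v\<in>V Q. \<forall>x\<in>carrier_vec (dimv X v).
                          f v *\<^sub>v x = 0\<^sub>v (dimv Y v) \<longrightarrow> x = 0\<^sub>v (dimv X v))"

definition split_epi :: "params \<Rightarrow> (nat \<Rightarrow> 'k::field mat) \<Rightarrow> 'k rep \<Rightarrow> 'k rep \<Rightarrow> bool" where
  "split_epi Q g X Y \<longleftrightarrow> (\<exists>s. morph Q s Y X \<and> eqon Q (comp g s) (idm Y))"

definition split_mono :: "params \<Rightarrow> (nat \<Rightarrow> 'k::field mat) \<Rightarrow> 'k rep \<Rightarrow> 'k rep \<Rightarrow> bool" where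
  "split_mono Q f X Y \<longleftrightarrow> (\<exists>p. morph Q p Y X \<and> eqon Q (comp p f) (idm X))"

definition short_exact :: "params \<Rightarrow> (nat \<Rightarrow> 'k::field mat) \<Rightarrow> (nat \<Rightarrow> 'k mat)
                           \<Rightarrow> 'k rep \<Rightarrow> 'k rep \<Rightarrow> 'k rep \<Rightarrow> bool" where
  "short_exact Q f g N E M \<longleftrightarrow> morph Q f N E \<and> morph Q g E M \<and> inj_m Q f N E \<and> surj_m Q g E M \<and>
     (\<forall>v\<in>V Q. \<forall>y\<in>carrier_vec (dimv E v).
        g v *\<^sub>v y = 0\<^sub>v (dimv M v) \<longleftrightarrow> (\<exists>x\<in>carrier_vec (dimv N v). f v *\<^sub>v x = y))"

definition left_almost_split :: "params \<Rightarrow> (nat \<Rightarrow> 'k::field mat) \<Rightarrow> 'k rep \<Rightarrow> 'k rep \<Rightarrow> bool" where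
  "left_almost_split Q f N E \<longleftrightarrow> \<not> split_mono Q f N E \<and>
     (\<forall>U u. is_mod Q U \<and> morph Q u N U \<and> \<not> split_mono Q u N U \<longrightarrow>
            (\<exists>w. morph Q w E U \<and> eqon Q (comp w f) u))"

definition right_almost_split :: "params \<Rightarrow> (nat \<Rightarrow> 'k::field mat) \<Rightarrow> 'k rep \<Rightarrow> 'k rep \<Rightarrow> bool" where
  "right_almost_split Q g E M \<longleftrightarrow> \<not> split_epi Q g E M \<and>
     (\<forall>X h. is_mod Q X \<and> morph Q h X M \<and> \<not> split_epi Q h X M \<longrightarrow>
            (\<exists>w. morph Q w X E \<and> eqon Q (comp g w) h))"

text \<open>An almost split (Auslander-Reiten) sequence 0 -> N -> E -> M -> 0; then N = tau M.\<close>
definition almost_split :: "params \<Rightarrow> 'k::field rep \<Rightarrow> 'k rep \<Rightarrow> 'k rep \<Rightarrow> bool" where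
  "almost_split Q N E M \<longleftrightarrow> is_mod Q N \<and> is_mod Q E \<and> is_mod Q M \<and>
     (\<exists>f g. short_exact Q f g N E M \<and> left_almost_split Q f N E \<and> right_almost_split Q g E M)"

definition firstpos :: "params \<Rightarrow> int \<Rightarrow> nat \<Rightarrow> int" where
  "firstpos Q i v = i + ((int v - i) mod int (mm Q))"

definition dimMt :: "params \<Rightarrow> int \<Rightarrow> int \<Rightarrow> nat \<Rightarrow> nat" where
  "dimMt Q i j v = (if v \<in> V Q \<and> firstpos Q i v \<le> j
                    then nat ((j - firstpos Q i v) div int (mm Q)) + 1 else 0)"

text \<open>Basis b_i..b_j; at vertex v the basis vectors are b_t (t = firstpos v + q m, q = 0,1,..);
  alpha_v b_t = b_(t-1) if t-1 >= i, else 0.\<close>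
definition Mt :: "params \<Rightarrow> int \<Rightarrow> int \<Rightarrow> 'k::field rep" where
  "Mt Q i j = \<lparr>dimv = dimMt Q i j,
     mapv = (\<lambda>v. mat (dimMt Q i j (tgt Q v)) (dimMt Q i j v)
                   (\<lambda>(p, q). let s = firstpos Q i v + int q * int (mm Q) - 1 in
                             if i \<le> s \<and> s = firstpos Q i (tgt Q v) + int p * int (mm Q) then 1 else 0))\<rparr>"

definition Smod :: "params \<Rightarrow> nat \<Rightarrow> 'k::field rep" where
  "Smod Q t = Mt Q (int t) (int t)"

text \<open>S_v is a summand of soc M (soc M (v) = kernel of the unique arrow leaving v).\<close>
definition soc_nz :: "params \<Rightarrow> 'k::field rep \<Rightarrow> nat \<Rightarrow> bool" where
  "soc_nz Q M v \<longleftrightarrow> (\<exists>x\<in>carrier_vec (dimv M v). x \<noteq> 0\<^sub>v (dimv M v) \<and>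
                        mapv M v *\<^sub>v x = 0\<^sub>v (dimv M (tgt Q v)))"

text \<open>S_v is a summand of top M (top M (v) = M(v) / image of the unique arrow entering v).\<close>
definition top_nz :: "params \<Rightarrow> 'k::field rep \<Rightarrow> nat \<Rightarrow> bool" where
  "top_nz Q M v \<longleftrightarrow> \<not> (\<forall>y\<in>carrier_vec (dimv M v). \<exists>x\<in>carrier_vec (dimv M (inarr Q v)).
                          mapv M (inarr Q v) *\<^sub>v x = y)"

definition soc_simple :: "params \<Rightarrow> 'k::field rep \<Rightarrow> nat \<Rightarrow> bool" where
  "soc_simple Q M s \<longleftrightarrow> s \<in> V Q \<and> (\<forall>v\<in>V Q. v \<noteq> s \<longrightarrow> \<not> soc_nz Q M v) \<and>
     (\<exists>x\<in>carrier_vec (dimv M s). x \<noteq> 0\<^sub>v (dimv M s) \<and> mapv M s *\<^sub>v x = 0\<^sub>v (dimv M (tgt Q s)) \<and>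
        (\<forall>y\<in>carrier_vec (dimv M s). mapv M s *\<^sub>v y = 0\<^sub>v (dimv M (tgt Q s)) \<longrightarrow> (\<exists>c. y = c \<cdot>\<^sub>v x)))"

definition projective :: "params \<Rightarrow> 'k::field rep \<Rightarrow> bool" where
  "projective Q P \<longleftrightarrow> is_mod Q P \<and>
     (\<forall>X Y g f. is_mod Q X \<and> is_mod Q Y \<and> morph Q g X Y \<and> surj_m Q g X Y \<and> morph Q f P Y \<longrightarrow>
        (\<exists>h. morph Q h P X \<and> eqon Q (comp g h) f))"

definition proj_cover :: "params \<Rightarrow> 'k::field rep \<Rightarrow> (nat \<Rightarrow> 'k mat) \<Rightarrow> 'k rep \<Rightarrow> bool" where
  "proj_cover Q P p N \<longleftrightarrow> projective Q P \<and> is_mod Q N \<and> morph Q p P N \<and> surj_m Q p P N \<and>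
     (\<forall>Z h. is_mod Q Z \<and> morph Q h Z P \<and> surj_m Q (comp p h) Z N \<longrightarrow> surj_m Q h Z P)"

text \<open>Arrow S_i -> S_j iff S_j is isomorphic to tau (soc P_i).\<close>
definition res_arrow :: "'k::field itself \<Rightarrow> params \<Rightarrow> nat \<Rightarrow> nat \<Rightarrow> bool" where
  "res_arrow (T :: 'k itself) Q i j \<longleftrightarrow> i \<in> V Q \<and> j \<in> V Q \<and>
     (\<exists>(P :: 'k rep) p s. proj_cover Q P p (Smod Q i :: 'k rep) \<and> soc_simple Q P s \<and>
        (\<exists>E. almost_split Q (Smod Q j :: 'k rep) E (Smod Q s)))"

definition cyclic_simple :: "'k::field itself \<Rightarrow> params \<Rightarrow> nat \<Rightarrow> bool" where
  "cyclic_simple T Q i \<longleftrightarrow> (i, i) \<in> {(a, b). res_arrow T Q a b}\<^sup>+"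

text \<open>X_c: indecomposables M with top M cyclic and tau (soc M) cyclic.\<close>
definition in_Xc :: "params \<Rightarrow> 'k::field rep \<Rightarrow> bool" where
  "in_Xc Q M \<longleftrightarrow> indec Q M \<and>
     (\<forall>v\<in>V Q. top_nz Q M v \<longrightarrow> cyclic_simple TYPE('k) Q v) \<and>
     (\<forall>s\<in>V Q. soc_nz Q M s \<longrightarrow>
        (\<exists>t. cyclic_simple TYPE('k) Q t \<and> (\<exists>E. almost_split Q (Smod Q t :: 'k rep) E (Smod Q s))))"

definition in_F :: "params \<Rightarrow> 'k::field rep \<Rightarrow> bool" where
  "in_F Q M \<longleftrightarrow> is_mod Q M \<and>
     (\<exists>Ms. (\<forall>X\<in>set Ms. in_Xc Q X) \<and> iso Q M (foldr (dsum Q) Ms zero_rep))"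

definition epi_F :: "params \<Rightarrow> (nat \<Rightarrow> 'k::field mat) \<Rightarrow> 'k rep \<Rightarrow> 'k rep \<Rightarrow> bool" where
  "epi_F Q g X Y \<longleftrightarrow> in_F Q X \<and> in_F Q Y \<and> morph Q g X Y \<and>
     (\<forall>Z h1 h2. in_F Q Z \<and> morph Q h1 Y Z \<and> morph Q h2 Y Z \<and> eqon Q (comp h1 g) (comp h2 g)
                 \<longrightarrow> eqon Q h1 h2)"

definition proj_in_F :: "params \<Rightarrow> 'k::field rep \<Rightarrow> bool" where
  "proj_in_F Q M \<longleftrightarrow> in_F Q M \<and>
     (\<forall>X Y g f. epi_F Q g X Y \<and> morph Q f M Y \<longrightarrow> (\<exists>h. morph Q h M X \<and> eqon Q (comp g h) f))"

definition listed :: "params \<Rightarrow> nat \<Rightarrow> int \<Rightarrow> bool" where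
  "listed Q k i \<longleftrightarrow> 1 \<le> k \<and> k \<le> rr Q \<and> int (ms Q k) \<le> i \<and> i < int (ms Q (Suc k)) \<and>
                     i mod int (ls Q k) = int (ms Q k) mod int (ls Q k)"

end

theory Submission
  imports Defs
begin

text \<open>The algebra is a Nakayama algebra on a cyclic quiver, and all its indecomposable projectives have
  length at most \<open>m\<close>, so its indecomposables are the uniserial modules \<open>Mt i j\<close> with \<open>st j \<le> i \<le> j\<close>,
  where \<open>Mt (st j) j\<close> is the projective cover of \<open>S\<^sub>j\<close>. Each of them has multiplicity-free composition
  factors. As \<open>\<tau> S\<^sub>j = S\<^sub>j\<^sub>-\<^sub>1\<close>, the resolution quiver has the arrows \<open>S\<^sub>j \<rightarrow> S\<^bsub>st j - 1\<^esub>\<close>, and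
  \<open>X\<^sub>c\<close> consists of the \<open>Mt i j\<close> with \<open>j\<close> and \<open>i - 1\<close> cyclic. In the \<open>k\<close>-th piece
  the map \<open>j \<mapsto> st j - 1\<close> subtracts \<open>l\<^sub>k\<close>, except that it sends the first \<open>l\<^sub>k - 1\<close> vertices to
  \<open>m\<^sub>k - 1\<close>; hence the cyclic vertices are those congruent to \<open>m\<^sub>k\<close> or \<open>m\<^sub>k - 1\<close> modulo \<open>l\<^sub>k\<close>.

  If \<open>s - 1\<close> is not cyclic, the arrow leaving \<open>s\<close> acts bijectively on every object of \<open>F\<close>. This
  makes the categorical epimorphisms of \<open>F\<close> surjective, so the projective modules in \<open>X\<^sub>c\<close>
  are projective in \<open>F\<close>; conversely the cover of \<open>Mt i j\<close> by \<open>Mt (st j) j\<close> lies in \<open>F\<close> and does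
  not split unless \<open>i = st j\<close>.\<close>

text \<open>Projective covers, almost split sequences and decompositions are quantified over all
  matrix representations. So the translate of a simple needs two arguments: an explicit almost split
  sequence ending in \<open>S_j\<close>, and a proof that any such sequence with simple left term
  starts in \<open>S_(j-1)\<close>. Likewise a projective cover of a simple is an arbitrary one, and
  has to be compared with \<open>Mt (st j) j\<close>.

  An epimorphism of \<open>F\<close> cancels only against objects of \<open>F\<close>, so a failure
  of surjectivity must be witnessed by a nonzero morphism into an object of \<open>F\<close>. The
  bijective arrows serve to move the witnessing functional to a position directly above a cyclic
  vertex, where it defines such a morphism.

  The bound \<open>m\<close> on the lengths makes \<open>m\<close> consecutive positions, counted
  from the socle, meet each vertex once, so that every space of \<open>Mt i j\<close> is zero or a
  line.

  For the cyclic vertices, divisibility cuts each piece into blocks of length \<open>l_k\<close>.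
  The map permutes the set formed by the block ends and their lower neighbours, and it strictly
  lowers every vertex whose image lies outside this set.\<close>

section \<open>Block matrices\<close>

text \<open>The premises are equations between dimensions instead of carriers: the dimensions of
  path matrices and morphisms become simp rules later on, so these premises simplify away, while
  carrier premises would need their formats guessed.\<close>

lemma mult_assoc_dim:
  "dim_col A = dim_row B \<Longrightarrow> dim_col B = dim_row C \<Longrightarrow> (A * B) * C = A * (B * (C :: 'a::semiring_0 mat))"
  by (rule assoc_mult_mat[of A "dim_row A" "dim_row B" B "dim_row C" C "dim_col C"]) auto

lemma mat_eq_no_cols: "dim_row A = dim_row B \<Longrightarrow> dim_col A = 0 \<Longrightarrow> dim_col B = 0 \<Longrightarrow> A = B"
  by (rule eq_matI) auto

lemma mat_eq_no_rows: "dim_col A = dim_col B \<Longrightarrow> dim_row A = 0 \<Longrightarrow> dim_row B = 0 \<Longrightarrow> A = B"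
  by (rule eq_matI) auto

lemma add_zero_dim [simp]:
  fixes A :: "'a::monoid_add mat"
  shows "dim_row A = r \<Longrightarrow> dim_col A = c \<Longrightarrow> 0\<^sub>m r c + A = A"
    and "dim_row A = r \<Longrightarrow> dim_col A = c \<Longrightarrow> A + 0\<^sub>m r c = A"
  by (rule eq_matI; simp)+

lemma one_mat_neq_zero: "0 < n \<Longrightarrow> (1\<^sub>m n :: 'a::zero_neq_one mat) \<noteq> 0\<^sub>m n n"
proof
  assume "0 < n" "(1\<^sub>m n :: 'a mat) = 0\<^sub>m n n"
  then have "(1\<^sub>m n :: 'a mat) $$ (0, 0) = 0\<^sub>m n n $$ (0, 0)" by simp
  then show False using \<open>0 < n\<close> by simp
qed

text \<open>Degenerate block matrices, with blocks of width or height zero, so that the product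
  rules reduce to \<open>mult_four_block_mat\<close>. \<open>vstack\<close> serves for maps into a
  direct sum, \<open>hstack\<close> for maps out of it.\<close>

definition vstack :: "'a::zero mat \<Rightarrow> 'a mat \<Rightarrow> 'a mat" where
  "vstack A B = four_block_mat A (0\<^sub>m (dim_row A) 0) B (0\<^sub>m (dim_row B) 0)"

definition hstack :: "'a::zero mat \<Rightarrow> 'a mat \<Rightarrow> 'a mat" where
  "hstack A B = four_block_mat A B (0\<^sub>m 0 (dim_col A)) (0\<^sub>m 0 (dim_col B))"

definition block_diag :: "'a::zero mat \<Rightarrow> 'a mat \<Rightarrow> 'a mat" where
  "block_diag A B = four_block_mat A (0\<^sub>m (dim_row A) (dim_col B)) (0\<^sub>m (dim_row B) (dim_col A)) B"

lemma dim_stack [simp]: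
  "dim_row (vstack A B) = dim_row A + dim_row B" "dim_col (vstack A B) = dim_col A"
  "dim_row (hstack A B) = dim_row A" "dim_col (hstack A B) = dim_col A + dim_col B"
  "dim_row (block_diag A B) = dim_row A + dim_row B" "dim_col (block_diag A B) = dim_col A + dim_col B"
  by (auto simp: vstack_def hstack_def block_diag_def)

lemma four_block_no_margin:
  "four_block_mat A (0\<^sub>m (dim_row A) 0) (0\<^sub>m 0 (dim_col A)) (0\<^sub>m 0 0) = A"
proof (rule eq_matI)
  fix i j assume "i < dim_row A" "j < dim_col A"
  then show "four_block_mat A (0\<^sub>m (dim_row A) 0) (0\<^sub>m 0 (dim_col A)) (0\<^sub>m 0 0) $$ (i, j) = A $$ (i, j)"
    by (subst index_mat_four_block(1)) simp_all
qed simp_all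

lemma vstack_mult:
  fixes A B C :: "'a::semiring_0 mat"
  assumes "dim_col A = dim_row C" "dim_col B = dim_row C"
  shows "vstack A B * C = vstack (A * C) (B * C)"
proof -
  have "vstack A B * C = vstack A B * four_block_mat C (0\<^sub>m (dim_row C) 0) (0\<^sub>m 0 (dim_col C)) (0\<^sub>m 0 0)"
    by (simp add: four_block_no_margin)
  also have "\<dots> = vstack (A * C) (B * C)"
    unfolding vstack_def
    by (subst mult_four_block_mat[of _ "dim_row A" "dim_row C" _ 0 _ "dim_row B" _ _ "dim_col C" _ 0])
      (simp_all only: left_mult_zero_mat' right_mult_zero_mat' add_zero_dim index_mult_mat index_zero_mat
        assms zero_carrier_mat carrier_matI)
  finally show ?thesis .
qed

lemma mult_hstack:
  fixes A B C :: "'a::semiring_0 mat"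
  assumes "dim_col C = dim_row A" "dim_col C = dim_row B"
  shows "C * hstack A B = hstack (C * A) (C * B)"
proof -
  have "C * hstack A B = four_block_mat C (0\<^sub>m (dim_row C) 0) (0\<^sub>m 0 (dim_col C)) (0\<^sub>m 0 0) * hstack A B"
    by (simp add: four_block_no_margin)
  also have "\<dots> = hstack (C * A) (C * B)"
    unfolding hstack_def
    by (subst mult_four_block_mat[of _ "dim_row C" "dim_col C" _ 0 _ 0 _ _ "dim_col A" _ "dim_col B"])
      (simp_all only: left_mult_zero_mat' right_mult_zero_mat' add_zero_dim index_mult_mat index_zero_mat
        assms[symmetric] zero_carrier_mat carrier_matI)
  finally show ?thesis .
qed

lemma block_diag_mult_vstack:
  fixes A B C D :: "'a::semiring_0 mat"
  assumes "dim_col A = dim_row C" "dim_col B = dim_row D" "dim_col C = dim_col D"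
  shows "block_diag A B * vstack C D = vstack (A * C) (B * D)"
  unfolding vstack_def block_diag_def
  by (subst mult_four_block_mat[of _ "dim_row A" "dim_row C" _ "dim_row D" _ "dim_row B" _ _ "dim_col C" _ 0])
      (simp_all only: left_mult_zero_mat' right_mult_zero_mat' add_zero_dim index_mult_mat index_zero_mat
        assms zero_carrier_mat carrier_matI)

lemma hstack_mult_block_diag:
  fixes A B C D :: "'a::semiring_0 mat"
  assumes "dim_col C = dim_row A" "dim_col D = dim_row B" "dim_row C = dim_row D"
  shows "hstack C D * block_diag A B = hstack (C * A) (D * B)"
  unfolding hstack_def block_diag_def
  by (subst mult_four_block_mat[of _ "dim_row C" "dim_row A" _ "dim_row B" _ 0 _ _ "dim_col A" _ "dim_col B"])
      (simp_all only: left_mult_zero_mat' right_mult_zero_mat' add_zero_dim index_mult_mat index_zero_mat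
        assms zero_carrier_mat carrier_matI)

lemma hstack_mult_vstack:
  fixes A B C D :: "'a::semiring_0 mat"
  assumes "dim_col A = dim_row C" "dim_col B = dim_row D" "dim_row A = dim_row B" "dim_col C = dim_col D"
  shows "hstack A B * vstack C D = A * C + B * D"
  unfolding hstack_def vstack_def
  by (subst mult_four_block_mat[of _ "dim_row A" "dim_row C" _ "dim_row D" _ 0 _ _ "dim_col C" _ 0])
      (simp_all only: left_mult_zero_mat' right_mult_zero_mat' add_zero_dim index_mult_mat index_zero_mat
        assms zero_carrier_mat carrier_matI
        four_block_no_margin[of "A * C + B * D", unfolded index_add_mat index_mult_mat])

lemma vstack_mult_hstack:
  fixes A B C D :: "'a::semiring_0 mat"
  assumes "dim_col A = dim_row C" "dim_col B = dim_row D" "dim_row C = dim_row D" "dim_col A = dim_col B"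
  shows "vstack A B * hstack C D = four_block_mat (A * C) (A * D) (B * C) (B * D)"
  unfolding hstack_def vstack_def
  by (subst mult_four_block_mat[of _ "dim_row A" "dim_row C" _ 0 _ "dim_row B" _ _ "dim_col C" _ "dim_col D"])
      (simp_all only: left_mult_zero_mat' right_mult_zero_mat' add_zero_dim index_mult_mat index_zero_mat
        assms zero_carrier_mat carrier_matI)

lemma block_diag_mult:
  fixes A B C D :: "'a::semiring_0 mat"
  assumes "dim_col A = dim_row C" "dim_col B = dim_row D"
  shows "block_diag A B * block_diag C D = block_diag (A * C) (B * D)"
  unfolding block_diag_def
  by (subst mult_four_block_mat[of _ "dim_row A" "dim_row C" _ "dim_row D" _ "dim_row B" _ _ "dim_col C" _ "dim_col D"])
      (simp_all only: left_mult_zero_mat' right_mult_zero_mat' add_zero_dim index_mult_mat index_zero_mat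
        assms zero_carrier_mat carrier_matI)

lemma block_diag_one: "block_diag (1\<^sub>m a) (1\<^sub>m b) = 1\<^sub>m (a + b)"
  by (rule eq_matI) (auto simp: block_diag_def)

section \<open>One-sided inverses of matrices\<close>

text \<open>Adding a column \<open>a\<close>: if \<open>z\<close> kills the old columns and \<open>z a = 1\<close>, it suffices to treat
  \<open>b - (z b) a\<close> by means of the old columns.\<close>
lemma Fredholm_alternative_sums:
  fixes A :: "nat \<Rightarrow> nat \<Rightarrow> 'a::field"
  shows "(\<exists>x. \<forall>i<r. (\<Sum>j<c. A i j * x j) = b i) \<or>
         (\<exists>y. (\<forall>j<c. (\<Sum>i<r. y i * A i j) = 0) \<and> (\<Sum>i<r. y i * b i) = 1)"
proof (induction c arbitrary: b)
  case 0
  show ?case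
  proof (cases "\<forall>i<r. b i = 0")
    case False
    then obtain p where p: "p < r" "b p \<noteq> 0" by auto
    have "(\<Sum>i<r. (if i = p then inverse (b p) else 0) * b i) = (\<Sum>i<r. if i = p then 1 else 0)"
      by (rule sum.cong) (use p in auto)
    also have "\<dots> = 1" using p by simp
    finally have "(\<Sum>i<r. (if i = p then inverse (b p) else 0) * b i) = 1" .
    then show ?thesis by (intro disjI2 exI[of _ "\<lambda>i. if i = p then inverse (b p) else 0"]) simp
  qed simp
next
  case (Suc c)
  let ?S = "\<lambda>b. \<exists>x. \<forall>i<r. (\<Sum>j<c. A i j * x j) = b i"
  let ?K = "\<lambda>y. \<forall>j<c. (\<Sum>i<r. y i * A i j) = 0"
  show ?case
  proof (cases "?S (\<lambda>i. A i c)")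
    case True
    then obtain u where u: "\<forall>i<r. (\<Sum>j<c. A i j * u j) = A i c" by auto
    from Suc.IH[of b] show ?thesis
    proof
      assume "?S b"
      then obtain x where "\<forall>i<r. (\<Sum>j<c. A i j * x j) = b i" by auto
      then show ?thesis by (intro disjI1 exI[of _ "x(c := 0)"]) simp
    next
      assume "\<exists>y. ?K y \<and> (\<Sum>i<r. y i * b i) = 1"
      then obtain y where y: "?K y" "(\<Sum>i<r. y i * b i) = 1" by auto
      have "(\<Sum>i<r. y i * A i c) = (\<Sum>i<r. y i * (\<Sum>j<c. A i j * u j))"
        using u by (intro sum.cong) auto
      also have "\<dots> = (\<Sum>i<r. \<Sum>j<c. y i * A i j * u j)"
        by (simp add: sum_distrib_left mult.assoc)
      also have "\<dots> = (\<Sum>j<c. \<Sum>i<r. y i * A i j * u j)" by (rule sum.swap)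
      also have "\<dots> = (\<Sum>j<c. (\<Sum>i<r. y i * A i j) * u j)" by (simp add: sum_distrib_right)
      also have "\<dots> = 0" using y(1) by simp
      finally show ?thesis using y by (intro disjI2 exI[of _ y]) (auto simp: less_Suc_eq)
    qed
  next
    case False
    with Suc.IH[of "\<lambda>i. A i c"] obtain z where z: "?K z" "(\<Sum>i<r. z i * A i c) = 1" by blast
    define zb where "zb = (\<Sum>i<r. z i * b i)"
    from Suc.IH[of "\<lambda>i. b i - zb * A i c"] show ?thesis
    proof
      assume "?S (\<lambda>i. b i - zb * A i c)"
      then obtain x where "\<forall>i<r. (\<Sum>j<c. A i j * x j) = b i - zb * A i c" by auto
      then show ?thesis by (intro disjI1 exI[of _ "x(c := zb)"]) (simp add: mult.commute)
    next
      assume "\<exists>y. ?K y \<and> (\<Sum>i<r. y i * (b i - zb * A i c)) = 1"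
      then obtain y where y: "?K y" "(\<Sum>i<r. y i * (b i - zb * A i c)) = 1" by auto
      define ya where "ya = (\<Sum>i<r. y i * A i c)"
      have lin: "(\<Sum>i<r. (y i - ya * z i) * w i) = (\<Sum>i<r. y i * w i) - ya * (\<Sum>i<r. z i * w i)" for w
        by (simp add: left_diff_distrib sum_subtractf sum_distrib_left mult.assoc)
      have "(\<Sum>i<r. y i * b i) - ya * zb = (\<Sum>i<r. y i * (b i - zb * A i c))"
        unfolding ya_def
        by (simp add: right_diff_distrib sum_subtractf sum_distrib_left sum_distrib_right ac_simps)
      then have "(\<Sum>i<r. (y i - ya * z i) * b i) = 1"
        unfolding lin using y(2) by (simp add: zb_def)
      moreover have "(\<Sum>i<r. (y i - ya * z i) * A i j) = 0" if "j < Suc c" for j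
        unfolding lin using that y(1) z by (auto simp: less_Suc_eq ya_def)
      ultimately show ?thesis by (intro disjI2 exI[of _ "\<lambda>i. y i - ya * z i"]) auto
    qed
  qed
qed

text \<open>The functional \<open>y\<close> is normalised to \<open>y * b = 1\<close>, so that for
  almost split sequences it directly supplies a retraction.\<close>

lemma Fredholm_alternative:
  fixes A :: "'a::field mat"
  assumes A: "A \<in> carrier_mat r c" and b: "b \<in> carrier_mat r 1"
  shows "(\<exists>x\<in>carrier_mat c 1. A * x = b) \<or> (\<exists>y\<in>carrier_mat 1 r. y * A = 0\<^sub>m 1 c \<and> y * b = 1\<^sub>m 1)"
  using Fredholm_alternative_sums[where r = r and c = c and A = "\<lambda>i j. A $$ (i, j)" and b = "\<lambda>i. b $$ (i, 0)"]
proof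
  assume "\<exists>x. \<forall>i<r. (\<Sum>j<c. A $$ (i, j) * x j) = b $$ (i, 0)"
  then obtain x where x: "\<forall>i<r. (\<Sum>j<c. A $$ (i, j) * x j) = b $$ (i, 0)" ..
  have "A * mat c 1 (\<lambda>(i, j). x i) = b"
    using A b x by (intro eq_matI) (auto simp: scalar_prod_def atLeast0LessThan)
  then show ?thesis by (intro disjI1 bexI[of _ "mat c 1 (\<lambda>(i, j). x i)"]) auto
next
  assume "\<exists>y. (\<forall>j<c. (\<Sum>i<r. y i * A $$ (i, j)) = 0) \<and> (\<Sum>i<r. y i * b $$ (i, 0)) = 1"
  then obtain y where y: "\<forall>j<c. (\<Sum>i<r. y i * A $$ (i, j)) = 0" "(\<Sum>i<r. y i * b $$ (i, 0)) = 1" by auto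
  have "mat 1 r (\<lambda>(i, j). y j) * A = 0\<^sub>m 1 c"
    using A b y by (intro eq_matI) (auto simp: scalar_prod_def atLeast0LessThan)
  moreover have "mat 1 r (\<lambda>(i, j). y j) * b = 1\<^sub>m 1"
    using A b y by (intro eq_matI) (auto simp: scalar_prod_def atLeast0LessThan)
  ultimately show ?thesis by (intro disjI2 bexI[of _ "mat 1 r (\<lambda>(i, j). y j)"]) auto
qed

text \<open>Surjectivity, and below injectivity, encoded by a witness: products and block sums are
  then treated by exhibiting an inverse, and cancellation is a matrix computation.\<close>

definition rinv :: "'a::semiring_1 mat \<Rightarrow> bool" where
  "rinv A \<longleftrightarrow> (\<exists>B\<in>carrier_mat (dim_col A) (dim_row A). A * B = 1\<^sub>m (dim_row A))"

definition linv :: "'a::semiring_1 mat \<Rightarrow> bool" where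
  "linv A \<longleftrightarrow> (\<exists>B\<in>carrier_mat (dim_col A) (dim_row A). B * A = 1\<^sub>m (dim_col A))"

text \<open>If every standard basis column were hit, the preimages would be the columns of a right
  inverse. So some column \<open>v\<close> is missed, and the Fredholm alternative gives
  \<open>y\<close> with \<open>y * A = 0\<close> and \<open>y * v = 1\<close>.\<close>

lemma not_rinv_functional:
  fixes A :: "'a::field mat"
  assumes "A \<in> carrier_mat r c" "\<not> rinv A"
  obtains y where "y \<in> carrier_mat 1 r" "y * A = 0\<^sub>m 1 c" "y \<noteq> 0\<^sub>m 1 r"
proof -
  have "\<exists>v\<in>carrier_mat r 1. \<not> (\<exists>x\<in>carrier_mat c 1. A * x = v)"
  proof (rule ccontr)
    assume "\<not> ?thesis"
    then have "\<forall>k. \<exists>x\<in>carrier_mat c 1. A * x = mat r 1 (\<lambda>(i, j). if i = k then 1 else 0)" by auto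
    then obtain x where x: "\<And>k. x k \<in> carrier_mat c 1"
        "\<And>k. A * x k = mat r 1 (\<lambda>(i, j). if i = k then 1 else 0)" by metis
    have "(A * mat c r (\<lambda>(i, j). x j $$ (i, 0))) $$ (p, q) = 1\<^sub>m r $$ (p, q)" if pq: "p < r" "q < r" for p q
    proof -
      have "(A * mat c r (\<lambda>(i, j). x j $$ (i, 0))) $$ (p, q) = (A * x q) $$ (p, 0)"
        using assms(1) pq x(1)[of q] by (auto simp: scalar_prod_def intro!: sum.cong)
      then show ?thesis using pq x(2)[of q] by simp
    qed
    then have "A * mat c r (\<lambda>(i, j). x j $$ (i, 0)) = 1\<^sub>m r"
      using assms(1) by (intro eq_matI) auto
    then have "rinv A" unfolding rinv_def using assms(1)
      by (intro bexI[of _ "mat c r (\<lambda>(i, j). x j $$ (i, 0))"]) auto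
    with assms show False by simp
  qed
  then obtain v where v: "v \<in> carrier_mat r 1" "\<not> (\<exists>x\<in>carrier_mat c 1. A * x = v)" by auto
  with Fredholm_alternative[OF assms(1) v(1)]
  obtain y where y: "y \<in> carrier_mat 1 r" "y * A = 0\<^sub>m 1 c" "y * v = 1\<^sub>m 1" by auto
  have "y \<noteq> 0\<^sub>m 1 r" using y(3) v(1) one_mat_neq_zero[of 1, where 'a='a] by auto
  with y that show ?thesis by blast
qed

lemma linv_transpose: "linv (A :: 'a::comm_semiring_1 mat) \<longleftrightarrow> rinv (transpose_mat A)"
proof
  assume "linv A"
  then obtain B where B: "B \<in> carrier_mat (dim_col A) (dim_row A)" "B * A = 1\<^sub>m (dim_col A)"
    unfolding linv_def by auto
  have "transpose_mat A * transpose_mat B = transpose_mat (B * A)"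
    by (rule transpose_mult[symmetric, OF B(1) carrier_matI[OF refl refl]])
  with B show "rinv (transpose_mat A)" unfolding rinv_def
    by (intro bexI[of _ "transpose_mat B"]) auto
next
  assume "rinv (transpose_mat A)"
  then obtain B where B: "B \<in> carrier_mat (dim_row A) (dim_col A)" "transpose_mat A * B = 1\<^sub>m (dim_col A)"
    unfolding rinv_def by auto
  have "transpose_mat (transpose_mat A * B) = transpose_mat B * transpose_mat (transpose_mat A)"
    by (rule transpose_mult[OF _ B(1), where nr = "dim_col A"]) simp
  with B show "linv A" unfolding linv_def
    by (intro bexI[of _ "transpose_mat B"]) auto
qed

text \<open>For the converse, a functional that kills the columns of a surjective \<open>A\<close>
  kills every vector, hence is zero.\<close>

lemma rinv_iff_surj:
  fixes A :: "'a::field mat"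
  assumes A: "A \<in> carrier_mat r c"
  shows "rinv A \<longleftrightarrow> (\<forall>y\<in>carrier_vec r. \<exists>x\<in>carrier_vec c. A *\<^sub>v x = y)"
proof
  assume "rinv A"
  then obtain B where B: "B \<in> carrier_mat c r" "A * B = 1\<^sub>m r" using A unfolding rinv_def by auto
  show "\<forall>y\<in>carrier_vec r. \<exists>x\<in>carrier_vec c. A *\<^sub>v x = y"
  proof
    fix y :: "'a vec" assume y: "y \<in> carrier_vec r"
    have "A *\<^sub>v (B *\<^sub>v y) = (A * B) *\<^sub>v y" using A B y by (intro assoc_mult_mat_vec[symmetric])
    also have "\<dots> = y" unfolding B(2) using y by simp
    finally show "\<exists>x\<in>carrier_vec c. A *\<^sub>v x = y" using B y by (intro bexI[of _ "B *\<^sub>v y"]) auto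
  qed
next
  assume s: "\<forall>y\<in>carrier_vec r. \<exists>x\<in>carrier_vec c. A *\<^sub>v x = y"
  show "rinv A"
  proof (rule ccontr)
    assume "\<not> rinv A"
    then obtain y where y: "y \<in> carrier_mat 1 r" "y * A = 0\<^sub>m 1 c" "y \<noteq> 0\<^sub>m 1 r"
      using not_rinv_functional A by blast
    have "row y 0 \<bullet> v = 0" if "v \<in> carrier_vec r" for v
    proof -
      from s that obtain x where x: "x \<in> carrier_vec c" "A *\<^sub>v x = v" by auto
      have "y *\<^sub>v v = (y * A) *\<^sub>v x"
        unfolding x(2)[symmetric] by (rule assoc_mult_mat_vec[symmetric, OF y(1) A x(1)])
      also have "\<dots> = 0\<^sub>v 1" using y x by (auto intro!: eq_vecI simp: scalar_prod_def)
      finally have "(y *\<^sub>v v) $ 0 = 0" by simp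
      then show ?thesis using y by simp
    qed
    then have "row y 0 \<bullet> unit_vec r i = 0" for i by simp
    then have "row y 0 $ i = 0" if "i < r" for i
      using that y(1) scalar_prod_right_unit[of i r "row y 0"] by auto
    then have "y = 0\<^sub>m 1 r" using y(1) by (intro eq_matI) auto
    with y show False by simp
  qed
qed

lemma linv_iff_inj:
  fixes A :: "'a::field mat"
  assumes A: "A \<in> carrier_mat r c"
  shows "linv A \<longleftrightarrow> (\<forall>x\<in>carrier_vec c. A *\<^sub>v x = 0\<^sub>v r \<longrightarrow> x = 0\<^sub>v c)"
proof
  assume "linv A"
  then obtain B where B: "B \<in> carrier_mat c r" "B * A = 1\<^sub>m c" using A unfolding linv_def by auto
  show "\<forall>x\<in>carrier_vec c. A *\<^sub>v x = 0\<^sub>v r \<longrightarrow> x = 0\<^sub>v c"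
  proof (intro ballI impI)
    fix x :: "'a vec" assume x: "x \<in> carrier_vec c" "A *\<^sub>v x = 0\<^sub>v r"
    have "x = (B * A) *\<^sub>v x" unfolding B(2) using x(1) by simp
    also have "\<dots> = B *\<^sub>v (A *\<^sub>v x)" using A B x(1) by (intro assoc_mult_mat_vec)
    also have "\<dots> = 0\<^sub>v c" using x B by (auto intro!: eq_vecI simp: scalar_prod_def)
    finally show "x = 0\<^sub>v c" .
  qed
next
  assume s: "\<forall>x\<in>carrier_vec c. A *\<^sub>v x = 0\<^sub>v r \<longrightarrow> x = 0\<^sub>v c"
  show "linv A"
  proof (rule ccontr)
    assume "\<not> linv A"
    \<comment> \<open>Transposition turns a functional killing \<open>transpose_mat A\<close> into a
      kernel vector of \<open>A\<close>, namely \<open>row y 0\<close>.\<close>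
    then have "\<not> rinv (transpose_mat A)" by (simp add: linv_transpose)
    then obtain y where y: "y \<in> carrier_mat 1 c" "y * transpose_mat A = 0\<^sub>m 1 r" "y \<noteq> 0\<^sub>m 1 c"
      using not_rinv_functional[of "transpose_mat A" c r] A by auto
    have "A *\<^sub>v row y 0 = 0\<^sub>v r"
    proof (rule eq_vecI)
      fix i assume i: "i < dim_vec (0\<^sub>v r :: 'a vec)"
      have "(A *\<^sub>v row y 0) $ i = row A i \<bullet> row y 0" using i A y by simp
      also have "\<dots> = row y 0 \<bullet> row A i" using A y by (intro comm_scalar_prod[of _ c]) auto
      also have "\<dots> = (y * transpose_mat A) $$ (0, i)" using i A y(1) by simp
      finally show "(A *\<^sub>v row y 0) $ i = 0\<^sub>v r $ i" unfolding y(2) using i by simp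
    qed (use A in auto)
    with s y(1) have "row y 0 = 0\<^sub>v c" by auto
    have "y $$ (0, i) = 0" if "i < c" for i
    proof -
      have "y $$ (0, i) = row y 0 $ i" using that y(1) by simp
      then show ?thesis unfolding \<open>row y 0 = 0\<^sub>v c\<close> using that by simp
    qed
    then have "y = 0\<^sub>m 1 c" using y(1) by (intro eq_matI) auto
    with y show False by simp
  qed
qed

lemma rinv_one [simp]: "rinv (1\<^sub>m n)"
  unfolding rinv_def by (intro bexI[of _ "1\<^sub>m n"]) auto

lemma linv_one [simp]: "linv (1\<^sub>m n)"
  unfolding linv_def by (intro bexI[of _ "1\<^sub>m n"]) auto

lemma rinv_no_rows: "dim_row A = 0 \<Longrightarrow> rinv A"
  unfolding rinv_def by (intro bexI[of _ "0\<^sub>m (dim_col A) 0"]) (auto intro: eq_matI)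

lemma linv_no_cols: "dim_col A = 0 \<Longrightarrow> linv A"
  unfolding linv_def by (intro bexI[of _ "0\<^sub>m 0 (dim_row A)"]) (auto intro: eq_matI)

lemma rinv_cancel:
  assumes "rinv A" "B * A = C * A" "dim_col B = dim_row A" "dim_col C = dim_row A"
  shows "B = C"
proof -
  from assms(1) obtain R where R: "R \<in> carrier_mat (dim_col A) (dim_row A)" "A * R = 1\<^sub>m (dim_row A)"
    unfolding rinv_def by auto
  have "B * (A * R) = C * (A * R)" using assms R(1) by (simp flip: mult_assoc_dim)
  then show ?thesis using R assms by simp
qed

lemma rinv_block_diag:
  assumes "rinv A" "rinv B" shows "rinv (block_diag A B)"
proof -
  from assms obtain R S where "R \<in> carrier_mat (dim_col A) (dim_row A)" "A * R = 1\<^sub>m (dim_row A)"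
    "S \<in> carrier_mat (dim_col B) (dim_row B)" "B * S = 1\<^sub>m (dim_row B)"
    unfolding rinv_def by auto
  then show ?thesis unfolding rinv_def
    by (intro bexI[of _ "block_diag R S"]) (auto simp: block_diag_mult block_diag_one)
qed

lemma linv_block_diag:
  assumes "linv A" "linv B" shows "linv (block_diag A B)"
proof -
  from assms obtain R S where "R \<in> carrier_mat (dim_col A) (dim_row A)" "R * A = 1\<^sub>m (dim_col A)"
    "S \<in> carrier_mat (dim_col B) (dim_row B)" "S * B = 1\<^sub>m (dim_col B)"
    unfolding linv_def by auto
  then show ?thesis unfolding linv_def
    by (intro bexI[of _ "block_diag R S"]) (auto simp: block_diag_mult block_diag_one)
qed

lemma rinv_mult:
  assumes "rinv A" "rinv B" "dim_col A = dim_row B" shows "rinv (A * B)"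
proof -
  from assms obtain R S where RS: "R \<in> carrier_mat (dim_col A) (dim_row A)" "A * R = 1\<^sub>m (dim_row A)"
    "S \<in> carrier_mat (dim_col B) (dim_row B)" "B * S = 1\<^sub>m (dim_row B)"
    unfolding rinv_def by auto
  have "A * B * (S * R) = A * ((B * S) * R)" using RS(1,3) assms(3) by (simp add: mult_assoc_dim)
  then show ?thesis unfolding rinv_def using RS assms(3)
    by (intro bexI[of _ "S * R"]) auto
qed

lemma linv_mult:
  assumes "linv A" "linv B" "dim_col A = dim_row B" shows "linv (A * B)"
proof -
  from assms obtain R S where RS: "R \<in> carrier_mat (dim_col A) (dim_row A)" "R * A = 1\<^sub>m (dim_col A)"
    "S \<in> carrier_mat (dim_col B) (dim_row B)" "S * B = 1\<^sub>m (dim_col B)"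
    unfolding linv_def by auto
  have "S * R * (A * B) = S * ((R * A) * B)" using RS(1,3) assms(3) by (simp add: mult_assoc_dim)
  then show ?thesis unfolding linv_def using RS assms(3)
    by (intro bexI[of _ "S * R"]) auto
qed

text \<open>A unit column and a scaled unit row at a nonzero entry. For a nonzero path,
  \<open>x\<close> will generate a uniserial submodule and \<open>y\<close> will define the
  retraction onto it.\<close>

lemma nonzero_mat_pairing:
  fixes A :: "'a::field mat"
  assumes A: "A \<in> carrier_mat r c" "A \<noteq> 0\<^sub>m r c"
  obtains y x where "y \<in> carrier_mat 1 r" "x \<in> carrier_mat c 1" "y * (A * x) = 1\<^sub>m 1"
proof -
  have "\<exists>p q. p < r \<and> q < c \<and> A $$ (p, q) \<noteq> 0"
  proof (rule ccontr)
    assume "\<not> ?thesis"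
    then have "A = 0\<^sub>m r c" using A(1) by (intro eq_matI) auto
    with A(2) show False by simp
  qed
  then obtain p q where pq: "p < r" "q < c" "A $$ (p, q) \<noteq> 0" by auto
  let ?y = "mat 1 r (\<lambda>(i, j). if j = p then inverse (A $$ (p, q)) else 0)"
  let ?x = "mat c 1 (\<lambda>(i, j). if i = q then 1 else 0) :: 'a mat"
  have Ax: "A * ?x = mat r 1 (\<lambda>(i, j). A $$ (i, q))"
    using A pq by (intro eq_matI) (auto simp: scalar_prod_def if_distrib cong: if_cong)
  have "?y * (A * ?x) = 1\<^sub>m 1"
    unfolding Ax using A pq
    by (intro eq_matI) (auto simp: scalar_prod_def if_distribR if_distrib[of "\<lambda>x. x * _"] cong: if_cong)
  then show ?thesis using that[of ?y ?x] by simp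
qed




text \<open>With \<open>b\<^sub>p \<noteq> 0\<close>, the standard basis vectors \<open>e\<^sub>q\<close>, \<open>q \<noteq> p\<close>, project to a basis of the kernel
  of \<open>a\<close>; \<open>J\<close> is the inclusion of their span.\<close>
lemma split_off_line:
  fixes a b :: "'k::field mat"
  assumes a: "a \<in> carrier_mat 1 n" and b: "b \<in> carrier_mat n 1" and ab: "a * b = 1\<^sub>m 1"
  obtains c C D where "C \<in> carrier_mat c n" "D \<in> carrier_mat n c" "C * D = 1\<^sub>m c" "b * a + D * C = 1\<^sub>m n"
proof -
  have "\<exists>p<n. b $$ (p, 0) \<noteq> 0"
  proof (rule ccontr)
    assume "\<not> ?thesis"
    then have "b = 0\<^sub>m n 1" using b by (intro eq_matI) auto
    with ab a show False using one_mat_neq_zero[of 1, where 'a='k] by auto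
  qed
  then obtain p where p: "p < n" "b $$ (p, 0) \<noteq> 0" by auto
  \<comment> \<open>\<open>sk\<close> enumerates the indices other than \<open>p\<close> in
    increasing order.\<close>
  define sk where "sk q = (if q < p then q else Suc q)" for q
  define J where "J = mat n (n - 1) (\<lambda>(i, q). if i = sk q then 1 else 0 :: 'k)"
  define J' where "J' = mat (n - 1) n (\<lambda>(q, i). if i = sk q then 1 else 0 :: 'k)"
  \<comment> \<open>This functional has \<open>e * b = 1\<close>, and its kernel is the image of
    \<open>J\<close>.\<close>
  define e where "e = mat 1 n (\<lambda>(i, j). if j = p then inverse (b $$ (p, 0)) else 0)"
  have sk: "sk q < n" "sk q \<noteq> p" if "q < n - 1" for q using that by (auto simp: sk_def)
  have sk_inj: "sk q = sk q' \<longleftrightarrow> q = q'" for q q' by (auto simp: sk_def)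
  have sk_ex: "\<exists>q<n - 1. sk q = i" if "i < n" "i \<noteq> p" for i
  proof (cases "i < p")
    case True then show ?thesis using that p by (intro exI[of _ i]) (auto simp: sk_def)
  next
    case False then show ?thesis using that p by (intro exI[of _ "i - 1"]) (auto simp: sk_def)
  qed
  have dims [simp]: "dim_row J = n" "dim_col J = n - 1" "dim_row J' = n - 1" "dim_col J' = n"
    "dim_row e = 1" "dim_col e = n" "dim_row a = 1" "dim_col a = n" "dim_row b = n" "dim_col b = 1"
    using a b by (auto simp: J_def J'_def e_def)
  have J'J: "J' * J = 1\<^sub>m (n - 1)"
    by (rule eq_matI) (auto simp: J_def J'_def scalar_prod_def sk sk_inj if_distrib[of "\<lambda>x. x * _"] cong: if_cong)
  have eJ: "e * J = 0\<^sub>m 1 (n - 1)"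
    by (rule eq_matI) (use sk in \<open>auto simp: J_def e_def scalar_prod_def intro!: sum.neutral\<close>)
  have eb: "e * b = 1\<^sub>m 1"
    using p by (intro eq_matI) (auto simp: e_def scalar_prod_def if_distrib[of "\<lambda>x. x * _"] cong: if_cong)
  have proj: "(1\<^sub>m n - b * e) $$ (i, l) = (if i = l then 1 else 0) -
       (if l = p then b $$ (i, 0) * inverse (b $$ (p, 0)) else 0)" if "i < n" "l < n" for i l
    using that by (simp add: e_def scalar_prod_def)
  have JJ': "J * J' = mat n n (\<lambda>(i, l). if i = l \<and> i \<noteq> p then 1 else 0)"
  proof (rule eq_matI)
    fix i l assume il: "i < dim_row (mat n n (\<lambda>(i, l). if i = l \<and> i \<noteq> p then 1 else 0 :: 'k))"
      "l < dim_col (mat n n (\<lambda>(i, l). if i = l \<and> i \<noteq> p then 1 else 0 :: 'k))"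
    have "(J * J') $$ (i, l) = (\<Sum>q = 0..<n - 1. (if i = sk q then 1 else 0) * (if l = sk q then 1 else 0))"
      using il by (simp add: J_def J'_def scalar_prod_def)
    also have "\<dots> = (if i = l \<and> i \<noteq> p then 1 else 0)"
    proof (cases "i = p")
      case True
      then have "(\<Sum>q = 0..<n - 1. (if i = sk q then 1 else 0) * (if l = sk q then 1 else 0)) = (0 :: 'k)"
        by (intro sum.neutral ballI) (metis atLeastLessThan_iff mult_zero_left sk(2))
      then show ?thesis using True by simp
    next
      case False
      with il sk_ex obtain q0 where q0: "q0 < n - 1" "sk q0 = i" by auto
      have "(\<Sum>q = 0..<n - 1. (if i = sk q then 1 else 0) * (if l = sk q then 1 else 0))
          = (\<Sum>q = 0..<n - 1. if q = q0 then (if l = i then 1 else 0 :: 'k) else 0)"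
        using q0 by (intro sum.cong) (auto simp: sk_inj)
      then show ?thesis using q0 False by auto
    qed
    finally show "(J * J') $$ (i, l) = mat n n (\<lambda>(i, l). if i = l \<and> i \<noteq> p then 1 else 0) $$ (i, l)"
      using il by simp
  qed auto
  \<comment> \<open>Row \<open>p\<close> of \<open>1 - b e\<close> vanishes, since \<open>e\<close>
    divides by \<open>b $$ (p, 0)\<close>; hence erasing coordinate \<open>p\<close> changes
    nothing.\<close>
  have P: "J * J' * (1\<^sub>m n - b * e) = 1\<^sub>m n - b * e"
  proof (rule eq_matI)
    fix i l assume il: "i < dim_row (1\<^sub>m n - b * e)" "l < dim_col (1\<^sub>m n - b * e)"
    then have il': "i < n" "l < n" by auto
    have "(J * J' * (1\<^sub>m n - b * e)) $$ (i, l) = (\<Sum>q = 0..<n. (J * J') $$ (i, q) * (1\<^sub>m n - b * e) $$ (q, l))"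
      using il' by (simp add: scalar_prod_def)
    also have "\<dots> = (\<Sum>q = 0..<n. if q = i then (if i \<noteq> p then (1\<^sub>m n - b * e) $$ (i, l) else 0) else 0)"
      using il' by (intro sum.cong) (auto simp: JJ' simp del: index_minus_mat)
    also have "\<dots> = (if i \<noteq> p then (1\<^sub>m n - b * e) $$ (i, l) else 0)" using il' by simp
    also have "\<dots> = (1\<^sub>m n - b * e) $$ (i, l)" using il' p by (simp only: proj) auto
    finally show "(J * J' * (1\<^sub>m n - b * e)) $$ (i, l) = (1\<^sub>m n - b * e) $$ (i, l)" .
  qed auto
  \<comment> \<open>The kernels of \<open>e\<close> and of \<open>a\<close> are both complements of
    the line spanned by \<open>b\<close>, and the projections along \<open>b\<close> identify them.
    \<open>D\<close> carries the coordinates of the former kernel into the latter, \<open>C\<close>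
    leads back.\<close>
  define C where "C = J' * (1\<^sub>m n - b * e)"
  define D where "D = (1\<^sub>m n - b * a) * J"
  have dist: "(1\<^sub>m n - b * x) * y = y - b * (x * y)" if "x \<in> carrier_mat 1 n" "y \<in> carrier_mat n l" for x y l
    using that b by (simp add: minus_mult_distrib_mat[of _ n n _ y l] mult_assoc_dim)
  have be_b: "(1\<^sub>m n - b * e) * b = 0\<^sub>m n 1"
    using dist[of e b 1] eb b by (auto simp: carrier_matI)
  have ba_b: "(1\<^sub>m n - b * a) * b = 0\<^sub>m n 1"
    using dist[of a b 1] ab b a by auto
  have rdist: "y * (1\<^sub>m n - b * x) = y - (y * b) * x" if "x \<in> carrier_mat 1 n" "y \<in> carrier_mat l n" for x y l
    using that b by (simp add: mult_minus_distrib_mat[of y l n _ n] mult_assoc_dim)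
  have "(1\<^sub>m n - b * e) * (1\<^sub>m n - b * a) = 1\<^sub>m n - b * e"
    using rdist[of a "1\<^sub>m n - b * e" n] a be_b by (auto simp: carrier_matI)
  then have "(1\<^sub>m n - b * e) * ((1\<^sub>m n - b * a) * J) = (1\<^sub>m n - b * e) * J"
    by (subst mult_assoc_dim[symmetric]) auto
  then have "C * D = J' * ((1\<^sub>m n - b * e) * J)"
    unfolding C_def D_def by (subst mult_assoc_dim) auto
  also have "(1\<^sub>m n - b * e) * J = J"
    using dist[of e J "n - 1"] eJ by (auto simp: carrier_matI)
  finally have CD: "C * D = 1\<^sub>m (n - 1)" using J'J by simp
  have "D * C = (1\<^sub>m n - b * a) * (J * J' * (1\<^sub>m n - b * e))"
    unfolding C_def D_def by (simp add: mult_assoc_dim)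
  also have "\<dots> = 1\<^sub>m n - b * a"
    unfolding P using rdist[of e "1\<^sub>m n - b * a" n] ba_b by (auto simp: carrier_matI)
  finally have DC: "b * a + D * C = 1\<^sub>m n" by (auto intro!: eq_matI)
  show ?thesis
    by (rule that[of C "n - 1" D, OF _ _ CD DC]) (auto simp: C_def D_def carrier_matI)
qed

section \<open>Representations of the cyclic quiver\<close>

locale cyclic_quiver =
  fixes Q :: params
  assumes m_pos: "0 < mm Q"
begin

text \<open>Vertices are addressed by integer positions on the universal cover, an infinite line.
  Arrows then lower the position by one, without a case distinction at vertex 1.\<close>

abbreviation vt :: "int \<Rightarrow> nat" where "vt \<equiv> vtx Q"

lemma vt_eq_iff: "vt s = vt t \<longleftrightarrow> int (mm Q) dvd s - t"
proof -
  have "vt s = vt t \<longleftrightarrow> (s - 1) mod int (mm Q) = (t - 1) mod int (mm Q)"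
    unfolding vtx_def using m_pos by (simp add: nat_eq_iff)
  then show ?thesis by (simp add: mod_eq_dvd_iff)
qed

lemma vt_shift: "vt s = vt t \<Longrightarrow> vt (s + k) = vt (t + k)"
  by (simp add: vt_eq_iff)

lemma vt_shift_minus: "vt s = vt t \<Longrightarrow> vt (s - k) = vt (t - k)"
  by (simp add: vt_eq_iff)

lemma vt_in_V [simp]: "vt t \<in> V Q"
proof -
  have "(t - 1) mod int (mm Q) < int (mm Q)" using m_pos by simp
  then show ?thesis unfolding V_def vtx_def by (simp add: nat_less_iff Suc_le_eq m_pos)
qed

lemma vt_of_V: "v \<in> V Q \<Longrightarrow> vt (int v) = v"
  unfolding V_def vtx_def by (auto simp: nat_diff_distrib)

lemma int_vt: "vt (int (vt t)) = vt t"
  by (simp add: vt_of_V)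

lemma tgt_vt [simp]: "tgt Q (vt t) = vt (t - 1)"
  unfolding tgt_def by (rule vt_shift_minus) (rule int_vt)

lemma inarr_vt [simp]: "inarr Q (vt t) = vt (t + 1)"
  unfolding inarr_def by (rule vt_shift) (rule int_vt)

lemma ball_V: "(\<forall>v\<in>V Q. P v) \<longleftrightarrow> (\<forall>t. P (vt t))"
  by (metis vt_in_V vt_of_V)

text \<open>The start \<open>i\<close> of the window is free. If it is the socle position of a
  uniserial module \<open>Mt i j\<close> of length at most \<open>m\<close>, the module lives
  exactly at the positions of the window up to \<open>j\<close>.\<close>

lemma ball_V_window: "(\<forall>v\<in>V Q. P v) \<longleftrightarrow> (\<forall>t. i \<le> t \<and> t < i + int (mm Q) \<longrightarrow> P (vt t))"
proof -
  have "\<exists>s. i \<le> s \<and> s < i + int (mm Q) \<and> vt s = vt t" for t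
  proof (intro exI conjI)
    show "i \<le> i + (t - i) mod int (mm Q)" using m_pos by simp
    show "i + (t - i) mod int (mm Q) < i + int (mm Q)" using m_pos by simp
    have "i + (t - i) mod int (mm Q) - t = - ((t - i) - (t - i) mod int (mm Q))" by simp
    then show "vt (i + (t - i) mod int (mm Q)) = vt t"
      unfolding vt_eq_iff by (metis dvd_minus_iff dvd_minus_mod)
  qed
  then show ?thesis unfolding ball_V by metis
qed

text \<open>The part of \<open>is_mod\<close> about matrix formats. It is separated from the
  relations because arguments on paths and morphisms mostly rest on the formats alone.\<close>

definition shaped :: "'k::field rep \<Rightarrow> bool" where
  "shaped M \<longleftrightarrow> (\<forall>t. mapv M (vt t) \<in> carrier_mat (dimv M (vt (t - 1))) (dimv M (vt t)))"

lemma shaped_carrier: "shaped M \<Longrightarrow> mapv M (vt t) \<in> carrier_mat (dimv M (vt (t - 1))) (dimv M (vt t))"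
  by (simp add: shaped_def)

lemma shaped_dim:
  assumes "shaped M"
  shows "dim_row (mapv M (vt t)) = dimv M (vt (t - 1))" "dim_col (mapv M (vt t)) = dimv M (vt t)"
  using shaped_carrier[OF assms, of t] by auto

lemma is_mod_shaped: "is_mod Q M \<Longrightarrow> shaped M"
  unfolding is_mod_def shaped_def ball_V by simp

lemma pathm_dim:
  assumes "shaped M"
  shows "dim_row (pathm Q M t L) = dimv M (vt (t - int L))" "dim_col (pathm Q M t L) = dimv M (vt t)"
proof -
  have "dim_row (pathm Q M t L) = dimv M (vt (t - int L)) \<and> dim_col (pathm Q M t L) = dimv M (vt t)"
    by (induction L) (auto simp: shaped_dim[OF assms] algebra_simps)
  then show "dim_row (pathm Q M t L) = dimv M (vt (t - int L))" "dim_col (pathm Q M t L) = dimv M (vt t)"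
    by auto
qed

lemma pathm_add:
  assumes "shaped M"
  shows "pathm Q M t (a + b) = pathm Q M (t - int a) b * pathm Q M t a"
proof (induction b)
  case 0
  show ?case using pathm_dim[OF assms] by simp
next
  case (Suc b)
  have "pathm Q M t (a + Suc b) = mapv M (vt (t - int (a + b))) * (pathm Q M (t - int a) b * pathm Q M t a)"
    using Suc by simp
  also have "\<dots> = mapv M (vt (t - int (a + b))) * pathm Q M (t - int a) b * pathm Q M t a"
    by (rule mult_assoc_dim[symmetric]) (simp_all add: pathm_dim[OF assms] shaped_dim[OF assms] algebra_simps)
  finally show ?case by (simp add: algebra_simps)
qed

lemma pathm_one: "shaped M \<Longrightarrow> pathm Q M t 1 = mapv M (vt t)"
  by (simp add: shaped_dim)

lemma pathm_Suc_right:
  assumes "shaped M"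
  shows "pathm Q M t (Suc L) = pathm Q M (t - 1) L * mapv M (vt t)"
  using pathm_add[OF assms, of t 1 L] pathm_one[OF assms, of t] by simp

lemma pathm_cong: "vt s = vt t \<Longrightarrow> pathm Q M s L = pathm Q M t L"
  by (induction L) (simp_all add: vt_shift_minus[of s t])

lemma kills_cong: "vt s = vt t \<Longrightarrow> kills Q M s L = kills Q M t L"
  unfolding kills_def by (simp add: pathm_cong[of s t] vt_shift_minus[of s t])

lemma pathm_zero_mono:
  assumes "shaped M" "pathm Q M t a = 0\<^sub>m r c" "a \<le> b"
  shows "kills Q M t b"
proof -
  have "b = a + (b - a)" using assms by simp
  then have "pathm Q M t b = pathm Q M (t - int a) (b - a) * 0\<^sub>m r c"
    using pathm_add[OF assms(1), of t a "b - a"] assms(2) by simp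
  moreover have "dim_col (pathm Q M (t - int a) (b - a)) = r"
    using pathm_dim[OF assms(1), of t a] pathm_dim(2)[OF assms(1), of "t - int a"] assms(2) by simp
  moreover have "c = dimv M (vt t)" using pathm_dim(2)[OF assms(1), of t a] assms(2) by simp
  ultimately show ?thesis
    using pathm_dim(1)[OF assms(1), of "t - int a" "b - a"] \<open>a \<le> b\<close> unfolding kills_def by simp
qed

text \<open>Meant for the lowest vertices of a piece, whose vanishing path ends in the relation of
  length two at the junction.\<close>

lemma pathm_zero_mono_end:
  assumes "shaped M" "kills Q M (t - int a) b"
  shows "kills Q M t (a + b)"
  using assms(2) pathm_dim[OF assms(1), of t a] unfolding kills_def pathm_add[OF assms(1)]
  by (simp add: algebra_simps)

section \<open>Morphisms, isomorphisms and retracts\<close>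

lemma morph_iff: "morph Q f X Y \<longleftrightarrow> (\<forall>t. f (vt t) \<in> carrier_mat (dimv Y (vt t)) (dimv X (vt t)) \<and>
    f (vt (t - 1)) * mapv X (vt t) = mapv Y (vt t) * f (vt t))"
  unfolding morph_def ball_V by simp

lemma morph_dim:
  assumes "morph Q f X Y"
  shows "dim_row (f (vt t)) = dimv Y (vt t)" "dim_col (f (vt t)) = dimv X (vt t)"
  using assms unfolding morph_iff by auto

lemma morph_carrier: "morph Q f X Y \<Longrightarrow> f (vt t) \<in> carrier_mat (dimv Y (vt t)) (dimv X (vt t))"
  unfolding morph_iff by auto

lemma morph_commute: "morph Q f X Y \<Longrightarrow> f (vt (t - 1)) * mapv X (vt t) = mapv Y (vt t) * f (vt t)"
  unfolding morph_iff by auto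

lemma eqon_iff: "eqon Q f g \<longleftrightarrow> (\<forall>t. f (vt t) = g (vt t))"
  unfolding eqon_def ball_V ..

lemma surj_m_iff:
  assumes "morph Q f X Y"
  shows "surj_m Q f X Y \<longleftrightarrow> (\<forall>t. rinv (f (vt t)))"
  unfolding surj_m_def ball_V using rinv_iff_surj[OF morph_carrier[OF assms]] by simp

lemma inj_m_iff:
  assumes "morph Q f X Y"
  shows "inj_m Q f X Y \<longleftrightarrow> (\<forall>t. linv (f (vt t)))"
  unfolding inj_m_def ball_V using linv_iff_inj[OF morph_carrier[OF assms]] by simp

lemma top_nz_iff: "shaped M \<Longrightarrow> top_nz Q M (vt t) \<longleftrightarrow> \<not> rinv (mapv M (vt (t + 1)))"
  unfolding top_nz_def using rinv_iff_surj[OF shaped_carrier[of M "t + 1"]] by simp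

lemma soc_nz_iff: "shaped M \<Longrightarrow> soc_nz Q M (vt t) \<longleftrightarrow> \<not> linv (mapv M (vt t))"
  unfolding soc_nz_def using linv_iff_inj[OF shaped_carrier[of M t]] by auto

lemma morph_pathm:
  assumes "shaped X" "shaped Y" "morph Q f X Y"
  shows "f (vt (t - int L)) * pathm Q X t L = pathm Q Y t L * f (vt t)"
proof (induction L)
  case 0
  show ?case using morph_dim[OF assms(3)] by simp
next
  case (Suc L)
  note d [simp] = morph_dim[OF assms(3)] shaped_dim[OF assms(1)] shaped_dim[OF assms(2)]
    pathm_dim[OF assms(1)] pathm_dim[OF assms(2)]
  let ?s = "t - int L"
  have s: "t - int (Suc L) = ?s - 1" by simp
  have "f (vt (?s - 1)) * (mapv X (vt ?s) * pathm Q X t L) = f (vt (?s - 1)) * mapv X (vt ?s) * pathm Q X t L"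
    by (rule mult_assoc_dim[symmetric]) simp_all
  also have "\<dots> = mapv Y (vt ?s) * f (vt ?s) * pathm Q X t L"
    using morph_commute[OF assms(3), of ?s] by simp
  also have "\<dots> = mapv Y (vt ?s) * (pathm Q Y t L * f (vt t))"
    unfolding Suc[symmetric] by (rule mult_assoc_dim) simp_all
  also have "\<dots> = mapv Y (vt ?s) * pathm Q Y t L * f (vt t)"
    by (rule mult_assoc_dim[symmetric]) simp_all
  finally show ?case unfolding s by simp
qed

lemma morph_comp:
  assumes "shaped X" "shaped Y" "shaped Z" "morph Q f X Y" "morph Q g Y Z"
  shows "morph Q (comp g f) X Z"
  unfolding morph_iff
proof (intro allI conjI)
  note d [simp] = morph_dim[OF assms(4)] morph_dim[OF assms(5)]
    shaped_dim[OF assms(1)] shaped_dim[OF assms(2)] shaped_dim[OF assms(3)]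
  fix t
  show "comp g f (vt t) \<in> carrier_mat (dimv Z (vt t)) (dimv X (vt t))"
    unfolding comp_def by (rule carrier_matI) simp_all
  have "g (vt (t - 1)) * f (vt (t - 1)) * mapv X (vt t) = g (vt (t - 1)) * (mapv Y (vt t) * f (vt t))"
    unfolding morph_commute[OF assms(4), symmetric] by (rule mult_assoc_dim) simp_all
  also have "\<dots> = mapv Z (vt t) * g (vt t) * f (vt t)"
    unfolding morph_commute[OF assms(5), symmetric] by (rule mult_assoc_dim[symmetric]) simp_all
  also have "\<dots> = mapv Z (vt t) * (g (vt t) * f (vt t))" by (rule mult_assoc_dim) simp_all
  finally show "comp g f (vt (t - 1)) * mapv X (vt t) = mapv Z (vt t) * comp g f (vt t)"
    unfolding comp_def .
qed

lemma morph_id: "shaped X \<Longrightarrow> morph Q (idm X) X X"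
  unfolding morph_iff idm_def by (simp add: shaped_dim)

lemma eqon_comp_idm: "eqon Q (comp g f) (idm X) \<longleftrightarrow> (\<forall>t. g (vt t) * f (vt t) = 1\<^sub>m (dimv X (vt t)))"
  unfolding eqon_iff comp_def idm_def ..

lemma comp_inverse:
  assumes "g * f = 1\<^sub>m n" "g' * f' = 1\<^sub>m k" "dim_col g' = dim_row g" "dim_row f' = dim_col f" 
    "dim_row f = dim_col g" "n = dim_col f"
  shows "(g' * g) * (f * f') = (1\<^sub>m k :: 'a::semiring_1 mat)"
proof -
  have "(g' * g) * (f * f') = g' * ((g * f) * f')" using assms(3-5) by (simp add: mult_assoc_dim)
  also have "\<dots> = g' * f'" unfolding assms(1) using assms(4,6) by simp
  finally show ?thesis using assms(2) by simp
qed

text \<open>A single morphism does not control the format of the matrices of its source and target, but an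
  isomorphism does, since it gives morphisms in both directions.\<close>
lemma iso_shaped:
  assumes "iso Q X Y" shows "shaped X" "shaped Y"
proof -
  from assms obtain f g where fg: "morph Q f X Y" "morph Q g Y X" unfolding iso_def by auto
  note d = morph_dim[OF fg(1)] morph_dim[OF fg(2)]
  have "dim_row (mapv X (vt t)) = dimv X (vt (t - 1)) \<and> dim_row (mapv Y (vt t)) = dimv Y (vt (t - 1)) \<and>
     dim_col (mapv X (vt t)) = dimv X (vt t) \<and> dim_col (mapv Y (vt t)) = dimv Y (vt t)" for t
    using arg_cong[OF morph_commute[OF fg(1), of t], of dim_row]
      arg_cong[OF morph_commute[OF fg(1), of t], of dim_col]
      arg_cong[OF morph_commute[OF fg(2), of t], of dim_row]
      arg_cong[OF morph_commute[OF fg(2), of t], of dim_col] by (simp add: d)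
  then show "shaped X" "shaped Y" unfolding shaped_def by (auto intro: carrier_matI)
qed

lemma iso_sym: "iso Q X Y \<Longrightarrow> iso Q Y X"
  unfolding iso_def by blast

lemma iso_trans:
  assumes "iso Q X Y" "iso Q Y Z" shows "iso Q X Z"
proof -
  note s = iso_shaped[OF assms(1)] iso_shaped(2)[OF assms(2)]
  from assms obtain f g f' g' where f: "morph Q f X Y" "morph Q g Y X" "morph Q f' Y Z" "morph Q g' Z Y"
    and e: "eqon Q (comp g f) (idm X)" "eqon Q (comp f g) (idm Y)"
      "eqon Q (comp g' f') (idm Y)" "eqon Q (comp f' g') (idm Z)" unfolding iso_def by auto
  note d [simp] = f[THEN morph_dim(1)] f[THEN morph_dim(2)]
  have "comp (comp g g') (comp f' f) (vt t) = 1\<^sub>m (dimv X (vt t))" for t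
    unfolding comp_def using e unfolding eqon_comp_idm by (intro comp_inverse) simp_all
  moreover have "comp (comp f' f) (comp g g') (vt t) = 1\<^sub>m (dimv Z (vt t))" for t
    unfolding comp_def using e unfolding eqon_comp_idm by (intro comp_inverse) simp_all
  ultimately show ?thesis unfolding iso_def using f s
    by (intro exI[of _ "comp f' f"] exI[of _ "comp g g'"] conjI morph_comp) (auto simp: eqon_iff idm_def)
qed

lemma retract_kills:
  assumes "shaped X" "shaped Y" "morph Q f X Y" "morph Q g Y X" "eqon Q (comp g f) (idm X)" "kills Q Y t L"
  shows "kills Q X t L"
proof -
  note d [simp] = morph_dim[OF assms(3)] morph_dim[OF assms(4)] pathm_dim[OF assms(1)] pathm_dim[OF assms(2)]
  let ?s = "t - int L"
  have "pathm Q X t L = (g (vt ?s) * f (vt ?s)) * pathm Q X t L"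
    using assms(5) unfolding eqon_comp_idm by simp
  also have "\<dots> = g (vt ?s) * (pathm Q Y t L * f (vt t))"
    unfolding morph_pathm[OF assms(1-3), symmetric] by (rule mult_assoc_dim) simp_all
  also have "\<dots> = 0\<^sub>m (dimv X (vt ?s)) (dimv X (vt t))"
    using assms(6) unfolding kills_def by simp
  finally show ?thesis unfolding kills_def .
qed

lemma retract_is_mod:
  assumes "shaped X" "is_mod Q Y" "morph Q f X Y" "morph Q g Y X" "eqon Q (comp g f) (idm X)"
  shows "is_mod Q X"
  using assms(2) retract_kills[OF assms(1) is_mod_shaped[OF assms(2)] assms(3-5)] assms(1)
  unfolding is_mod_def ball_V shaped_def by auto

lemma iso_is_mod: "iso Q X Y \<Longrightarrow> is_mod Q Y \<Longrightarrow> is_mod Q X"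
  using iso_shaped(1)[of X Y] retract_is_mod[of X Y] unfolding iso_def by blast

lemma retract_is_zero:
  assumes "morph Q f X Y" "morph Q g Y X" "eqon Q (comp g f) (idm X)" "is_zero Q Y"
  shows "is_zero Q X"
proof (rule ccontr)
  assume "\<not> is_zero Q X"
  then obtain t where t: "0 < dimv X (vt t)" unfolding is_zero_def ball_V by auto
  have "dimv Y (vt t) = 0" using assms(4) unfolding is_zero_def by simp
  then have "g (vt t) * f (vt t) = 0\<^sub>m (dimv X (vt t)) (dimv X (vt t))"
    using morph_dim[OF assms(1), of t] morph_dim[OF assms(2), of t]
    by (intro eq_matI) (simp_all add: scalar_prod_def)
  moreover have "g (vt t) * f (vt t) = 1\<^sub>m (dimv X (vt t))"
    using assms(3) unfolding eqon_comp_idm by simp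
  ultimately show False using one_mat_neq_zero[OF t, where 'a='a] by simp
qed

lemma iso_is_zero: "iso Q X Y \<Longrightarrow> is_zero Q X \<longleftrightarrow> is_zero Q Y"
  unfolding iso_def using retract_is_zero by blast

lemma iso_indec:
  assumes "iso Q X Y" "indec Q Y" shows "indec Q X"
  unfolding indec_def
proof (intro conjI notI)
  show "is_mod Q X" using assms iso_is_mod unfolding indec_def by blast
  show "is_zero Q X \<Longrightarrow> False" using assms iso_is_zero unfolding indec_def by blast
  assume "\<exists>A B. is_mod Q A \<and> is_mod Q B \<and> \<not> is_zero Q A \<and> \<not> is_zero Q B \<and> iso Q X (dsum Q A B)"
  then show False using assms(2) iso_trans[OF iso_sym[OF assms(1)]] unfolding indec_def by blast
qed

lemma iso_inverse_rinv_linv: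
  assumes "eqon Q (comp g f) (idm X)" "eqon Q (comp f g) (idm Y)" "morph Q f X Y" "morph Q g Y X"
  shows "rinv (f (vt t))" "linv (f (vt t))" "rinv (g (vt t))" "linv (g (vt t))"
proof -
  have "g (vt t) * f (vt t) = 1\<^sub>m (dimv X (vt t))" "f (vt t) * g (vt t) = 1\<^sub>m (dimv Y (vt t))"
    using assms(1,2) unfolding eqon_comp_idm by auto
  then show "rinv (f (vt t))" "linv (f (vt t))" "rinv (g (vt t))" "linv (g (vt t))"
    using morph_carrier[OF assms(3), of t] morph_carrier[OF assms(4), of t]
    unfolding rinv_def linv_def by auto
qed

text \<open>Tops and socles are read off from arrows that fail to be surjective or injective; this
  makes them invariants of the isomorphism class.\<close>

lemma iso_arrow_inv:
  assumes "iso Q X Y"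
  shows "rinv (mapv Y (vt t)) \<Longrightarrow> rinv (mapv X (vt t))" "linv (mapv Y (vt t)) \<Longrightarrow> linv (mapv X (vt t))"
proof -
  note s = iso_shaped[OF assms]
  from assms obtain f g where f: "morph Q f X Y" "morph Q g Y X"
    and e: "eqon Q (comp g f) (idm X)" "eqon Q (comp f g) (idm Y)" unfolding iso_def by auto
  note d [simp] = f[THEN morph_dim(1)] f[THEN morph_dim(2)] s[THEN shaped_dim(1)] s[THEN shaped_dim(2)]
  note inv = iso_inverse_rinv_linv[OF e f]
  have "mapv X (vt t) = (g (vt (t - 1)) * f (vt (t - 1))) * mapv X (vt t)"
    using e(1) unfolding eqon_comp_idm by simp
  also have "\<dots> = g (vt (t - 1)) * (mapv Y (vt t) * f (vt t))"
    unfolding morph_commute[OF f(1), symmetric] by (rule mult_assoc_dim) simp_all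
  finally have eq: "mapv X (vt t) = g (vt (t - 1)) * (mapv Y (vt t) * f (vt t))" .
  show "rinv (mapv Y (vt t)) \<Longrightarrow> rinv (mapv X (vt t))"
    unfolding eq by (intro rinv_mult inv) simp_all
  show "linv (mapv Y (vt t)) \<Longrightarrow> linv (mapv X (vt t))"
    unfolding eq by (intro linv_mult inv) simp_all
qed

section \<open>Direct sums and complements of retracts\<close>

lemma mapv_dsum: "shaped X \<Longrightarrow> shaped Y \<Longrightarrow> mapv (dsum Q X Y) (vt t) = block_diag (mapv X (vt t)) (mapv Y (vt t))"
  unfolding dsum_def block_diag_def by (simp add: shaped_dim)

lemma dimv_dsum: "dimv (dsum Q X Y) v = dimv X v + dimv Y v"
  unfolding dsum_def by simp

lemma shaped_dsum: "shaped X \<Longrightarrow> shaped Y \<Longrightarrow> shaped (dsum Q X Y)"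
  unfolding shaped_def[of "dsum Q X Y"]
  by (intro allI carrier_matI) (simp_all add: mapv_dsum dimv_dsum shaped_dim)

lemma shaped_zero_rep: "shaped zero_rep"
  unfolding shaped_def zero_rep_def by simp

lemma shaped_foldr_dsum: "(\<And>X. X \<in> set Xs \<Longrightarrow> shaped X) \<Longrightarrow> shaped (foldr (dsum Q) Xs zero_rep)"
  by (induction Xs) (simp_all add: shaped_zero_rep shaped_dsum)

lemma rinv_foldr_dsum:
  assumes "\<And>X. X \<in> set Xs \<Longrightarrow> shaped X" "\<And>X. X \<in> set Xs \<Longrightarrow> rinv (mapv X (vt t))"
  shows "rinv (mapv (foldr (dsum Q) Xs zero_rep) (vt t))"
  using assms
proof (induction Xs)
  case Nil
  then show ?case by (simp add: zero_rep_def rinv_no_rows)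
next
  case (Cons X Xs)
  then show ?case by (simp add: mapv_dsum shaped_foldr_dsum rinv_block_diag)
qed

lemma linv_foldr_dsum:
  assumes "\<And>X. X \<in> set Xs \<Longrightarrow> shaped X" "\<And>X. X \<in> set Xs \<Longrightarrow> linv (mapv X (vt t))"
  shows "linv (mapv (foldr (dsum Q) Xs zero_rep) (vt t))"
  using assms
proof (induction Xs)
  case Nil
  then show ?case by (simp add: zero_rep_def linv_no_cols)
next
  case (Cons X Xs)
  then show ?case by (simp add: mapv_dsum shaped_foldr_dsum linv_block_diag)
qed

lemma iso_dsum:
  assumes M: "shaped M" "shaped X" "shaped Y"
    and mo: "morph Q i1 X M" "morph Q p1 M X" "morph Q i2 Y M" "morph Q p2 M Y"
    and eq: "\<And>t. p1 (vt t) * i1 (vt t) = 1\<^sub>m (dimv X (vt t))" "\<And>t. p2 (vt t) * i2 (vt t) = 1\<^sub>m (dimv Y (vt t))"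
      "\<And>t. p1 (vt t) * i2 (vt t) = 0\<^sub>m (dimv X (vt t)) (dimv Y (vt t))"
      "\<And>t. p2 (vt t) * i1 (vt t) = 0\<^sub>m (dimv Y (vt t)) (dimv X (vt t))"
      "\<And>t. i1 (vt t) * p1 (vt t) + i2 (vt t) * p2 (vt t) = 1\<^sub>m (dimv M (vt t))"
  shows "iso Q M (dsum Q X Y)"
proof -
  note d [simp] = mo[THEN morph_dim(1)] mo[THEN morph_dim(2)] M[THEN shaped_dim(1)] M[THEN shaped_dim(2)]
  let ?f = "\<lambda>v. vstack (p1 v) (p2 v)"
  let ?g = "\<lambda>v. hstack (i1 v) (i2 v)"
  have "morph Q ?f M (dsum Q X Y)"
    unfolding morph_iff using mo(2,4)[THEN morph_commute]
    by (auto intro!: carrier_matI simp: dimv_dsum mapv_dsum M vstack_mult block_diag_mult_vstack)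
  moreover have "morph Q ?g (dsum Q X Y) M"
    unfolding morph_iff using mo(1,3)[THEN morph_commute]
    by (auto intro!: carrier_matI simp: dimv_dsum mapv_dsum M mult_hstack hstack_mult_block_diag)
  moreover have "eqon Q (comp ?g ?f) (idm M)"
    unfolding eqon_comp_idm using eq(5) by (simp add: hstack_mult_vstack)
  moreover have "eqon Q (comp ?f ?g) (idm (dsum Q X Y))"
    unfolding eqon_comp_idm using eq(1-4) by (simp add: vstack_mult_hstack dimv_dsum)
  ultimately show ?thesis unfolding iso_def by blast
qed

lemma dsum_retract_left:
  assumes "shaped X" "shaped Y"
  shows "\<exists>i p. morph Q i X (dsum Q X Y) \<and> morph Q p (dsum Q X Y) X \<and> eqon Q (comp p i) (idm X)"
proof -
  note d [simp] = assms[THEN shaped_dim(1)] assms[THEN shaped_dim(2)]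
  let ?i = "\<lambda>v. vstack (1\<^sub>m (dimv X v)) (0\<^sub>m (dimv Y v) (dimv X v)) :: 'a mat"
  let ?p = "\<lambda>v. hstack (1\<^sub>m (dimv X v)) (0\<^sub>m (dimv X v) (dimv Y v)) :: 'a mat"
  have "morph Q ?i X (dsum Q X Y)" unfolding morph_iff
    by (auto intro!: carrier_matI simp: dimv_dsum mapv_dsum assms vstack_mult block_diag_mult_vstack)
  moreover have "morph Q ?p (dsum Q X Y) X" unfolding morph_iff
    by (auto intro!: carrier_matI simp: dimv_dsum mapv_dsum assms mult_hstack hstack_mult_block_diag)
  moreover have "eqon Q (comp ?p ?i) (idm X)"
    unfolding eqon_comp_idm by (simp add: hstack_mult_vstack)
  ultimately show ?thesis by blast
qed

lemma dsum_retract_right: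
  assumes "shaped X" "shaped Y"
  shows "\<exists>i p. morph Q i Y (dsum Q X Y) \<and> morph Q p (dsum Q X Y) Y \<and> eqon Q (comp p i) (idm Y)"
proof -
  note d [simp] = assms[THEN shaped_dim(1)] assms[THEN shaped_dim(2)]
  let ?i = "\<lambda>v. vstack (0\<^sub>m (dimv X v) (dimv Y v)) (1\<^sub>m (dimv Y v)) :: 'a mat"
  let ?p = "\<lambda>v. hstack (0\<^sub>m (dimv Y v) (dimv X v)) (1\<^sub>m (dimv Y v)) :: 'a mat"
  have "morph Q ?i Y (dsum Q X Y)" unfolding morph_iff
    by (auto intro!: carrier_matI simp: dimv_dsum mapv_dsum assms vstack_mult block_diag_mult_vstack)
  moreover have "morph Q ?p (dsum Q X Y) Y" unfolding morph_iff
    by (auto intro!: carrier_matI simp: dimv_dsum mapv_dsum assms mult_hstack hstack_mult_block_diag)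
  moreover have "eqon Q (comp ?p ?i) (idm Y)"
    unfolding eqon_comp_idm by (simp add: hstack_mult_vstack)
  ultimately show ?thesis by blast
qed

lemma in_Xc_in_F:
  assumes "in_Xc Q (M :: 'k::field rep)" shows "in_F Q M"
proof -
  have M: "is_mod Q M" using assms unfolding in_Xc_def indec_def by simp
  note s = is_mod_shaped[OF M]
  note [simp] = shaped_dim[OF s]
  let ?z = "\<lambda>v. 0\<^sub>m 0 (dimv M v) :: 'k mat" and ?z' = "\<lambda>v. 0\<^sub>m (dimv M v) 0 :: 'k mat"
  have zero [simp]: "dimv zero_rep v = 0" "mapv zero_rep v = (0\<^sub>m 0 0 :: 'k mat)" for v
    by (simp_all add: zero_rep_def)
  have mz: "morph Q ?z' zero_rep M" "morph Q ?z M zero_rep"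
    unfolding morph_iff by simp_all
  \<comment> \<open>The singleton list folds to a sum with a trailing zero summand, which this
    isomorphism absorbs.\<close>
  have "iso Q M (dsum Q M zero_rep)"
    by (rule iso_dsum[OF s s shaped_zero_rep morph_id[OF s] morph_id[OF s] mz])
      (auto simp: idm_def intro: mat_eq_no_cols)
  then show ?thesis unfolding in_F_def using M assms
    by (intro conjI exI[of _ "[M]"]) simp_all
qed

text \<open>The complement is the kernel of \<open>p\<close>. As \<open>U\<close> is at most a line
  at each vertex, \<open>split_off_line\<close> gives coordinates of this kernel: \<open>D\<close>
  is its inclusion and \<open>C\<close> the projection along the image of \<open>i\<close>. They
  commute with the arrows because \<open>p\<close> and \<open>i\<close> do.\<close>

lemma iso_line_complement:
  assumes M: "is_mod Q M" and U: "shaped U" and mo: "morph Q i U M" "morph Q p M U"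
    and pi: "\<And>t. p (vt t) * i (vt t) = 1\<^sub>m (dimv U (vt t))" and dim: "\<And>t. dimv U (vt t) \<le> 1"
  shows "\<exists>K. is_mod Q K \<and> iso Q M (dsum Q U K)"
proof -
  note Ms = is_mod_shaped[OF M]
  note d [simp] = mo[THEN morph_dim(1)] mo[THEN morph_dim(2)] shaped_dim[OF Ms] shaped_dim[OF U]
  have "\<exists>c C D. C \<in> carrier_mat c (dimv M v) \<and> D \<in> carrier_mat (dimv M v) c \<and> C * D = 1\<^sub>m c \<and>
      i v * p v + D * C = 1\<^sub>m (dimv M v)" if vV: "v \<in> V Q" for v
  proof -
    obtain t where v: "v = vt t" using vt_of_V[OF vV] by metis
    consider "dimv U v = 0" | "dimv U v = 1" using dim[of t] unfolding v by linarith
    then show ?thesis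
    proof cases
      case 1
      have "i v * p v = 0\<^sub>m (dimv M v) (dimv M v)"
        using 1 by (intro eq_matI) (simp_all add: v scalar_prod_def)
      then show ?thesis
        by (intro exI[of _ "dimv M v"] exI[of _ "1\<^sub>m (dimv M v)"]) simp
    next
      case 2
      have "p v \<in> carrier_mat 1 (dimv M v)" "i v \<in> carrier_mat (dimv M v) 1" "p v * i v = 1\<^sub>m 1"
        using pi[of t] 2 by (auto simp: v intro!: carrier_matI)
      then show ?thesis using split_off_line by metis
    qed
  qed
  then obtain c C D where CD: "\<And>v. v \<in> V Q \<Longrightarrow> C v \<in> carrier_mat (c v) (dimv M v) \<and>
      D v \<in> carrier_mat (dimv M v) (c v) \<and> C v * D v = 1\<^sub>m (c v) \<and> i v * p v + D v * C v = 1\<^sub>m (dimv M v)"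
    by metis
  have [simp]: "dim_row (C (vt t)) = c (vt t)" "dim_col (C (vt t)) = dimv M (vt t)"
    "dim_row (D (vt t)) = dimv M (vt t)" "dim_col (D (vt t)) = c (vt t)" for t
    using CD[OF vt_in_V, of t] by auto
  have CD1: "C (vt t) * D (vt t) = 1\<^sub>m (c (vt t))" and sum1: "i (vt t) * p (vt t) + D (vt t) * C (vt t) = 1\<^sub>m (dimv M (vt t))" for t
    using CD[OF vt_in_V, of t] by auto
  have expand: "x = i (vt t) * (p (vt t) * x) + D (vt t) * (C (vt t) * x)" if "dim_row x = dimv M (vt t)" for x t
  proof -
    have "x = (i (vt t) * p (vt t) + D (vt t) * C (vt t)) * x" using sum1 that by simp
    also have "\<dots> = (i (vt t) * p (vt t)) * x + (D (vt t) * C (vt t)) * x"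
      by (rule add_mult_distrib_mat[of _ "dimv M (vt t)" "dimv M (vt t)" _ _ "dim_col x"])
        (auto intro!: carrier_matI simp: that)
    finally show ?thesis using that by (simp add: mult_assoc_dim)
  qed
  have cancel: "a = 0\<^sub>m (dim_row a) (dim_col a)" if "b = a + b" "dim_row b = dim_row a" "dim_col b = dim_col a" for a b :: "'a mat"
  proof (rule eq_matI)
    fix r s assume rs: "r < dim_row (0\<^sub>m (dim_row a) (dim_col a) :: 'a mat)" "s < dim_col (0\<^sub>m (dim_row a) (dim_col a) :: 'a mat)"
    have "b $$ (r, s) = (a + b) $$ (r, s)" using that(1) by simp
    also have "\<dots> = a $$ (r, s) + b $$ (r, s)" using rs that(2,3) by simp
    finally show "a $$ (r, s) = 0\<^sub>m (dim_row a) (dim_col a) $$ (r, s)" using rs by simp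
  qed simp_all
  \<comment> \<open>Orthogonality follows from the other equations: multiply the resolution of the
    identity by \<open>D\<close>, resp. by \<open>i\<close> in the next step, and cancel the
    repeated term.\<close>
  have pD: "p (vt t) * D (vt t) = 0\<^sub>m (dimv U (vt t)) (c (vt t))" for t
  proof -
    have "D (vt t) = i (vt t) * (p (vt t) * D (vt t)) + D (vt t)"
      using expand[of "D (vt t)" t] CD1 by simp
    then have "i (vt t) * (p (vt t) * D (vt t)) = 0\<^sub>m (dimv M (vt t)) (c (vt t))"
      using cancel[of "D (vt t)" "i (vt t) * (p (vt t) * D (vt t))"] by simp
    then have "p (vt t) * (i (vt t) * (p (vt t) * D (vt t))) = 0\<^sub>m (dimv U (vt t)) (c (vt t))" by simp
    moreover have "p (vt t) * (i (vt t) * (p (vt t) * D (vt t))) = p (vt t) * i (vt t) * (p (vt t) * D (vt t))"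
      by (rule mult_assoc_dim[symmetric]) simp_all
    ultimately show ?thesis using pi by simp
  qed
  have Ci: "C (vt t) * i (vt t) = 0\<^sub>m (c (vt t)) (dimv U (vt t))" for t
  proof -
    have "i (vt t) = i (vt t) + D (vt t) * (C (vt t) * i (vt t))"
      using expand[of "i (vt t)" t] pi by simp
    then have "i (vt t) = D (vt t) * (C (vt t) * i (vt t)) + i (vt t)"
      by (subst (asm) comm_add_mat[of _ "dimv M (vt t)" "dimv U (vt t)"]) (simp_all add: carrier_matI)
    then have "D (vt t) * (C (vt t) * i (vt t)) = 0\<^sub>m (dimv M (vt t)) (dimv U (vt t))"
      using cancel[of "i (vt t)" "D (vt t) * (C (vt t) * i (vt t))"] by simp
    then have "C (vt t) * (D (vt t) * (C (vt t) * i (vt t))) = 0\<^sub>m (c (vt t)) (dimv U (vt t))" by simp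
    moreover have "C (vt t) * (D (vt t) * (C (vt t) * i (vt t))) = C (vt t) * D (vt t) * (C (vt t) * i (vt t))"
      by (rule mult_assoc_dim[symmetric]) simp_all
    ultimately show ?thesis using CD1 by simp
  qed
  define K where "K = \<lparr>dimv = c, mapv = (\<lambda>v. C (tgt Q v) * (mapv M v * D v))\<rparr>"
  have Kdim [simp]: "dimv K v = c v" for v by (simp add: K_def)
  have Kmap: "mapv K (vt t) = C (vt (t - 1)) * (mapv M (vt t) * D (vt t))" for t by (simp add: K_def)
  have Ks: "shaped K" unfolding shaped_def by (auto intro!: carrier_matI simp: Kmap)
  note [simp] = shaped_dim[OF Ks]
  have mD: "morph Q D K M" unfolding morph_iff
  proof (intro allI conjI)
    fix t
    show "D (vt t) \<in> carrier_mat (dimv M (vt t)) (dimv K (vt t))" by (rule carrier_matI) simp_all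
    have "p (vt (t - 1)) * (mapv M (vt t) * D (vt t)) = p (vt (t - 1)) * mapv M (vt t) * D (vt t)"
      by (rule mult_assoc_dim[symmetric]) simp_all
    also have "\<dots> = mapv U (vt t) * (p (vt t) * D (vt t))"
      unfolding morph_commute[OF mo(2)] by (rule mult_assoc_dim) simp_all
    finally have "p (vt (t - 1)) * (mapv M (vt t) * D (vt t)) = 0\<^sub>m (dimv U (vt (t - 1))) (c (vt t))"
      by (simp add: pD)
    then have "mapv M (vt t) * D (vt t) = D (vt (t - 1)) * (C (vt (t - 1)) * (mapv M (vt t) * D (vt t)))"
      using expand[of "mapv M (vt t) * D (vt t)" "t - 1"] by simp
    then show "D (vt (t - 1)) * mapv K (vt t) = mapv M (vt t) * D (vt t)" by (simp add: Kmap)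
  qed
  have mC: "morph Q C M K" unfolding morph_iff
  proof (intro allI conjI)
    fix t
    show "C (vt t) \<in> carrier_mat (dimv K (vt t)) (dimv M (vt t))" by (rule carrier_matI) simp_all
    let ?A = "C (vt (t - 1)) * mapv M (vt t)"
    have "?A = ?A * (i (vt t) * p (vt t) + D (vt t) * C (vt t))" using sum1 by simp
    also have "\<dots> = ?A * (i (vt t) * p (vt t)) + ?A * (D (vt t) * C (vt t))"
      by (rule mult_add_distrib_mat[of _ "c (vt (t - 1))" "dimv M (vt t)" _ "dimv M (vt t)"])
        (auto intro!: carrier_matI)
    also have "?A * (i (vt t) * p (vt t)) = C (vt (t - 1)) * (mapv M (vt t) * i (vt t)) * p (vt t)"
      by (simp add: mult_assoc_dim)
    also have "\<dots> = (C (vt (t - 1)) * i (vt (t - 1))) * mapv U (vt t) * p (vt t)"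
      unfolding morph_commute[OF mo(1), symmetric] by (simp add: mult_assoc_dim)
    also have "\<dots> = 0\<^sub>m (c (vt (t - 1))) (dimv M (vt t))" by (simp add: Ci)
    also have "0\<^sub>m (c (vt (t - 1))) (dimv M (vt t)) + ?A * (D (vt t) * C (vt t)) = mapv K (vt t) * C (vt t)"
      by (simp add: Kmap mult_assoc_dim)
    finally show "C (vt (t - 1)) * mapv M (vt t) = mapv K (vt t) * C (vt t)" .
  qed
  have "iso Q M (dsum Q U K)"
    by (rule iso_dsum[OF Ms U Ks mo mD mC]) (simp_all add: pi CD1 sum1 pD Ci)
  moreover have "is_mod Q K"
    by (rule retract_is_mod[OF Ks M mD mC]) (simp add: eqon_comp_idm CD1)
  ultimately show ?thesis by blast
qed

section \<open>Uniserial modules\<close>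

lemma firstpos_cong:
  assumes "vt i = vt i'" shows "firstpos Q i' v = firstpos Q i v + (i' - i)"
proof -
  have "(int v - i') mod int (mm Q) = (int v - i) mod int (mm Q)"
    using assms by (simp add: vt_eq_iff mod_eq_dvd_iff)
  then show ?thesis unfolding firstpos_def by simp
qed

text \<open>Positions enter only through differences and residues, so the periodicity of the
  uniserial modules is an equality of records and not just an isomorphism.\<close>

lemma Mt_cong:
  assumes "vt i = vt i'" "j' - i' = j - i"
  shows "Mt Q i' j' = Mt Q i j"
proof -
  note fp = firstpos_cong[OF assms(1)]
  have dim: "dimMt Q i' j' = dimMt Q i j"
  proof
    fix v
    have "firstpos Q i' v \<le> j' \<longleftrightarrow> firstpos Q i v \<le> j" "j' - firstpos Q i' v = j - firstpos Q i v"
      unfolding fp using assms(2) by auto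
    then show "dimMt Q i' j' v = dimMt Q i j v" unfolding dimMt_def by simp
  qed
  show ?thesis unfolding Mt_def dim Let_def fp
    by (auto intro!: eq_matI ext)
qed

lemma firstpos_window: "i \<le> t \<Longrightarrow> t < i + int (mm Q) \<Longrightarrow> firstpos Q i (vt t) = t"
proof -
  assume t: "i \<le> t" "t < i + int (mm Q)"
  have "int (mm Q) dvd int (vt t) - t" using int_vt[of t] by (simp add: vt_eq_iff)
  then have "(int (vt t) - i) mod int (mm Q) = (t - i) mod int (mm Q)"
    by (simp add: mod_eq_dvd_iff)
  also have "\<dots> = t - i" using t by simp
  finally show ?thesis unfolding firstpos_def by simp
qed

text \<open>A morphism out of \<open>Mt i j\<close> is given by the image \<open>x\<close> of the top basis vector, one into \<open>Mt i j\<close>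
  by a functional \<open>y\<close> at the socle vertex.\<close>
definition hom_from :: "'k::field rep \<Rightarrow> int \<Rightarrow> int \<Rightarrow> 'k mat \<Rightarrow> nat \<Rightarrow> 'k mat" where
  "hom_from U i j x v = (let s = firstpos Q i v in
     if s \<le> j then pathm Q U j (nat (j - s)) * x else 0\<^sub>m (dimv U v) 0)"

definition hom_to :: "'k::field rep \<Rightarrow> int \<Rightarrow> int \<Rightarrow> 'k mat \<Rightarrow> nat \<Rightarrow> 'k mat" where
  "hom_to X i j y v = (let s = firstpos Q i v in
     if s \<le> j then y * pathm Q X s (nat (s - i)) else 0\<^sub>m 0 (dimv X v))"

text \<open>The second premise may use the formats at all vertices, because at \<open>t = i\<close>
  the square involves the position \<open>t - 1\<close> outside the window.\<close>

lemma morph_windowI: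
  assumes "\<And>t. i \<le> t \<Longrightarrow> t < i + int (mm Q) \<Longrightarrow> f (vt t) \<in> carrier_mat (dimv Y (vt t)) (dimv X (vt t))"
    and "\<And>t. i \<le> t \<Longrightarrow> t < i + int (mm Q) \<Longrightarrow>
      (\<And>s. f (vt s) \<in> carrier_mat (dimv Y (vt s)) (dimv X (vt s))) \<Longrightarrow>
      f (vt (t - 1)) * mapv X (vt t) = mapv Y (vt t) * f (vt t)"
  shows "morph Q f X Y"
proof -
  have "\<forall>v\<in>V Q. f v \<in> carrier_mat (dimv Y v) (dimv X v)"
    unfolding ball_V_window[of _ i] using assms(1) by blast
  then have c: "f (vt s) \<in> carrier_mat (dimv Y (vt s)) (dimv X (vt s))" for s by simp
  show ?thesis unfolding morph_def ball_V_window[of _ i] using assms(2)[OF _ _ c] c by simp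
qed

lemma eqon_windowI:
  assumes "\<And>t. i \<le> t \<Longrightarrow> t < i + int (mm Q) \<Longrightarrow> f (vt t) = g (vt t)"
  shows "eqon Q f g"
  unfolding eqon_def ball_V_window[of _ i] using assms by blast

lemma all_windowI:
  assumes "\<And>t. i \<le> t \<Longrightarrow> t < i + int (mm Q) \<Longrightarrow> P (vt t)"
  shows "P (vt s)"
proof -
  have "\<forall>v\<in>V Q. P v" unfolding ball_V_window[of _ i] using assms by blast
  then show ?thesis by simp
qed

section \<open>Uniserial modules of length at most \<open>m\<close>\<close>

context
  fixes i j :: int
  assumes ij: "i \<le> j" "j < i + int (mm Q)"
begin

lemma Mt_dim: "i \<le> t \<Longrightarrow> t < i + int (mm Q) \<Longrightarrow> dimv (Mt Q i j :: 'k::field rep) (vt t) = (if t \<le> j then 1 else 0)"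
  unfolding Mt_def dimMt_def using ij by (auto simp: firstpos_window)

lemma Mt_dim_top: "dimv (Mt Q i j :: 'k::field rep) (vt j) = 1"
  using Mt_dim[of j] ij by simp

lemma Mt_dim_soc: "dimv (Mt Q i j :: 'k::field rep) (vt i) = 1"
  using Mt_dim[of i] ij by simp

lemma Mt_dim_le: "dimv (Mt Q i j :: 'k::field rep) (vt t) \<le> 1"
  by (rule all_windowI[of i]) (simp add: Mt_dim)

lemma shaped_Mt: "shaped (Mt Q i j :: 'k::field rep)"
  unfolding shaped_def Mt_def by simp

lemma Mt_map_id: "i < t \<Longrightarrow> t \<le> j \<Longrightarrow> mapv (Mt Q i j :: 'k::field rep) (vt t) = 1\<^sub>m 1"
proof (rule eq_matI)
  assume t: "i < t" "t \<le> j"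
  then have w: "firstpos Q i (vt t) = t" "firstpos Q i (vt (t - 1)) = t - 1"
    using ij by (simp_all add: firstpos_window)
  have dims: "dimMt Q i j (vt t) = 1" "dimMt Q i j (vt (t - 1)) = 1"
    using Mt_dim[of t, where 'k='k] Mt_dim[of "t - 1", where 'k='k] t ij by (simp_all add: Mt_def)
  show "dim_row (mapv (Mt Q i j :: 'k rep) (vt t)) = dim_row (1\<^sub>m 1 :: 'k mat)"
    "dim_col (mapv (Mt Q i j :: 'k rep) (vt t)) = dim_col (1\<^sub>m 1 :: 'k mat)"
    using dims by (simp_all add: Mt_def)
  fix a b assume "a < dim_row (1\<^sub>m 1 :: 'k mat)" "b < dim_col (1\<^sub>m 1 :: 'k mat)"
  then show "mapv (Mt Q i j :: 'k rep) (vt t) $$ (a, b) = 1\<^sub>m 1 $$ (a, b)"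
    using dims w t by (simp add: Mt_def Let_def)
qed

lemma Mt_map_zero:
  assumes "t = i \<or> j < t \<and> t < i + int (mm Q)"
  shows "mapv (Mt Q i j :: 'k::field rep) (vt t) = 0\<^sub>m (dimv (Mt Q i j :: 'k rep) (vt (t - 1))) (dimv (Mt Q i j :: 'k rep) (vt t))"
proof (rule eq_matI)
  fix a b assume ab: "a < dim_row (0\<^sub>m (dimv (Mt Q i j :: 'k rep) (vt (t - 1))) (dimv (Mt Q i j :: 'k rep) (vt t)) :: 'k mat)"
    "b < dim_col (0\<^sub>m (dimv (Mt Q i j :: 'k rep) (vt (t - 1))) (dimv (Mt Q i j :: 'k rep) (vt t)) :: 'k mat)"
  have "i \<le> t" "t < i + int (mm Q)" using assms ij m_pos by auto
  then have "dimv (Mt Q i j :: 'k rep) (vt t) = (if t \<le> j then 1 else 0)" by (rule Mt_dim)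
  then have t: "t = i" "b = 0" using assms ab by (auto split: if_splits)
  have "firstpos Q i (vt i) = i" using ij m_pos by (simp add: firstpos_window)
  then show "mapv (Mt Q i j :: 'k rep) (vt t) $$ (a, b) =
      0\<^sub>m (dimv (Mt Q i j :: 'k rep) (vt (t - 1))) (dimv (Mt Q i j :: 'k rep) (vt t)) $$ (a, b)"
    using ab t by (simp add: Mt_def)
qed (simp_all add: shaped_dim[OF shaped_Mt])

lemma Mt_map_above_top:
  "mapv (Mt Q i j :: 'k::field rep) (vt (j + 1)) = 0\<^sub>m 1 (dimv (Mt Q i j :: 'k rep) (vt (j + 1)))"
proof -
  obtain t where t: "vt t = vt (j + 1)" "t = i \<or> j < t \<and> t < i + int (mm Q)"
  proof (cases "j + 1 < i + int (mm Q)")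
    case True then show ?thesis using that[of "j + 1"] by simp
  next
    \<comment> \<open>In full length \<open>m\<close>, the arrow into the top is the arrow leaving
      the socle.\<close>
    case False
    then have "j + 1 = i + int (mm Q)" using ij by simp
    then show ?thesis using that[of i] by (simp add: vt_eq_iff)
  qed
  show ?thesis using Mt_map_zero[OF t(2), where 'k='k] t(1) vt_shift_minus[OF t(1), of 1] Mt_dim_top[where 'k='k] by simp
qed

lemma pathm_Mt_id: "t \<le> j \<Longrightarrow> i \<le> t - int L \<Longrightarrow> pathm Q (Mt Q i j :: 'k::field rep) t L = 1\<^sub>m 1"
proof (induction L)
  case 0
  then show ?case using Mt_dim[of t, where 'k='k] ij by simp
next
  case (Suc L)
  then show ?case using Mt_map_id[of "t - int L", where 'k='k] by simp
qed

lemma kills_Mt: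
  assumes "i \<le> t" "t < i + int (mm Q)" "t - int L < i \<or> j < t"
  shows "kills Q (Mt Q i j :: 'k::field rep) t L"
proof (cases "j < t")
  case True
  then have "dimv (Mt Q i j :: 'k rep) (vt t) = 0" using Mt_dim[OF assms(1,2), where 'k='k] by simp
  then show ?thesis unfolding kills_def
    using pathm_dim[OF shaped_Mt, where 'a='k] by (intro mat_eq_no_cols) simp_all
next
  case False
  let ?a = "nat (t - i)"
  \<comment> \<open>The path down to the socle acts as the identity; one more arrow makes it
    vanish.\<close>
  have "pathm Q (Mt Q i j :: 'k rep) t (Suc ?a) = mapv (Mt Q i j) (vt i) * 1\<^sub>m 1"
    using pathm_Mt_id[of t ?a, where 'k='k] False assms(1) by simp
  also have "\<dots> = 0\<^sub>m (dimv (Mt Q i j :: 'k rep) (vt (i - 1))) 1"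
    using Mt_map_zero[of i, where 'k='k] Mt_dim_soc[where 'k='k] by simp
  finally show ?thesis
    by (rule pathm_zero_mono[OF shaped_Mt]) (use assms False in simp)
qed

lemma Mt_linv: "vt t \<noteq> vt i \<Longrightarrow> linv (mapv (Mt Q i j :: 'k::field rep) (vt t))"
proof -
  have "vt t \<noteq> vt i \<longrightarrow> linv (mapv (Mt Q i j :: 'k rep) (vt t))"
  proof (rule all_windowI[of i], rule impI)
    fix t assume t: "i \<le> t" "t < i + int (mm Q)" "vt t \<noteq> vt i"
    show "linv (mapv (Mt Q i j :: 'k rep) (vt t))"
    proof (cases "t \<le> j")
      case True
      then show ?thesis using t Mt_map_id[of t, where 'k='k] by (cases "t = i") simp_all
    next
      case False
      then show ?thesis using Mt_dim[OF t(1,2), where 'k='k] by (simp add: linv_no_cols shaped_dim[OF shaped_Mt, where 'a='k])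
    qed
  qed
  then show "vt t \<noteq> vt i \<Longrightarrow> ?thesis" by simp
qed

lemma Mt_not_linv: "\<not> linv (mapv (Mt Q i j :: 'k::field rep) (vt i))"
  using Mt_map_zero[of i, where 'k='k] Mt_dim_soc[where 'k='k] one_mat_neq_zero[of 1, where 'a='k]
  unfolding linv_def by auto

lemma Mt_rinv: "vt t \<noteq> vt j \<Longrightarrow> rinv (mapv (Mt Q i j :: 'k::field rep) (vt (t + 1)))"
proof -
  \<comment> \<open>The claim is turned into a property of the vertex, with \<open>inarr\<close> in
    place of \<open>t + 1\<close>, so that the window rule applies.\<close>
  have "v \<noteq> vt j \<longrightarrow> rinv (mapv (Mt Q i j :: 'k rep) (inarr Q v))" if "v = vt t" for v
    unfolding that
  proof (rule all_windowI[of i], rule impI)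
    fix t assume t: "i \<le> t" "t < i + int (mm Q)" "vt t \<noteq> vt j"
    show "rinv (mapv (Mt Q i j :: 'k rep) (inarr Q (vt t)))"
    proof (cases "t \<le> j")
      case True
      then show ?thesis using t Mt_map_id[of "t + 1", where 'k='k] by (cases "t = j") simp_all
    next
      case False
      then show ?thesis using Mt_dim[OF t(1,2), where 'k='k] shaped_dim(1)[OF shaped_Mt, of "t + 1", where 'a='k]
        by (simp add: rinv_no_rows)
    qed
  qed
  then show "vt t \<noteq> vt j \<Longrightarrow> ?thesis" by simp
qed

lemma Mt_not_rinv: "\<not> rinv (mapv (Mt Q i j :: 'k::field rep) (vt (j + 1)))"
  using Mt_map_above_top[where 'k='k] one_mat_neq_zero[of 1, where 'a='k]
  unfolding rinv_def by auto

lemma hom_from_window: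
  "i \<le> t \<Longrightarrow> t < i + int (mm Q) \<Longrightarrow> hom_from U i j x (vt t) =
     (if t \<le> j then pathm Q U j (nat (j - t)) * x else 0\<^sub>m (dimv U (vt t)) 0)"
  unfolding hom_from_def by (simp add: firstpos_window)

lemma hom_to_window:
  "i \<le> t \<Longrightarrow> t < i + int (mm Q) \<Longrightarrow> hom_to X i j y (vt t) =
     (if t \<le> j then y * pathm Q X t (nat (t - i)) else 0\<^sub>m 0 (dimv X (vt t)))"
  unfolding hom_to_def by (simp add: firstpos_window)

lemma hom_from_top: "x \<in> carrier_mat (dimv U (vt j)) c \<Longrightarrow> hom_from U i j x (vt j) = x"
  using hom_from_window[of j U x] ij by simp

text \<open>\<open>Mt i j\<close> is generated by \<open>b_j\<close> subject to the single relation
  that the path of length \<open>j - i + 1\<close> kills it; \<open>z\<close> is this relation for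
  the image \<open>x\<close>.\<close>

lemma morph_hom_from:
  fixes U :: "'k::field rep"
  assumes U: "shaped U" and x: "x \<in> carrier_mat (dimv U (vt j)) 1"
    and z: "pathm Q U j (Suc (nat (j - i))) * x = 0\<^sub>m (dimv U (vt (i - 1))) 1"
  shows "morph Q (hom_from U i j x) (Mt Q i j) U"
proof (rule morph_windowI[of i])
  note [simp] = pathm_dim[OF U] shaped_dim[OF U]
  have [simp]: "dim_row x = dimv U (vt j)" "dim_col x = 1" using x by auto
  fix t assume t: "i \<le> t" "t < i + int (mm Q)"
  then show "hom_from U i j x (vt t) \<in> carrier_mat (dimv U (vt t)) (dimv (Mt Q i j :: 'k rep) (vt t))"
    by (intro carrier_matI) (simp_all add: hom_from_window Mt_dim)
  assume c: "\<And>s. hom_from U i j x (vt s) \<in> carrier_mat (dimv U (vt s)) (dimv (Mt Q i j :: 'k rep) (vt s))"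
  note [simp] = c[THEN carrier_matD(1)] c[THEN carrier_matD(2)] shaped_dim[OF shaped_Mt]
  consider "t = i" | "i < t" "t \<le> j" | "j < t" using t by linarith
  then show "hom_from U i j x (vt (t - 1)) * mapv (Mt Q i j) (vt t) = mapv U (vt t) * hom_from U i j x (vt t)"
  proof cases
    case 1
    have "mapv U (vt i) * hom_from U i j x (vt i) = mapv U (vt i) * (pathm Q U j (nat (j - i)) * x)"
      using hom_from_window[of i U x] ij m_pos by simp
    also have "\<dots> = mapv U (vt i) * pathm Q U j (nat (j - i)) * x"
      by (rule mult_assoc_dim[symmetric]) (use ij in simp_all)
    also have "\<dots> = 0\<^sub>m (dimv U (vt (i - 1))) 1" using z ij by simp
    finally show ?thesis using 1 Mt_map_zero[of i, where 'k='k] Mt_dim_soc[where 'k='k] by simp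
  next
    case 2
    have "nat (j - (t - 1)) = Suc (nat (j - t))" using 2 by simp
    then have "hom_from U i j x (vt (t - 1)) = mapv U (vt t) * pathm Q U j (nat (j - t)) * x"
      using hom_from_window[of "t - 1" U x] 2 t by simp
    also have "\<dots> = mapv U (vt t) * (pathm Q U j (nat (j - t)) * x)"
      by (rule mult_assoc_dim) (use 2 in simp_all)
    finally have e: "hom_from U i j x (vt (t - 1)) = mapv U (vt t) * (pathm Q U j (nat (j - t)) * x)" .
    have "dim_col (hom_from U i j x (vt (t - 1))) = 1" unfolding e by simp
    then show ?thesis using e hom_from_window[of t U x] t 2 Mt_map_id[of t, where 'k='k] by simp
  next
    case 3
    then show ?thesis using Mt_dim[OF t, where 'k='k] by (intro mat_eq_no_cols) simp_all
  qed
qed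

text \<open>Dual to the previous lemma: the functional is pulled back along the paths ending in
  \<open>i\<close>, and \<open>z\<close> says that it vanishes on everything coming from above
  \<open>j\<close>.\<close>

lemma morph_hom_to:
  fixes X :: "'k::field rep"
  assumes X: "shaped X" and y: "y \<in> carrier_mat 1 (dimv X (vt i))"
    and z: "y * pathm Q X (j + 1) (Suc (nat (j - i))) = 0\<^sub>m 1 (dimv X (vt (j + 1)))"
  shows "morph Q (hom_to X i j y) X (Mt Q i j)"
proof (rule morph_windowI[of i])
  note [simp] = pathm_dim[OF X] shaped_dim[OF X]
  have [simp]: "dim_col y = dimv X (vt i)" "dim_row y = 1" using y by auto
  fix t assume t: "i \<le> t" "t < i + int (mm Q)"
  then show "hom_to X i j y (vt t) \<in> carrier_mat (dimv (Mt Q i j :: 'k rep) (vt t)) (dimv X (vt t))"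
    by (intro carrier_matI) (simp_all add: hom_to_window Mt_dim)
  assume c: "\<And>s. hom_to X i j y (vt s) \<in> carrier_mat (dimv (Mt Q i j :: 'k rep) (vt s)) (dimv X (vt s))"
  note [simp] = c[THEN carrier_matD(1)] c[THEN carrier_matD(2)] shaped_dim[OF shaped_Mt]
  have zero: "hom_to X i j y (vt j) * mapv X (vt (j + 1)) = 0\<^sub>m 1 (dimv X (vt (j + 1)))"
  proof -
    have "hom_to X i j y (vt j) * mapv X (vt (j + 1)) = y * pathm Q X j (nat (j - i)) * mapv X (vt (j + 1))"
      using hom_to_window[of j X y] ij by simp
    also have "\<dots> = y * (pathm Q X j (nat (j - i)) * mapv X (vt (j + 1)))"
      by (rule mult_assoc_dim) (use ij in simp_all)
    finally show ?thesis using z pathm_Suc_right[OF X, of "j + 1" "nat (j - i)"] by simp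
  qed
  consider "t = i" "j < i + int (mm Q) - 1" | "t = i" "j = i + int (mm Q) - 1" | "i < t" "t \<le> j"
    | "t = j + 1" | "j + 1 < t" using t ij by linarith
  then show "hom_to X i j y (vt (t - 1)) * mapv X (vt t) = mapv (Mt Q i j) (vt t) * hom_to X i j y (vt t)"
  proof cases
    case 1
    have "vt (i + int (mm Q) - 1) = vt (i - 1)" by (simp add: vt_eq_iff)
    then have "dimv (Mt Q i j :: 'k rep) (vt (i - 1)) = 0"
      using Mt_dim[of "i + int (mm Q) - 1", where 'k='k] 1 m_pos by simp
    then show ?thesis using 1 by (intro mat_eq_no_rows) simp_all
  next
    case 2
    \<comment> \<open>In full length \<open>m\<close> the square at the socle coincides with the one
      above the top, where \<open>zero\<close> applies.\<close>
    have v: "vt (i - 1) = vt j" "vt i = vt (j + 1)" using 2 by (simp_all add: vt_eq_iff)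
    have "hom_to X i j y (vt (t - 1)) * mapv X (vt t) = 0\<^sub>m 1 (dimv X (vt t))"
      unfolding 2(1) v using zero by simp
    moreover have "mapv (Mt Q i j) (vt t) * hom_to X i j y (vt t) = 0\<^sub>m 1 (dimv X (vt t))"
      unfolding 2(1) Mt_map_zero[of i, OF disjI1[OF refl]] v(1) Mt_dim_top by simp
    ultimately show ?thesis by simp
  next
    case 3
    have "Suc (nat (t - 1 - i)) = nat (t - i)" using 3 by simp
    then have "pathm Q X t (nat (t - i)) = pathm Q X (t - 1) (nat (t - 1 - i)) * mapv X (vt t)"
      using pathm_Suc_right[OF X, of t "nat (t - 1 - i)"] by simp
    moreover have "y * (pathm Q X (t - 1) (nat (t - 1 - i)) * mapv X (vt t)) =
        y * pathm Q X (t - 1) (nat (t - 1 - i)) * mapv X (vt t)"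
      by (rule mult_assoc_dim[symmetric]) (use 3 in simp_all)
    ultimately have "hom_to X i j y (vt (t - 1)) * mapv X (vt t) = hom_to X i j y (vt t)"
      using 3 t hom_to_window[of "t - 1" X y] hom_to_window[of t X y] by simp
    then show ?thesis using Mt_map_id[OF 3, where 'k='k] Mt_dim[OF t, where 'k='k] 3 by simp
  next
    case 4
    then show ?thesis using zero Mt_map_above_top[where 'k='k] by simp
  next
    case 5
    then have "dimv (Mt Q i j :: 'k rep) (vt (t - 1)) = 0"
      using Mt_dim[of "t - 1", where 'k='k] t ij(1) by simp
    then show ?thesis by (intro mat_eq_no_rows) simp_all
  qed
qed

lemma morph_from_Mt:
  fixes U :: "'k::field rep"
  assumes U: "shaped U" and f: "morph Q f (Mt Q i j) U"
  shows "f (vt t) = hom_from U i j (f (vt j)) (vt t)"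
proof (rule all_windowI[of i])
  note [simp] = pathm_dim[OF U] shaped_dim[OF U] morph_dim[OF f]
  fix t assume t: "i \<le> t" "t < i + int (mm Q)"
  show "f (vt t) = hom_from U i j (f (vt j)) (vt t)"
  proof (cases "t \<le> j")
    case True
    then have "f (vt t) * pathm Q (Mt Q i j) j (nat (j - t)) = pathm Q U j (nat (j - t)) * f (vt j)"
      using morph_pathm[OF shaped_Mt U f, of j "nat (j - t)"] by simp
    moreover have "pathm Q (Mt Q i j :: 'k rep) j (nat (j - t)) = 1\<^sub>m 1"
      using pathm_Mt_id[of j "nat (j - t)", where 'k='k] True t by simp
    ultimately show ?thesis using True t Mt_dim[OF t, where 'k='k] by (simp add: hom_from_window)
  next
    case False
    then show ?thesis using t Mt_dim[OF t, where 'k='k] by (intro mat_eq_no_cols) (simp_all add: hom_from_window)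
  qed
qed

lemma morph_from_Mt_eqI:
  fixes U :: "'k::field rep"
  assumes "shaped U" "morph Q f (Mt Q i j) U" "morph Q g (Mt Q i j) U" "f (vt j) = g (vt j)"
  shows "eqon Q f g"
  unfolding eqon_iff
proof
  fix t
  have "f (vt t) = hom_from U i j (f (vt j)) (vt t)" by (rule morph_from_Mt[OF assms(1,2)])
  also have "\<dots> = g (vt t)" unfolding assms(4) by (rule morph_from_Mt[OF assms(1,3), symmetric])
  finally show "f (vt t) = g (vt t)" .
qed

lemma Mt_nonzero: "\<not> is_zero Q (Mt Q i j :: 'k::field rep)"
  unfolding is_zero_def ball_V using Mt_dim_top[where 'k='k] by force

text \<open>A retract is a quotient, hence generated by the image of the top vector. If it vanished
  at the top vertex, then \<open>p\<close> and with it the identity of \<open>A\<close> would be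
  zero.\<close>

lemma Mt_retract_dim_top:
  fixes A :: "'k::field rep"
  assumes A: "shaped A" and mo: "morph Q p (Mt Q i j) A" "morph Q e A (Mt Q i j)" "eqon Q (comp p e) (idm A)"
    and nz: "\<not> is_zero Q A"
  shows "0 < dimv A (vt j)"
proof (rule ccontr)
  assume "\<not> ?thesis"
  then have z: "dimv A (vt j) = 0" by simp
  note [simp] = pathm_dim[OF A] shaped_dim[OF A] morph_dim[OF mo(1)] morph_dim[OF mo(2)]
  from nz obtain t where t: "0 < dimv A (vt t)" unfolding is_zero_def ball_V by auto
  have "p (vt t) = 0\<^sub>m (dimv A (vt t)) (dimv (Mt Q i j :: 'k rep) (vt t))"
  proof (rule all_windowI[of i])
    fix t assume w: "i \<le> t" "t < i + int (mm Q)"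
    have "p (vt t) = hom_from A i j (p (vt j)) (vt t)" by (rule morph_from_Mt[OF A mo(1)])
    then show "p (vt t) = 0\<^sub>m (dimv A (vt t)) (dimv (Mt Q i j :: 'k rep) (vt t))"
      using w z Mt_dim[OF w, where 'k='k] hom_from_window[OF w, of A "p (vt j)"]
      Mt_dim_top[where 'k='k] by (cases "t \<le> j") (auto simp: scalar_prod_def intro!: eq_matI)
  qed
  then have "p (vt t) * e (vt t) = 0\<^sub>m (dimv A (vt t)) (dimv A (vt t))" by simp
  moreover have "p (vt t) * e (vt t) = 1\<^sub>m (dimv A (vt t))"
    using mo(3) unfolding eqon_comp_idm by simp
  ultimately have "1\<^sub>m (dimv A (vt t)) = (0\<^sub>m (dimv A (vt t)) (dimv A (vt t)) :: 'k mat)" by simp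
  then show False using one_mat_neq_zero[OF t, where 'a='k] by simp
qed

text \<open>Two nonzero summands would both be nonzero at the top vertex, so an identity matrix of
  size at least 2 would factor through the line there.\<close>

lemma Mt_indec:
  assumes "is_mod Q (Mt Q i j :: 'k::field rep)"
  shows "indec Q (Mt Q i j :: 'k rep)"
  unfolding indec_def
proof (intro conjI notI)
  show "is_mod Q (Mt Q i j :: 'k rep)" by fact
  show "is_zero Q (Mt Q i j :: 'k rep) \<Longrightarrow> False" using Mt_nonzero by blast
  assume "\<exists>A B. is_mod Q A \<and> is_mod Q B \<and> \<not> is_zero Q A \<and> \<not> is_zero Q B \<and> iso Q (Mt Q i j :: 'k rep) (dsum Q A B)"
  then obtain A B where AB: "is_mod Q A" "is_mod Q B" "\<not> is_zero Q A" "\<not> is_zero Q B"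
    and iso: "iso Q (Mt Q i j :: 'k rep) (dsum Q A B)" by blast
  note s = AB(1,2)[THEN is_mod_shaped]
  let ?D = "dsum Q A B"
  have Ds: "shaped ?D" by (rule shaped_dsum[OF s])
  from iso obtain f g where fg: "morph Q f (Mt Q i j) ?D" "morph Q g ?D (Mt Q i j)"
    and e: "eqon Q (comp f g) (idm ?D)" unfolding iso_def by auto
  have retract: "0 < dimv C (vt j)"
    if C: "shaped C" "\<not> is_zero Q C" "\<exists>a p. morph Q a C ?D \<and> morph Q p ?D C \<and> eqon Q (comp p a) (idm C)" for C
  proof -
    from C(3) obtain a p where ap: "morph Q a C ?D" "morph Q p ?D C" "eqon Q (comp p a) (idm C)" by auto
    note [simp] = ap(1,2)[THEN morph_dim(1)] ap(1,2)[THEN morph_dim(2)] fg[THEN morph_dim(1)] fg[THEN morph_dim(2)]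
    have "eqon Q (comp (comp p f) (comp g a)) (idm C)"
      unfolding eqon_comp_idm
    proof
      fix t
      have "(p (vt t) * f (vt t)) * (g (vt t) * a (vt t)) = 1\<^sub>m (dimv C (vt t))"
        using e ap(3) unfolding eqon_comp_idm by (intro comp_inverse) simp_all
      then show "comp p f (vt t) * comp g a (vt t) = 1\<^sub>m (dimv C (vt t))" by (simp add: comp_def)
    qed
    then show ?thesis
      using Mt_retract_dim_top[OF C(1) morph_comp[OF shaped_Mt Ds C(1) fg(1) ap(2)]
          morph_comp[OF C(1) Ds shaped_Mt ap(1) fg(2)] _ C(2)] by blast
  qed
  have "0 < dimv A (vt j)" "0 < dimv B (vt j)"
    using retract[OF s(1) AB(3) dsum_retract_left[OF s]] retract[OF s(2) AB(4) dsum_retract_right[OF s]] by auto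
  then have n: "2 \<le> dimv ?D (vt j)" by (simp add: dimv_dsum)
  have "f (vt j) * g (vt j) = 1\<^sub>m (dimv ?D (vt j))" using e unfolding eqon_comp_idm by simp
  moreover have "(f (vt j) * g (vt j)) $$ (a, b) = f (vt j) $$ (a, 0) * g (vt j) $$ (0, b)"
    if "a < dimv ?D (vt j)" "b < dimv ?D (vt j)" for a b
    using that morph_dim[OF fg(1), of j] morph_dim[OF fg(2), of j] Mt_dim_top[where 'k='k]
    by (simp add: scalar_prod_def)
  ultimately have p: "f (vt j) $$ (a, 0) * g (vt j) $$ (0, b) = (if a = b then 1 else 0)"
    if "a < dimv ?D (vt j)" "b < dimv ?D (vt j)" for a b using that by simp
  have "f (vt j) $$ (0, 0) * g (vt j) $$ (0, 1) = 0" "f (vt j) $$ (0, 0) * g (vt j) $$ (0, 0) = 1"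
    "f (vt j) $$ (1, 0) * g (vt j) $$ (0, 1) = 1"
    using p[of 0 0] p[of 0 1] p[of 1 1] n by auto
  then show False by auto
qed

end

end

section \<open>Projective covers and almost split sequences\<close>

lemma Fredholm_alternative_row:
  fixes A :: "'a::field mat"
  assumes A: "A \<in> carrier_mat r c" and b: "b \<in> carrier_mat 1 c"
  shows "(\<exists>y\<in>carrier_mat 1 r. y * A = b) \<or> (\<exists>x\<in>carrier_mat c 1. A * x = 0\<^sub>m r 1 \<and> b * x = 1\<^sub>m 1)"
proof -
  have "transpose_mat A \<in> carrier_mat c r" "transpose_mat b \<in> carrier_mat c 1" using A b by auto
  from Fredholm_alternative[OF this] show ?thesis
  proof
    assume "\<exists>x\<in>carrier_mat r 1. transpose_mat A * x = transpose_mat b"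
    then obtain x where x: "x \<in> carrier_mat r 1" "transpose_mat A * x = transpose_mat b" by blast
    have "transpose_mat (transpose_mat A * x) = transpose_mat x * transpose_mat (transpose_mat A)"
      by (rule transpose_mult[OF _ x(1), where nr = c]) (use A in simp)
    then have "transpose_mat x * A = b" unfolding x(2) by simp
    then show ?thesis using x(1) by (intro disjI1 bexI[of _ "transpose_mat x"]) auto
  next
    assume "\<exists>y\<in>carrier_mat 1 c. y * transpose_mat A = 0\<^sub>m 1 r \<and> y * transpose_mat b = 1\<^sub>m 1"
    then obtain y where y: "y \<in> carrier_mat 1 c" "y * transpose_mat A = 0\<^sub>m 1 r" "y * transpose_mat b = 1\<^sub>m 1"
      by blast
    have "transpose_mat (y * transpose_mat A) = transpose_mat (transpose_mat A) * transpose_mat y"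
      by (rule transpose_mult[OF y(1), where nc = r]) (use A in simp)
    then have 1: "A * transpose_mat y = 0\<^sub>m r 1" unfolding y(2) by simp
    have "transpose_mat (y * transpose_mat b) = transpose_mat (transpose_mat b) * transpose_mat y"
      by (rule transpose_mult[OF y(1), where nc = 1]) (use b in simp)
    then have "b * transpose_mat y = 1\<^sub>m 1" unfolding y(3) by simp
    with 1 show ?thesis using y(1) by (intro disjI2 bexI[of _ "transpose_mat y"]) auto
  qed
qed

text \<open>The relations say exactly that the path of length \<open>pl v\<close> starting at \<open>v\<close> vanishes; \<open>pl v\<close> is
  the length of the indecomposable projective with top \<open>v\<close>, whose socle sits at position \<open>st v\<close>.\<close>
locale nakayama = cyclic_quiver Q for Q :: params +
  fixes pl :: "nat \<Rightarrow> nat" and ty :: "'k::field itself"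
  assumes pl_ge2: "2 \<le> pl (vtx Q t)"
    and pl_le: "pl (vtx Q t) \<le> mm Q"
    and pl_mono: "pl (vtx Q t) \<le> pl (vtx Q (t - 1)) + 1"
    and is_mod_iff: "is_mod Q (M :: 'k rep) \<longleftrightarrow>
      (\<forall>t. mapv M (vtx Q t) \<in> carrier_mat (dimv M (vtx Q (t - 1))) (dimv M (vtx Q t))) \<and>
      (\<forall>t. kills Q M t (pl (vtx Q t)))"
begin

definition st :: "int \<Rightarrow> int" where
  "st t = t - int (pl (vt t)) + 1"

lemma st_le: "st t \<le> t - 1"
  using pl_ge2[of t] by (simp add: st_def)

lemma st_gt: "t - int (mm Q) < st t"
  using pl_le[of t] by (simp add: st_def)

lemma st_shift: "vt s = vt t \<Longrightarrow> st s - s = st t - t"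
  by (simp add: st_def)

text \<open>This is the inequality of a Kupisch series: the radical of the projective with top
  \<open>t\<close> is a quotient of the projective with top \<open>t - 1\<close>, so the socle of
  the former does not lie lower.\<close>

lemma st_step: "st (t - 1) \<le> st t"
  using pl_mono[of t] by (simp add: st_def)

lemma st_mono: "s \<le> t \<Longrightarrow> st s \<le> st t"
proof (induction "nat (t - s)" arbitrary: t)
  case (Suc n)
  then have "st s \<le> st (t - 1)" by simp
  also have "\<dots> \<le> st t" by (rule st_step)
  finally show ?case .
qed simp

lemma mod_kills: "is_mod Q (M :: 'k rep) \<Longrightarrow> t - int L < st t \<Longrightarrow> kills Q M t L"
  using pathm_zero_mono[OF is_mod_shaped, of M t "pl (vt t)" _ _ L] 
  unfolding is_mod_iff[of M] st_def kills_def by force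

text \<open>For \<open>t\<close> at most \<open>j\<close>, monotonicity gives
  \<open>st t \<le> st j \<le> i\<close>, so the relation starting at \<open>t\<close> runs past the
  socle; at the other positions of the window the space is zero.\<close>

lemma is_mod_Mt:
  assumes "i \<le> j" "st j \<le> i" shows "is_mod Q (Mt Q i j :: 'k rep)"
proof -
  have ij: "j < i + int (mm Q)" using assms st_gt[of j] by simp
  have "kills Q (Mt Q i j :: 'k rep) t (pl (vt t))" for t
  proof -
    have "\<forall>s. vt s = v \<longrightarrow> kills Q (Mt Q i j :: 'k rep) s (pl v)" if "v = vt t" for v
      unfolding that
    proof (rule all_windowI[of i], intro allI impI)
      fix t s assume t: "i \<le> t" "t < i + int (mm Q)" "vt s = vt t"
      have "kills Q (Mt Q i j :: 'k rep) t (pl (vt t))"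
        by (rule kills_Mt[OF assms(1) ij t(1,2)]) (use st_mono[of t j] assms(2) in \<open>auto simp: st_def\<close>)
      then show "kills Q (Mt Q i j :: 'k rep) s (pl (vt t))" using t(3) kills_cong by metis
    qed
    then show ?thesis by blast
  qed
  then show ?thesis unfolding is_mod_iff using shaped_Mt[OF assms(1) ij, where 'k='k] unfolding shaped_def by blast
qed

lemma mod_proj_top:
  assumes "is_mod Q (X :: 'k rep)" "x \<in> carrier_mat (dimv X (vt j)) 1" "i \<le> st j"
  shows "pathm Q X j (Suc (nat (j - i))) * x = 0\<^sub>m (dimv X (vt (i - 1))) 1"
proof -
  have i: "i \<le> j" using assms(3) st_le[of j] by simp
  then have "kills Q X j (Suc (nat (j - i)))"
    by (intro mod_kills[OF assms(1)]) (use assms(3) in simp)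
  then show ?thesis unfolding kills_def using assms(2) i by simp
qed

text \<open>A morphism out of \<open>Mt i j\<close> is determined at the top, so it lifts as soon as
  the one vector there has a preimage satisfying the relation. This yields lifts from projectives as
  well as sections onto simples.\<close>

lemma hom_lift:
  fixes X Y :: "'k rep"
  assumes ij: "i \<le> j" "j < i + int (mm Q)"
    and X: "shaped X" and Y: "shaped Y" and g: "morph Q g X Y" and f: "morph Q f (Mt Q i j) Y"
    and x: "x \<in> carrier_mat (dimv X (vt j)) 1" "g (vt j) * x = f (vt j)"
    and z: "pathm Q X j (Suc (nat (j - i))) * x = 0\<^sub>m (dimv X (vt (i - 1))) 1"
  shows "\<exists>h. morph Q h (Mt Q i j) X \<and> eqon Q (comp g h) f"
proof -
  note h = morph_hom_from[OF ij X x(1) z]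
  have "comp g (hom_from X i j x) (vt j) = f (vt j)"
    using x hom_from_top[OF ij x(1)] by (simp add: comp_def)
  then have "eqon Q (comp g (hom_from X i j x)) f"
    by (intro morph_from_Mt_eqI[OF ij Y morph_comp[OF shaped_Mt[OF ij] X Y h g] f])
  with h show ?thesis by blast
qed

abbreviation PP :: "int \<Rightarrow> 'k rep" where "PP j \<equiv> Mt Q (st j) j"

lemma st_window: "st j \<le> j" "j < st j + int (mm Q)"
  using st_le[of j] st_gt[of j] by auto

text \<open>Surjectivity is asked for at the top vertex only; the preimage satisfies the defining
  relation of the projective automatically, as \<open>X\<close> is a module.\<close>

lemma proj_lift:
  fixes X Y :: "'k rep"
  assumes X: "is_mod Q X" and Y: "shaped Y" and g: "morph Q g X Y" and f: "morph Q f (PP j) Y"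
    and s: "rinv (g (vt j))"
  shows "\<exists>h. morph Q h (PP j) X \<and> eqon Q (comp g h) f"
proof -
  note [simp] = morph_dim[OF g] morph_dim[OF f]
  from s obtain R where R: "R \<in> carrier_mat (dimv X (vt j)) (dimv Y (vt j))" "g (vt j) * R = 1\<^sub>m (dimv Y (vt j))"
    unfolding rinv_def by auto
  have d: "dimv (PP j) (vt j) = 1" by (rule Mt_dim_top[OF st_window])
  have x: "R * f (vt j) \<in> carrier_mat (dimv X (vt j)) 1"
    using R(1) d by (intro carrier_matI) simp_all
  have "g (vt j) * (R * f (vt j)) = (g (vt j) * R) * f (vt j)"
    by (rule mult_assoc_dim[symmetric]) (use R(1) in simp_all)
  then have "g (vt j) * (R * f (vt j)) = f (vt j)" unfolding R(2) by simp
  then show ?thesis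
    by (rule hom_lift[OF st_window is_mod_shaped[OF X] Y g f x _ mod_proj_top[OF X x order_refl]])
qed

lemma is_mod_PP: "is_mod Q (PP j)"
  by (rule is_mod_Mt) (use st_window in auto)

lemma projective_PP: "projective Q (PP j)"
  unfolding projective_def
proof (intro conjI allI impI is_mod_PP)
  fix X Y :: "'k rep" and g f
  assume a: "is_mod Q X \<and> is_mod Q Y \<and> morph Q g X Y \<and> surj_m Q g X Y \<and> morph Q f (PP j) Y"
  then have "rinv (g (vt j))" using surj_m_iff[of g X Y] by blast
  then show "\<exists>h. morph Q h (PP j) X \<and> eqon Q (comp g h) f"
    using a proj_lift[of X Y g f j] is_mod_shaped[of Y] by blast
qed

text \<open>Each \<open>b_t\<close> arises from the top vector along a path, so a preimage of the
  top vector moves along this path to a preimage of \<open>b_t\<close>.\<close>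

lemma surj_onto_Mt:
  fixes Z :: "'k rep"
  assumes ij: "i \<le> j" "j < i + int (mm Q)" and Z: "shaped Z" and h: "morph Q h Z (Mt Q i j)"
    and s: "rinv (h (vt j))"
  shows "surj_m Q h Z (Mt Q i j)"
  unfolding surj_m_iff[OF h]
proof
  fix t
  note [simp] = morph_dim[OF h] pathm_dim[OF Z]
  show "rinv (h (vt t))"
  proof (rule all_windowI[of i])
    fix t assume t: "i \<le> t" "t < i + int (mm Q)"
    show "rinv (h (vt t))"
    proof (cases "t \<le> j")
      case True
      have d: "dimv (Mt Q i j :: 'k rep) (vt j) = 1" by (rule Mt_dim_top[OF ij])
      from s obtain R where R: "R \<in> carrier_mat (dimv Z (vt j)) 1" "h (vt j) * R = 1\<^sub>m 1"
        unfolding rinv_def using d by auto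
      have "h (vt t) * pathm Q Z j (nat (j - t)) = pathm Q (Mt Q i j) j (nat (j - t)) * h (vt j)"
        using morph_pathm[OF Z shaped_Mt[OF ij] h, of j "nat (j - t)"] True by simp
      also have "pathm Q (Mt Q i j :: 'k rep) j (nat (j - t)) = 1\<^sub>m 1"
        by (rule pathm_Mt_id[OF ij]) (use t True in simp_all)
      also have "1\<^sub>m 1 * h (vt j) = h (vt j)" using d by simp
      finally have e: "h (vt t) * pathm Q Z j (nat (j - t)) = h (vt j)" .
      have "h (vt t) * (pathm Q Z j (nat (j - t)) * R) = h (vt t) * pathm Q Z j (nat (j - t)) * R"
        by (rule mult_assoc_dim[symmetric]) (use R(1) True in simp_all)
      then have "h (vt t) * (pathm Q Z j (nat (j - t)) * R) = 1\<^sub>m 1" unfolding e R(2) .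
      then show ?thesis unfolding rinv_def using Mt_dim[OF ij t, where 'k='k] True R(1)
        by (intro bexI[of _ "pathm Q Z j (nat (j - t)) * R"]) (auto intro!: carrier_matI)
    next
      case False
      then show ?thesis using Mt_dim[OF ij t, where 'k='k] by (intro rinv_no_rows) simp
    qed
  qed
qed

lemma quotient_hom:
  assumes "i \<le> a" "a \<le> j" "j < i + int (mm Q)"
  shows "morph Q (hom_from (Mt Q a j :: 'k rep) i j (1\<^sub>m 1)) (Mt Q i j) (Mt Q a j)"
    and "surj_m Q (hom_from (Mt Q a j :: 'k rep) i j (1\<^sub>m 1)) (Mt Q i j) (Mt Q a j)"
    and "hom_from (Mt Q a j :: 'k rep) i j (1\<^sub>m 1) (vt j) = 1\<^sub>m 1"
proof -
  have w: "i \<le> j" "j < i + int (mm Q)" "a \<le> j" "j < a + int (mm Q)" using assms by auto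
  note d = Mt_dim_top[OF w(3,4), where 'k='k]
  have one: "(1\<^sub>m 1 :: 'k mat) \<in> carrier_mat (dimv (Mt Q a j :: 'k rep) (vt j)) 1" using d by simp
  have "kills Q (Mt Q a j :: 'k rep) j (Suc (nat (j - i)))"
    by (rule kills_Mt[OF w(3,4)]) (use assms in auto)
  then have z: "pathm Q (Mt Q a j :: 'k rep) j (Suc (nat (j - i))) * 1\<^sub>m 1 = 0\<^sub>m (dimv (Mt Q a j :: 'k rep) (vt (i - 1))) 1"
    unfolding kills_def using d assms by simp
  show m: "morph Q (hom_from (Mt Q a j :: 'k rep) i j (1\<^sub>m 1)) (Mt Q i j) (Mt Q a j)"
    by (rule morph_hom_from[OF w(1,2) shaped_Mt[OF w(3,4)] one z])
  show t: "hom_from (Mt Q a j :: 'k rep) i j (1\<^sub>m 1) (vt j) = 1\<^sub>m 1"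
    by (rule hom_from_top[OF w(1,2) one])
  show "surj_m Q (hom_from (Mt Q a j :: 'k rep) i j (1\<^sub>m 1)) (Mt Q i j) (Mt Q a j)"
    by (rule surj_onto_Mt[OF w(3,4) shaped_Mt[OF w(1,2)] m]) (simp add: t del: One_nat_def)
qed

lemma Smod_vt: "Smod Q (vt t) = (Mt Q t t :: 'k rep)"
  unfolding Smod_def by (rule Mt_cong) (simp_all add: int_vt)

lemma mm_ge2: "2 \<le> mm Q"
  using pl_ge2 pl_le order_trans by blast

lemma proj_cover_PP:
  "proj_cover Q (PP j) (hom_from (Mt Q j j) (st j) j (1\<^sub>m 1)) (Smod Q (vt j))"
proof -
  let ?p = "hom_from (Mt Q j j :: 'k rep) (st j) j (1\<^sub>m 1)"
  have jj: "j \<le> j" "j < j + int (mm Q)" using m_pos by auto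
  note q = quotient_hom[of "st j" j j, OF st_window(1) order_refl st_window(2)]
  have "surj_m Q h Z (PP j)" if Z: "is_mod Q Z" "morph Q h Z (PP j)" "surj_m Q (comp ?p h) Z (Mt Q j j)" for Z h
  proof -
    note Zs = is_mod_shaped[OF Z(1)]
    have "morph Q (comp ?p h) Z (Mt Q j j)"
      by (rule morph_comp[OF Zs shaped_Mt[OF st_window] shaped_Mt[OF jj] Z(2) q(1)])
    then have "rinv (comp ?p h (vt j))" using Z(3) surj_m_iff by blast
    then have "rinv (h (vt j))" unfolding comp_def q(3)
      using morph_dim[OF Z(2), of j] Mt_dim_top[OF st_window, of j, where 'k='k] by simp
    then show ?thesis by (rule surj_onto_Mt[OF st_window Zs Z(2)])
  qed
  moreover have "is_mod Q (Mt Q j j :: 'k rep)" by (rule is_mod_Mt) (use st_window in auto)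
  ultimately show ?thesis unfolding proj_cover_def Smod_vt using projective_PP q by blast
qed

section \<open>Socles of projective covers and translates of simples\<close>

lemma retract_linv:
  fixes X Y :: "'k rep"
  assumes "shaped X" "shaped Y" "morph Q f X Y" "morph Q g Y X" "eqon Q (comp g f) (idm X)" "linv (mapv Y (vt t))"
  shows "linv (mapv X (vt t))"
proof -
  note d [simp] = morph_dim[OF assms(3)] morph_dim[OF assms(4)] shaped_dim[OF assms(1)] shaped_dim[OF assms(2)]
  from assms(6) obtain L where L: "L \<in> carrier_mat (dimv Y (vt t)) (dimv Y (vt (t - 1)))"
      "L * mapv Y (vt t) = 1\<^sub>m (dimv Y (vt t))" unfolding linv_def by auto
  have [simp]: "dim_row L = dimv Y (vt t)" "dim_col L = dimv Y (vt (t - 1))" using L(1) by auto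
  have "g (vt t) * L * f (vt (t - 1)) * mapv X (vt t) = g (vt t) * (L * (f (vt (t - 1)) * mapv X (vt t)))"
    by (simp add: mult_assoc_dim)
  also have "\<dots> = g (vt t) * ((L * mapv Y (vt t)) * f (vt t))"
    unfolding morph_commute[OF assms(3)] by (simp add: mult_assoc_dim)
  also have "\<dots> = 1\<^sub>m (dimv X (vt t))"
    unfolding L(2) using assms(5) unfolding eqon_comp_idm by simp
  finally show ?thesis unfolding linv_def
    by (intro bexI[of _ "g (vt t) * L * f (vt (t - 1))"]) (auto intro!: carrier_matI)
qed

text \<open>Any projective cover \<open>P\<close> is a retract of \<open>PP j\<close>: minimality
  makes a lift \<open>PP j \<rightarrow> P\<close> surjective, and projectivity of \<open>P\<close>
  splits it. A non-injective arrow of \<open>P\<close> is then non-injective on \<open>PP j\<close>,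
  whose socle is known.\<close>

lemma proj_cover_soc:
  fixes P :: "'k rep"
  assumes pc: "proj_cover Q P p (Smod Q (vt j))" and s: "soc_simple Q P s"
  shows "s = vt (st j)"
proof -
  let ?p = "hom_from (Mt Q j j :: 'k rep) (st j) j (1\<^sub>m 1)"
  have jj: "j \<le> j" "j < j + int (mm Q)" using m_pos by auto
  note q = quotient_hom[of "st j" j j, OF st_window(1) order_refl st_window(2)]
  have P: "projective Q P" "is_mod Q P" "morph Q p P (Mt Q j j)" "surj_m Q p P (Mt Q j j)"
    and min: "\<And>Z h. is_mod Q Z \<Longrightarrow> morph Q h Z P \<Longrightarrow> surj_m Q (comp p h) Z (Mt Q j j) \<Longrightarrow> surj_m Q h Z P"
    using pc unfolding proj_cover_def Smod_vt projective_def by blast+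
  note Ps = is_mod_shaped[OF P(2)]
  have "rinv (p (vt j))" using P(4) surj_m_iff[OF P(3)] by blast
  from proj_lift[OF P(2) shaped_Mt[OF jj] P(3) q(1) this]
  obtain g where g: "morph Q g (PP j) P" "eqon Q (comp p g) ?p" by blast
  have "surj_m Q (comp p g) (PP j) (Mt Q j j)"
    using q(2) g(2) unfolding surj_m_def eqon_def by simp
  then have "surj_m Q g (PP j) P" by (rule min[OF is_mod_PP g(1)])
  moreover have "morph Q (idm P) P P" by (rule morph_id[OF Ps])
  ultimately obtain a where a: "morph Q a P (PP j)" "eqon Q (comp g a) (idm P)"
    using P(1,2) g(1) is_mod_PP[of j] unfolding projective_def by blast
  have sV: "s \<in> V Q" using s unfolding soc_simple_def by simp
  obtain t where t: "s = vt t" using vt_of_V[OF sV] by metis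
  have "soc_nz Q P s" using s unfolding soc_simple_def soc_nz_def by blast
  then have "\<not> linv (mapv P (vt t))" unfolding t soc_nz_iff[OF Ps] .
  then have "\<not> linv (mapv (PP j) (vt t))"
    using retract_linv[OF Ps shaped_Mt[OF st_window] a(1) g(1) a(2)] by blast
  then show ?thesis using Mt_linv[OF st_window] unfolding t by blast
qed

lemma soc_simple_PP: "soc_simple Q (PP j) (vt (st j))"
proof -
  note Ps = shaped_Mt[OF st_window, of j, where 'k='k]
  note d = Mt_dim_soc[OF st_window, of j, where 'k='k]
  have "\<not> soc_nz Q (PP j) v" if "v \<in> V Q" "v \<noteq> vt (st j)" for v
    using soc_nz_iff[OF Ps, of "int v"] Mt_linv[OF st_window, of "int v" j, where 'k='k] that vt_of_V by simp
  moreover have "\<exists>x\<in>carrier_vec (dimv (PP j) (vt (st j))). x \<noteq> 0\<^sub>v (dimv (PP j) (vt (st j))) \<and>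
      mapv (PP j) (vt (st j)) *\<^sub>v x = 0\<^sub>v (dimv (PP j) (tgt Q (vt (st j)))) \<and>
      (\<forall>y\<in>carrier_vec (dimv (PP j) (vt (st j))). mapv (PP j) (vt (st j)) *\<^sub>v y =
         0\<^sub>v (dimv (PP j) (tgt Q (vt (st j)))) \<longrightarrow> (\<exists>c. y = c \<cdot>\<^sub>v x))"
    unfolding d
  proof (intro bexI[of _ "unit_vec 1 0"] conjI ballI impI)
    show "unit_vec 1 0 \<noteq> (0\<^sub>v 1 :: 'k vec)"
    proof
      assume "unit_vec 1 0 = (0\<^sub>v 1 :: 'k vec)"
      then have "unit_vec 1 0 $ 0 = (0\<^sub>v 1 :: 'k vec) $ 0" by simp
      then show False by simp
    qed
    show "mapv (PP j) (vt (st j)) *\<^sub>v unit_vec 1 0 = 0\<^sub>v (dimv (PP j) (tgt Q (vt (st j))))"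
      using Mt_map_zero[OF st_window, of "st j" j, where 'k='k] d by (auto intro!: eq_vecI)
    fix y :: "'k vec" assume "y \<in> carrier_vec 1"
    then have "y = y $ 0 \<cdot>\<^sub>v unit_vec 1 0" by (intro eq_vecI) auto
    then show "\<exists>c. y = c \<cdot>\<^sub>v unit_vec 1 0" by blast
  qed simp
  ultimately show ?thesis unfolding soc_simple_def by simp
qed

text \<open>Otherwise both end terms vanish at \<open>s - 1\<close>, hence so does \<open>E\<close>.
  A preimage of the generator of \<open>S_s\<close> is then killed by the arrow leaving
  \<open>s\<close>, which gives a section of \<open>g\<close>.\<close>

lemma almost_split_tau:
  fixes E :: "'k rep"
  assumes as: "almost_split Q (Smod Q w) E (Smod Q (vt s))" and w: "w \<in> V Q"
  shows "w = vt (s - 1)"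
proof (rule ccontr)
  assume ne: "w \<noteq> vt (s - 1)"
  let ?N = "Smod Q w :: 'k rep" and ?S = "Mt Q s s :: 'k rep"
  have ss: "s \<le> s" "s < s + int (mm Q)" using m_pos by auto
  from as obtain f g where E: "is_mod Q E" and se: "short_exact Q f g ?N E ?S"
    and ra: "right_almost_split Q g E ?S" unfolding almost_split_def Smod_vt by blast
  note Es = is_mod_shaped[OF E]
  from se have g: "morph Q g E ?S" "surj_m Q g E ?S"
    and ex: "\<And>y. y \<in> carrier_vec (dimv E (vt (s - 1))) \<Longrightarrow> g (vt (s - 1)) *\<^sub>v y = 0\<^sub>v (dimv ?S (vt (s - 1))) \<Longrightarrow>
      \<exists>x\<in>carrier_vec (dimv ?N (vt (s - 1))). f (vt (s - 1)) *\<^sub>v x = y"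
    and fm: "morph Q f ?N E"
    unfolding short_exact_def by auto
  note [simp] = morph_dim[OF g(1)] shaped_dim[OF Es]
  have dS: "dimv ?S (vt s) = 1" by (rule Mt_dim_top[OF ss])
  have dS0: "dimv ?S (vt (s - 1)) = 0"
    using Mt_dim[OF ss, of "s - 1 + int (mm Q)", where 'k='k] mm_ge2 vt_eq_iff[of "s - 1 + int (mm Q)" "s - 1"] by simp
  have dN0: "dimv ?N (vt (s - 1)) = 0"
  proof -
    have ww: "int w \<le> int w" "int w < int w + int (mm Q)" using m_pos by auto
    have "vt (s - 1) \<noteq> vt (int w) \<longrightarrow> dimv (Mt Q (int w) (int w) :: 'k rep) (vt (s - 1)) = 0"
      by (rule all_windowI[of "int w"]) (use Mt_dim[OF ww, where 'k='k] in auto)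
    then show ?thesis using ne vt_of_V[OF w] unfolding Smod_def by simp
  qed
  from g(2) have "rinv (g (vt s))" using surj_m_iff[OF g(1)] by blast
  then obtain y where y: "y \<in> carrier_mat (dimv E (vt s)) 1" "g (vt s) * y = 1\<^sub>m 1"
    unfolding rinv_def using dS by auto
  let ?z = "mapv E (vt s) * y"
  have z0: "z = 0\<^sub>v (dimv E (vt (s - 1)))" if z: "z \<in> carrier_vec (dimv E (vt (s - 1)))" for z :: "'k vec"
  proof -
    have "g (vt (s - 1)) *\<^sub>v z = 0\<^sub>v (dimv ?S (vt (s - 1)))" using dS0 by (intro eq_vecI) auto
    from ex[OF z this] obtain x where x: "x \<in> carrier_vec 0" "f (vt (s - 1)) *\<^sub>v x = z" using dN0 by auto
    have "f (vt (s - 1)) *\<^sub>v x = 0\<^sub>v (dimv E (vt (s - 1)))"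
      using x(1) morph_dim[OF fm, of "s - 1"] by (intro eq_vecI) (auto simp: scalar_prod_def)
    with x show ?thesis by simp
  qed
  have "?z = 0\<^sub>m (dimv E (vt (s - 1))) 1"
  proof (rule eq_matI)
    fix a b assume ab: "a < dim_row (0\<^sub>m (dimv E (vt (s - 1))) 1 :: 'k mat)" "b < dim_col (0\<^sub>m (dimv E (vt (s - 1))) 1 :: 'k mat)"
    have "col ?z 0 = 0\<^sub>v (dimv E (vt (s - 1)))" by (rule z0) (simp add: carrier_vecI)
    then have "col ?z 0 $ a = 0" using ab by simp
    moreover have "col ?z 0 $ a = ?z $$ (a, 0)" using ab y(1) by (subst index_col) auto
    ultimately show "?z $$ (a, b) = 0\<^sub>m (dimv E (vt (s - 1))) 1 $$ (a, b)" using ab by simp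
  qed (use y in auto)
  then have z: "pathm Q E s (Suc (nat (s - s))) * y = 0\<^sub>m (dimv E (vt (s - 1))) 1" using y(1) by simp
  have "g (vt s) * y = idm ?S (vt s)" using y dS by (simp add: idm_def)
  from hom_lift[OF ss Es shaped_Mt[OF ss] g(1) morph_id[OF shaped_Mt[OF ss]] y(1) this z]
  have "split_epi Q g E ?S" unfolding split_epi_def .
  with ra show False unfolding right_almost_split_def by blast
qed

text \<open>Both almost split properties are instances of the Fredholm alternative for the arrow at
  \<open>t\<close>. On the left, either the vector given by \<open>u\<close> lies in the image of
  the arrow and \<open>u\<close> extends to the middle term, or a functional killing that image
  retracts \<open>u\<close>. On the right, either \<open>h\<close> factors through the arrow, or a
  kernel vector of the arrow is a section of \<open>h\<close>.\<close>

lemma almost_split_exists: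
  "almost_split Q (Mt Q (t - 1) (t - 1)) (Mt Q (t - 1) t) (Mt Q t t :: 'k rep)"
proof -
  let ?N = "Mt Q (t - 1) (t - 1) :: 'k rep" and ?E = "Mt Q (t - 1) t :: 'k rep" and ?S = "Mt Q t t :: 'k rep"
  have tt: "t \<le> t" "t < t + int (mm Q)" and nn: "t - 1 \<le> t - 1" "t - 1 < t - 1 + int (mm Q)"
    and te: "t - 1 \<le> t" "t < t - 1 + int (mm Q)" using mm_ge2 by auto
  have mods: "is_mod Q ?N" "is_mod Q ?E" "is_mod Q ?S"
    by (rule is_mod_Mt; use st_le[of t] st_le[of "t - 1"] in simp)+
  let ?f = "hom_from ?E (t - 1) (t - 1) (1\<^sub>m 1)"
  let ?g = "hom_from ?S (t - 1) t (1\<^sub>m 1)"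
  note Es = shaped_Mt[OF te, where 'k='k] and Ns = shaped_Mt[OF nn, where 'k='k] and Ss = shaped_Mt[OF tt, where 'k='k]
  note g = quotient_hom[of "t - 1" t t, OF te(1) order_refl te(2)]
  have dE: "dimv ?E (vt (t - 1)) = 1" "dimv ?E (vt t) = 1"
    by (rule Mt_dim_soc[OF te] Mt_dim_top[OF te])+
  have dN: "dimv ?N (vt (t - 1)) = 1" by (rule Mt_dim_top[OF nn])
  have dS: "dimv ?S (vt t) = 1" by (rule Mt_dim_top[OF tt])
  have dS0: "dimv ?S (vt (t - 1)) = 0"
    using Mt_dim[OF tt, of "t - 1 + int (mm Q)", where 'k='k] mm_ge2 vt_eq_iff[of "t - 1 + int (mm Q)" "t - 1"] by simp
  have one: "(1\<^sub>m 1 :: 'k mat) \<in> carrier_mat (dimv ?E (vt (t - 1))) 1" using dE by simp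
  have f: "morph Q ?f ?N ?E"
    by (rule morph_hom_from[OF nn Es one])
      (use Mt_map_zero[OF te, of "t - 1", where 'k='k] dE in simp)
  have ft: "?f (vt (t - 1)) = 1\<^sub>m 1" by (rule hom_from_top[OF nn one])
  note [simp] = morph_dim[OF f] morph_dim[OF g(1)]
  have "inj_m Q ?f ?N ?E"
    unfolding inj_m_iff[OF f]
  proof
    fix s
    show "linv (?f (vt s))"
    proof (rule all_windowI[of "t - 1"])
      fix s assume s: "t - 1 \<le> s" "s < t - 1 + int (mm Q)"
      show "linv (?f (vt s))"
      proof (cases "s = t - 1")
        case True then show ?thesis using ft by simp
      next
        case False then show ?thesis using Mt_dim[OF nn s, where 'k='k] s by (intro linv_no_cols) (simp del: One_nat_def)
      qed
    qed
  qed
  moreover have "\<forall>v\<in>V Q. \<forall>y\<in>carrier_vec (dimv ?E v). ?g v *\<^sub>v y = 0\<^sub>v (dimv ?S v) \<longleftrightarrow> (\<exists>x\<in>carrier_vec (dimv ?N v). ?f v *\<^sub>v x = y)"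
    unfolding ball_V_window[of _ "t - 1"]
  proof (intro allI impI ballI)
    fix s and y :: "'k vec" assume s: "t - 1 \<le> s \<and> s < t - 1 + int (mm Q)" and y: "y \<in> carrier_vec (dimv ?E (vt s))"
    consider "s = t - 1" | "s = t" | "t < s" using s by linarith
    then show "?g (vt s) *\<^sub>v y = 0\<^sub>v (dimv ?S (vt s)) \<longleftrightarrow> (\<exists>x\<in>carrier_vec (dimv ?N (vt s)). ?f (vt s) *\<^sub>v x = y)"
    proof cases
      case 1
      have y': "y \<in> carrier_vec 1" using y 1 dE by simp
      have "?g (vt s) *\<^sub>v y = 0\<^sub>v (dimv ?S (vt s))" using 1 dS0 by (intro eq_vecI) (auto simp del: One_nat_def)
      moreover have "?f (vt s) *\<^sub>v y = y" unfolding 1 ft using y' by simp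
      ultimately show ?thesis using y' 1 dN by auto
    next
      case 2
      have y': "y \<in> carrier_vec 1" using y 2 dE by simp
      have gy: "?g (vt s) *\<^sub>v y = y" unfolding 2 g(3) using y' by simp
      have dN0: "dimv ?N (vt t) = 0" using Mt_dim[OF nn, of t, where 'k='k] mm_ge2 by simp
      have fx: "?f (vt t) *\<^sub>v x = 0\<^sub>v 1" if "x \<in> carrier_vec 0" for x
        using that dN0 dE by (intro eq_vecI) (auto simp: scalar_prod_def simp del: One_nat_def)
      have "\<exists>x :: 'k vec. x \<in> carrier_vec 0" by (intro exI[of _ "0\<^sub>v 0"]) simp
      then show ?thesis unfolding gy unfolding 2 dS dN0 using fx by auto
    next
      case 3
      have dE0: "dimv ?E (vt s) = 0" using Mt_dim[OF te, of s, where 'k='k] s 3 by simp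
      have dS0: "dimv ?S (vt s) = 0" using Mt_dim[OF tt, of s, where 'k='k] s 3 by simp
      have "?g (vt s) *\<^sub>v y = 0\<^sub>v (dimv ?S (vt s))" using dS0 by (intro eq_vecI) (auto simp del: One_nat_def)
      moreover have "?f (vt s) *\<^sub>v 0\<^sub>v (dimv ?N (vt s)) = y" using dE0 y by (intro eq_vecI) (auto simp del: One_nat_def)
      ultimately show ?thesis by (metis zero_carrier_vec)
    qed
  qed
  ultimately have se: "short_exact Q ?f ?g ?N ?E ?S"
    unfolding short_exact_def using f g by blast
  have la: "left_almost_split Q ?f ?N ?E"
    unfolding left_almost_split_def
  proof (intro conjI allI impI notI)
    assume "split_mono Q ?f ?N ?E"
    then obtain p where p: "morph Q p ?E ?N" "eqon Q (comp p ?f) (idm ?N)" unfolding split_mono_def by blast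
    have dN0: "dimv ?N (vt t) = 0" using Mt_dim[OF nn, of t, where 'k='k] mm_ge2 by simp
    \<comment> \<open>The arrow at \<open>t\<close> is the identity on the middle term, while the
      left term vanishes at \<open>t\<close>; so \<open>p\<close> is forced to be zero on the
      socle.\<close>
    have "p (vt (t - 1)) = p (vt (t - 1)) * mapv ?E (vt t)"
      using Mt_map_id[OF te, of t, where 'k='k] morph_dim[OF p(1)] dE by simp
    also have "\<dots> = mapv ?N (vt t) * p (vt t)" by (rule morph_commute[OF p(1)])
    also have "\<dots> = 0\<^sub>m 1 1"
      using dN0 dN dE morph_dim[OF p(1), of t] shaped_dim[OF Ns, of t]
      by (intro eq_matI) (auto simp: scalar_prod_def simp del: One_nat_def)
    finally have "p (vt (t - 1)) = 0\<^sub>m 1 1" .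
    moreover have "p (vt (t - 1)) * ?f (vt (t - 1)) = 1\<^sub>m 1" using p(2) dN unfolding eqon_comp_idm by simp
    ultimately show False unfolding ft using one_mat_neq_zero[of 1, where 'a='k] by simp
  next
    fix U :: "'k rep" and u assume a: "is_mod Q U \<and> morph Q u ?N U \<and> \<not> split_mono Q u ?N U"
    then have U: "is_mod Q U" and u: "morph Q u ?N U" and ns: "\<not> split_mono Q u ?N U" by auto
    note Us = is_mod_shaped[OF U]
    note [simp] = shaped_dim[OF Us] morph_dim[OF u]
    have x: "u (vt (t - 1)) \<in> carrier_mat (dimv U (vt (t - 1))) 1" using morph_carrier[OF u] dN by metis
    from Fredholm_alternative[OF shaped_carrier[OF Us] x]
    show "\<exists>w. morph Q w ?E U \<and> eqon Q (comp w ?f) u"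
    proof
      assume "\<exists>y\<in>carrier_mat (dimv U (vt t)) 1. mapv U (vt t) * y = u (vt (t - 1))"
      then obtain y where y: "y \<in> carrier_mat (dimv U (vt t)) 1" "mapv U (vt t) * y = u (vt (t - 1))" by blast
      have [simp]: "dim_row y = dimv U (vt t)" "dim_col y = 1" using y(1) by auto
      have n: "nat (t - (t - 1)) = Suc 0" by simp
      have "pathm Q U t (Suc (Suc 0)) * y = mapv U (vt (t - 1)) * (mapv U (vt t) * y)"
        by (simp add: mult_assoc_dim)
      also have "\<dots> = u (vt (t - 1 - 1)) * mapv ?N (vt (t - 1))"
        unfolding y(2) by (rule morph_commute[OF u, symmetric])
      also have "\<dots> = 0\<^sub>m (dimv U (vt (t - 1 - 1))) 1"
        using Mt_map_zero[OF nn, of "t - 1", where 'k='k] dN by simp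
      finally have z: "pathm Q U t (Suc (nat (t - (t - 1)))) * y = 0\<^sub>m (dimv U (vt (t - 1 - 1))) 1"
        unfolding n .
      let ?w = "hom_from U (t - 1) t y"
      have w: "morph Q ?w ?E U" by (rule morph_hom_from[OF te Us y(1) z])
      have "?w (vt (t - 1)) = u (vt (t - 1))"
        using hom_from_window[OF te, of "t - 1" U y] te y by (simp add: n)
      then have "eqon Q (comp ?w ?f) u"
        by (intro morph_from_Mt_eqI[OF nn Us morph_comp[OF Ns Es Us f w] u]) (simp add: comp_def ft dN del: One_nat_def)
      with w show ?thesis by blast
    next
      assume "\<exists>y\<in>carrier_mat 1 (dimv U (vt (t - 1))). y * mapv U (vt t) = 0\<^sub>m 1 (dimv U (vt t)) \<and> y * u (vt (t - 1)) = 1\<^sub>m 1"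
      then obtain y where y: "y \<in> carrier_mat 1 (dimv U (vt (t - 1)))" "y * mapv U (vt t) = 0\<^sub>m 1 (dimv U (vt t))"
        "y * u (vt (t - 1)) = 1\<^sub>m 1" by blast
      let ?p = "hom_to U (t - 1) (t - 1) y"
      have p: "morph Q ?p U ?N" by (rule morph_hom_to[OF nn Us y(1)]) (use y(2) in simp)
      have "?p (vt (t - 1)) = y" using hom_to_window[OF nn, of "t - 1" U y] nn y(1) by simp
      then have "eqon Q (comp ?p u) (idm ?N)"
        by (intro morph_from_Mt_eqI[OF nn Ns morph_comp[OF Ns Us Ns u p] morph_id[OF Ns]])
          (simp add: comp_def idm_def dN y(3))
      with p ns show ?thesis unfolding split_mono_def by blast
    qed
  qed
  have ra: "right_almost_split Q ?g ?E ?S"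
    unfolding right_almost_split_def
  proof (intro conjI allI impI notI)
    assume "split_epi Q ?g ?E ?S"
    then obtain s where s: "morph Q s ?S ?E" "eqon Q (comp ?g s) (idm ?S)" unfolding split_epi_def by blast
    have "s (vt t) = mapv ?E (vt t) * s (vt t)"
      using Mt_map_id[OF te, of t, where 'k='k] morph_dim[OF s(1), of t] dE by simp
    also have "\<dots> = s (vt (t - 1)) * mapv ?S (vt t)" by (rule morph_commute[OF s(1), symmetric])
    also have "\<dots> = 0\<^sub>m 1 1"
      using dS0 dS dE morph_dim[OF s(1), of "t - 1"] shaped_dim[OF Ss, of t]
      by (intro eq_matI) (auto simp: scalar_prod_def simp del: One_nat_def)
    finally have "s (vt t) = 0\<^sub>m 1 1" .
    moreover have "?g (vt t) * s (vt t) = 1\<^sub>m 1" using s(2) dS unfolding eqon_comp_idm by simp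
    ultimately show False unfolding g(3) using one_mat_neq_zero[of 1, where 'a='k] by simp
  next
    fix X :: "'k rep" and h assume a: "is_mod Q X \<and> morph Q h X ?S \<and> \<not> split_epi Q h X ?S"
    then have X: "is_mod Q X" and h: "morph Q h X ?S" and ns: "\<not> split_epi Q h X ?S" by auto
    note Xs = is_mod_shaped[OF X]
    note [simp] = shaped_dim[OF Xs] morph_dim[OF h]
    have ht: "h (vt t) \<in> carrier_mat 1 (dimv X (vt t))" using morph_carrier[OF h] dS by metis
    from Fredholm_alternative_row[OF shaped_carrier[OF Xs] ht]
    show "\<exists>w. morph Q w X ?E \<and> eqon Q (comp ?g w) h"
    proof
      assume "\<exists>y\<in>carrier_mat 1 (dimv X (vt (t - 1))). y * mapv X (vt t) = h (vt t)"
      then obtain y where y: "y \<in> carrier_mat 1 (dimv X (vt (t - 1)))" "y * mapv X (vt t) = h (vt t)" by blast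
      have [simp]: "dim_col y = dimv X (vt (t - 1))" "dim_row y = 1" using y(1) by auto
      have n: "nat (t - (t - 1)) = Suc 0" by simp
      have "y * pathm Q X (t + 1) (Suc (Suc 0)) = (y * mapv X (vt t)) * mapv X (vt (t + 1))"
        by (simp add: mult_assoc_dim)
      also have "\<dots> = mapv ?S (vt (t + 1)) * h (vt (t + 1))"
        unfolding y(2) using morph_commute[OF h, of "t + 1"] by simp
      also have "\<dots> = 0\<^sub>m 1 (dimv X (vt (t + 1)))"
        using Mt_map_above_top[OF tt, where 'k='k] by simp
      finally have z: "y * pathm Q X (t + 1) (Suc (nat (t - (t - 1)))) = 0\<^sub>m 1 (dimv X (vt (t + 1)))"
        unfolding n .
      let ?w = "hom_to X (t - 1) t y"
      have w: "morph Q ?w X ?E" by (rule morph_hom_to[OF te Xs y(1) z])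
      have wt: "?w (vt t) = h (vt t)"
        using hom_to_window[OF te, of t X y] te y by (simp add: n)
      have "eqon Q (comp ?g ?w) h"
      proof (rule eqon_windowI[of t])
        fix s assume s: "t \<le> s" "s < t + int (mm Q)"
        show "comp ?g ?w (vt s) = h (vt s)"
        proof (cases "s = t")
          case True
          then show ?thesis using g(3) wt dS by (simp add: comp_def)
        next
          case False
          then show ?thesis using Mt_dim[OF tt s, where 'k='k] s
            by (intro mat_eq_no_rows) (simp_all add: comp_def morph_dim[OF w] del: One_nat_def)
        qed
      qed
      with w show ?thesis by blast
    next
      assume "\<exists>x\<in>carrier_mat (dimv X (vt t)) 1. mapv X (vt t) * x = 0\<^sub>m (dimv X (vt (t - 1))) 1 \<and> h (vt t) * x = 1\<^sub>m 1"
      then obtain x where x: "x \<in> carrier_mat (dimv X (vt t)) 1"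
        "mapv X (vt t) * x = 0\<^sub>m (dimv X (vt (t - 1))) 1" "h (vt t) * x = 1\<^sub>m 1" by blast
      have "h (vt t) * x = idm ?S (vt t)" using x(3) dS by (simp add: idm_def)
      moreover have "pathm Q X t (Suc (nat (t - t))) * x = 0\<^sub>m (dimv X (vt (t - 1))) 1" using x(2) by simp
      ultimately have "split_epi Q h X ?S"
        unfolding split_epi_def by (rule hom_lift[OF tt Xs Ss h morph_id[OF Ss] x(1)])
      with ns show ?thesis by blast
    qed
  qed
  show ?thesis unfolding almost_split_def using mods se la ra by blast
qed

lemma res_arrow_iff: "res_arrow TYPE('k) Q (vt t) w \<longleftrightarrow> w = vt (st t - 1)"
proof
  assume "res_arrow TYPE('k) Q (vt t) w"
  then obtain P :: "'k rep" and p s E where w: "w \<in> V Q" and a: "proj_cover Q P p (Smod Q (vt t))" "soc_simple Q P s"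
    "almost_split Q (Smod Q w :: 'k rep) E (Smod Q s)" unfolding res_arrow_def by blast
  have "s = vt (st t)" by (rule proj_cover_soc[OF a(1,2)])
  then show "w = vt (st t - 1)" using almost_split_tau[OF _ w] a(3) by blast
next
  assume "w = vt (st t - 1)"
  then show "res_arrow TYPE('k) Q (vt t) w"
    unfolding res_arrow_def
    using proj_cover_PP[of t] soc_simple_PP[of t] almost_split_exists[of "st t"]
    unfolding Smod_vt[symmetric] using vt_in_V by blast
qed

section \<open>Epimorphisms and projectives in the wide subcategory\<close>

definition cyc :: "int \<Rightarrow> bool" where
  "cyc t \<longleftrightarrow> cyclic_simple TYPE('k) Q (vt t)"

lemma cyc_cong: "vt s = vt t \<Longrightarrow> cyc s \<longleftrightarrow> cyc t"
  by (simp add: cyc_def)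

lemma cyclic_simple_in_V: "cyclic_simple TYPE('k) Q v \<Longrightarrow> v \<in> V Q"
  unfolding cyclic_simple_def by (auto dest!: tranclD simp: res_arrow_def)

text \<open>A vertex has only one outgoing arrow, so a cycle through \<open>t\<close> must continue
  with \<open>st t - 1\<close>.\<close>

lemma cyc_step:
  assumes "cyc t" shows "cyc (st t - 1)"
proof -
  let ?R = "{(a, b). res_arrow TYPE('k) Q a b}"
  from assms have "(vt t, vt t) \<in> ?R\<^sup>+" unfolding cyc_def cyclic_simple_def .
  then obtain z where z: "(vt t, z) \<in> ?R" "(z, vt t) \<in> ?R\<^sup>*" by (auto dest: tranclD)
  then have "(z, z) \<in> ?R\<^sup>+" by (rule_tac rtrancl_into_trancl1)
  moreover have "z = vt (st t - 1)" using z(1) by (simp add: res_arrow_iff)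
  ultimately show ?thesis unfolding cyc_def cyclic_simple_def by simp
qed

lemma tau_cyclic_iff:
  "(\<exists>w. cyclic_simple TYPE('k) Q w \<and> (\<exists>E. almost_split Q (Smod Q w :: 'k rep) E (Smod Q (vt s)))) \<longleftrightarrow> cyc (s - 1)"
proof
  assume "\<exists>w. cyclic_simple TYPE('k) Q w \<and> (\<exists>E. almost_split Q (Smod Q w :: 'k rep) E (Smod Q (vt s)))"
  then show "cyc (s - 1)" unfolding cyc_def using almost_split_tau cyclic_simple_in_V by blast
next
  assume "cyc (s - 1)"
  then show "\<exists>w. cyclic_simple TYPE('k) Q w \<and> (\<exists>E. almost_split Q (Smod Q w :: 'k rep) E (Smod Q (vt s)))"
    unfolding cyc_def using almost_split_exists[of s] unfolding Smod_vt[symmetric] by blast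
qed

text \<open>Stated through single arrows, the conditions on top and socle pass to direct sums and
  thus to all objects of \<open>F\<close>.\<close>

lemma in_Xc_iff:
  "in_Xc Q (M :: 'k rep) \<longleftrightarrow> indec Q M \<and> (\<forall>t. \<not> rinv (mapv M (vt (t + 1))) \<longrightarrow> cyc t) \<and>
     (\<forall>t. \<not> linv (mapv M (vt t)) \<longrightarrow> cyc (t - 1))"
proof (cases "indec Q M")
  case True
  then have s: "shaped M" using is_mod_shaped unfolding indec_def by blast
  show ?thesis
    unfolding in_Xc_def ball_V top_nz_iff[OF s] soc_nz_iff[OF s] tau_cyclic_iff cyc_def[symmetric] using True by simp
qed (simp add: in_Xc_def)

lemma in_Xc_iso:
  assumes "iso Q M (N :: 'k rep)" "in_Xc Q N" shows "in_Xc Q M"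
  using assms iso_indec[OF assms(1)] iso_arrow_inv[OF assms(1)] unfolding in_Xc_iff by blast

lemma Mt_in_Xc_iff:
  assumes "i \<le> j" "st j \<le> i"
  shows "in_Xc Q (Mt Q i j :: 'k rep) \<longleftrightarrow> cyc j \<and> cyc (i - 1)"
proof -
  have ij: "i \<le> j" "j < i + int (mm Q)" using assms st_gt[of j] by auto
  have ind: "indec Q (Mt Q i j :: 'k rep)" by (rule Mt_indec[OF ij is_mod_Mt[OF assms]])
  have "(\<forall>t. \<not> rinv (mapv (Mt Q i j :: 'k rep) (vt (t + 1))) \<longrightarrow> cyc t) \<longleftrightarrow> cyc j"
    using Mt_rinv[OF ij, where 'k='k] Mt_not_rinv[OF ij, where 'k='k] cyc_cong by blast
  moreover have "(\<forall>t. \<not> linv (mapv (Mt Q i j :: 'k rep) (vt t)) \<longrightarrow> cyc (t - 1)) \<longleftrightarrow> cyc (i - 1)"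
    using Mt_linv[OF ij, where 'k='k] Mt_not_linv[OF ij, where 'k='k] cyc_cong vt_shift_minus by blast
  ultimately show ?thesis unfolding in_Xc_iff using ind by blast
qed

text \<open>A nonzero path of maximal length in \<open>M\<close> spans a uniserial submodule which, by maximality, also
  admits a retraction.\<close>
lemma indec_uniserial:
  assumes "indec Q (M :: 'k rep)"
  shows "\<exists>i j. 1 \<le> j \<and> j \<le> int (mm Q) \<and> i \<le> j \<and> st j \<le> i \<and> iso Q M (Mt Q i j)"
proof -
  have M: "is_mod Q M" and nz: "\<not> is_zero Q M" using assms unfolding indec_def by auto
  note Ms = is_mod_shaped[OF M]
  note [simp] = shaped_dim[OF Ms] pathm_dim[OF Ms]
  let ?P = "\<lambda>L. \<exists>t. \<not> kills Q M t L"
  have bound: "L < mm Q" if "?P L" for L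
  proof (rule ccontr)
    assume "\<not> L < mm Q"
    then have "kills Q M t L" for t by (intro mod_kills[OF M]) (use st_gt[of t] in linarith)
    with that show False by blast
  qed
  from nz obtain t0 where "0 < dimv M (vt t0)" unfolding is_zero_def ball_V by auto
  then have "?P 0" using one_mat_neq_zero[where 'a='k] unfolding kills_def by auto
  then have "?P (Greatest ?P)" by (rule GreatestI_nat[where P = ?P and b = "mm Q"]) (rule bound[THEN less_imp_le])
  moreover define L where "L = Greatest ?P"
  moreover have max: "kills Q M t (Suc L)" for t
  proof (rule ccontr)
    assume "\<not> kills Q M t (Suc L)"
    then have "?P (Suc L)" by blast
    then have "Suc L \<le> Greatest ?P"
      by (rule Greatest_le_nat[where P = ?P and b = "mm Q"]) (rule bound[THEN less_imp_le])
    then show False by (simp add: L_def)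
  qed
  ultimately obtain t where t: "\<not> kills Q M t L" by blast
  \<comment> \<open>This representative lies between 1 and \<open>m\<close>, the range in which tops
    are enumerated later.\<close>
  define j where "j = int (vt t)"
  define i where "i = j - int L"
  have jt: "vt j = vt t" by (simp add: j_def int_vt)
  have nk: "\<not> kills Q M j L" using t kills_cong[OF jt, of M L] by simp
  have j: "1 \<le> j" "j \<le> int (mm Q)" using vt_in_V[of t] unfolding V_def j_def by auto
  have ij: "i \<le> j" "j < i + int (mm Q)" using bound[of L] nk unfolding i_def by auto
  have st: "st j \<le> i" using mod_kills[OF M, of j L] nk unfolding i_def by linarith
  have nL: "nat (j - i) = L" by (simp add: i_def)
  have vi: "vt (j - int L) = vt i" by (simp add: i_def)
  from nk have "pathm Q M j L \<noteq> 0\<^sub>m (dimv M (vt i)) (dimv M (vt j))" unfolding kills_def vi .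
  moreover have "pathm Q M j L \<in> carrier_mat (dimv M (vt i)) (dimv M (vt j))"
    by (rule carrier_matI) (simp_all add: vi)
  ultimately obtain y x where y: "y \<in> carrier_mat 1 (dimv M (vt i))" and x: "x \<in> carrier_mat (dimv M (vt j)) 1"
    and yx: "y * (pathm Q M j L * x) = 1\<^sub>m 1" by (metis nonzero_mat_pairing)
  have [simp]: "dim_row x = dimv M (vt j)" "dim_col x = 1" "dim_row y = 1" "dim_col y = dimv M (vt i)"
    using x y by auto
  let ?U = "Mt Q i j :: 'k rep" and ?e = "hom_from M i j x" and ?p = "hom_to M i j y"
  have Us: "shaped ?U" by (rule shaped_Mt[OF ij])
  \<comment> \<open>Maximality of \<open>L\<close> enters twice: on the path from \<open>j\<close>
    it is the relation required of \<open>x\<close>, and on the path from \<open>j + 1\<close> the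
    one required of \<open>y\<close>.\<close>
  have "pathm Q M j (Suc (nat (j - i))) * x = 0\<^sub>m (dimv M (vt (i - 1))) 1"
    using max[of j] unfolding kills_def nL by (simp add: i_def algebra_simps)
  then have e: "morph Q ?e ?U M" by (rule morph_hom_from[OF ij Ms x])
  have "y * pathm Q M (j + 1) (Suc (nat (j - i))) = 0\<^sub>m 1 (dimv M (vt (j + 1)))"
    using max[of "j + 1"] unfolding kills_def nL by (simp add: i_def)
  then have p: "morph Q ?p M ?U" by (rule morph_hom_to[OF ij Ms y])
  have pe: "?p (vt s) * ?e (vt s) = 1\<^sub>m (dimv ?U (vt s))" for s
  proof (rule all_windowI[of i])
    fix s assume s: "i \<le> s" "s < i + int (mm Q)"
    show "?p (vt s) * ?e (vt s) = 1\<^sub>m (dimv ?U (vt s))"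
    proof (cases "s \<le> j")
      case True
      let ?a = "nat (j - s)" and ?b = "nat (s - i)"
      have ab: "?a + ?b = L" "j - int ?a = s" "s - int ?b = i" using True s by (auto simp: i_def)
      have "?p (vt s) * ?e (vt s) = (y * pathm Q M s ?b) * (pathm Q M j ?a * x)"
        using hom_to_window[OF ij s, of M y] hom_from_window[OF ij s, of M x] True by simp
      also have "\<dots> = y * ((pathm Q M s ?b * pathm Q M j ?a) * x)"
        using ab(2,3) by (simp add: mult_assoc_dim)
      also have "pathm Q M s ?b * pathm Q M j ?a = pathm Q M j L"
        using pathm_add[OF Ms, of j ?a ?b] unfolding ab by simp
      finally show ?thesis using yx Mt_dim[OF ij s, where 'k='k] True by simp
    next
      case False
      then show ?thesis using Mt_dim[OF ij s, where 'k='k] morph_dim[OF e, of s] morph_dim[OF p, of s]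
        by (intro mat_eq_no_rows) simp_all
    qed
  qed
  from iso_line_complement[OF M Us e p pe] obtain K where K: "is_mod Q K" "iso Q M (dsum Q ?U K)"
    using Mt_dim_le[OF ij] by blast
  have "is_zero Q K"
    using assms K is_mod_Mt[OF ij(1) st] Mt_nonzero[OF ij, where 'k='k] unfolding indec_def by blast
  then have K0: "dimv K (vt s) = 0" for s unfolding is_zero_def by simp
  note Ks = is_mod_shaped[OF K(1)]
  let ?i2 = "\<lambda>v. 0\<^sub>m (dimv ?U v) (dimv K v) :: 'k mat" and ?p2 = "\<lambda>v. 0\<^sub>m (dimv K v) (dimv ?U v) :: 'k mat"
  have m2: "morph Q ?i2 K ?U" "morph Q ?p2 ?U K"
    unfolding morph_iff by (auto simp: shaped_dim[OF Ks] shaped_dim[OF Us])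
  have "iso Q ?U (dsum Q ?U K)"
    by (rule iso_dsum[OF Us Us Ks morph_id[OF Us] morph_id[OF Us] m2])
      (auto simp: idm_def K0 intro: mat_eq_no_cols)
  then have "iso Q M ?U" using K(2) iso_trans iso_sym by blast
  then show ?thesis using j ij(1) st by blast
qed

lemma in_Xc_uniserial:
  assumes "in_Xc Q (M :: 'k rep)"
  shows "\<exists>i j. 1 \<le> j \<and> j \<le> int (mm Q) \<and> i \<le> j \<and> st j \<le> i \<and> cyc j \<and> cyc (i - 1) \<and> iso Q M (Mt Q i j)"
proof -
  have "indec Q M" using assms unfolding in_Xc_def by simp
  from indec_uniserial[OF this] obtain i j where ij: "1 \<le> j" "j \<le> int (mm Q)" "i \<le> j" "st j \<le> i"
    and iso: "iso Q M (Mt Q i j)" by blast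
  have "in_Xc Q (Mt Q i j :: 'k rep)" by (rule in_Xc_iso[OF iso_sym[OF iso] assms])
  then show ?thesis using ij iso Mt_in_Xc_iff[OF ij(3,4)] by blast
qed

text \<open>Both conditions of the class concern the same arrow: it is surjective since
  \<open>t - 1\<close> is not a top, and injective since \<open>t\<close> is not in the socle, its
  translate being \<open>t - 1\<close>.\<close>

lemma in_F_arrow_inv:
  assumes "in_F Q (Y :: 'k rep)" "\<not> cyc (t - 1)"
  shows "rinv (mapv Y (vt t))" "linv (mapv Y (vt t))"
proof -
  from assms(1) obtain Ms where Ms: "\<And>X. X \<in> set Ms \<Longrightarrow> in_Xc Q X" "iso Q Y (foldr (dsum Q) Ms zero_rep)"
    unfolding in_F_def by blast
  have s: "shaped X" if "X \<in> set Ms" for X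
    using Ms(1)[OF that] is_mod_shaped unfolding in_Xc_def indec_def by blast
  have "rinv (mapv X (vt t))" "linv (mapv X (vt t))" if "X \<in> set Ms" for X
    using Ms(1)[OF that] assms(2) unfolding in_Xc_iff by force+
  then have "rinv (mapv (foldr (dsum Q) Ms zero_rep) (vt t))" "linv (mapv (foldr (dsum Q) Ms zero_rep) (vt t))"
    using rinv_foldr_dsum[OF s] linv_foldr_dsum[OF s] by blast+
  then show "rinv (mapv Y (vt t))" "linv (mapv Y (vt t))" using iso_arrow_inv[OF Ms(2)] by blast+
qed

lemma in_F_path_inv:
  assumes Y: "in_F Q (Y :: 'k rep)" and "\<And>s. t - int L \<le> s \<Longrightarrow> s < t \<Longrightarrow> \<not> cyc s"
  shows "rinv (pathm Q Y t L) \<and> linv (pathm Q Y t L)"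
  using assms(2)
proof (induction L)
  case (Suc L)
  have Ys: "shaped Y" using Y is_mod_shaped unfolding in_F_def by blast
  have "\<not> cyc (t - int L - 1)" by (rule Suc.prems) auto
  then show ?case using Suc in_F_arrow_inv[OF Y, of "t - int L"]
    by (auto intro!: rinv_mult linv_mult simp: shaped_dim[OF Ys] pathm_dim[OF Ys])
qed simp

text \<open>Take a functional killing the image of \<open>g\<close> and compose it with arrows as long as it stays nonzero.
  The result \<open>y\<close> lives at a vertex \<open>j\<close> in the top of \<open>Y\<close>, hence cyclic, and kills the arrow into \<open>j\<close>.
  The arrows from \<open>j\<close> down to the vertex \<open>i\<close> above the previous cyclic vertex are bijective, so \<open>y\<close> is
  induced by a functional at \<open>i\<close>, which defines a nonzero morphism \<open>Y \<rightarrow> Mt i j\<close> killing \<open>g\<close>.\<close>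
lemma epi_F_surj:
  fixes X Y :: "'k rep"
  assumes epi: "epi_F Q g X Y" shows "rinv (g (vt t))"
proof (rule ccontr)
  assume nr: "\<not> rinv (g (vt t))"
  have XF: "in_F Q X" and YF: "in_F Q Y" and g: "morph Q g X Y"
    and cancel: "\<And>Z h1 h2. in_F Q Z \<Longrightarrow> morph Q h1 Y Z \<Longrightarrow> morph Q h2 Y Z \<Longrightarrow>
      eqon Q (comp h1 g) (comp h2 g) \<Longrightarrow> eqon Q h1 h2" using epi unfolding epi_F_def by blast+
  have X: "is_mod Q X" and Y: "is_mod Q Y" using XF YF unfolding in_F_def by auto
  note Xs = is_mod_shaped[OF X] and Ys = is_mod_shaped[OF Y]
  note [simp] = shaped_dim[OF Xs] shaped_dim[OF Ys] pathm_dim[OF Xs] pathm_dim[OF Ys] morph_dim[OF g]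
  obtain y0 where y0: "y0 \<in> carrier_mat 1 (dimv Y (vt t))" "y0 * g (vt t) = 0\<^sub>m 1 (dimv X (vt t))"
    "y0 \<noteq> 0\<^sub>m 1 (dimv Y (vt t))" by (rule not_rinv_functional[OF morph_carrier[OF g] nr])
  have [simp]: "dim_row y0 = 1" "dim_col y0 = dimv Y (vt t)" using y0(1) by auto
  let ?P = "\<lambda>L. y0 * pathm Q Y (t + int L) L \<noteq> 0\<^sub>m 1 (dimv Y (vt (t + int L)))"
  have bound: "L < mm Q" if "?P L" for L
  proof (rule ccontr)
    assume "\<not> L < mm Q"
    then have "kills Q Y (t + int L) L" by (intro mod_kills[OF Y]) (use st_gt[of "t + int L"] in linarith)
    with that show False unfolding kills_def by simp
  qed
  define L where "L = Greatest ?P"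
  have "?P 0" using y0(3) by simp
  then have PL: "?P L" unfolding L_def
    by (rule GreatestI_nat[where P = ?P and b = "mm Q"]) (rule bound[THEN less_imp_le])
  have max: "\<not> ?P (Suc L)"
  proof
    assume "?P (Suc L)"
    then have "Suc L \<le> Greatest ?P"
      by (rule Greatest_le_nat[where P = ?P and b = "mm Q"]) (rule bound[THEN less_imp_le])
    then show False by (simp add: L_def)
  qed
  define j where "j = t + int L"
  define y where "y = y0 * pathm Q Y j L"
  have tj: "j - int L = t" by (simp add: j_def)
  have [simp]: "dim_row y = 1" "dim_col y = dimv Y (vt j)" unfolding y_def by simp_all
  have ynz: "y \<noteq> 0\<^sub>m 1 (dimv Y (vt j))" using PL unfolding y_def j_def .
  have yg: "y * g (vt j) = 0\<^sub>m 1 (dimv X (vt j))"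
  proof -
    have "y * g (vt j) = y0 * (pathm Q Y j L * g (vt j))" unfolding y_def by (rule mult_assoc_dim) (simp_all add: tj)
    also have "\<dots> = y0 * (g (vt t) * pathm Q X j L)"
      using morph_pathm[OF Xs Ys g, of j L] unfolding tj by simp
    also have "\<dots> = y0 * g (vt t) * pathm Q X j L" by (rule mult_assoc_dim[symmetric]) (simp_all add: tj)
    also have "\<dots> = 0\<^sub>m 1 (dimv X (vt j))" unfolding y0(2) by (simp add: tj)
    finally show ?thesis .
  qed
  have yA: "y * mapv Y (vt (j + 1)) = 0\<^sub>m 1 (dimv Y (vt (j + 1)))"
  proof -
    have "y * mapv Y (vt (j + 1)) = y0 * (pathm Q Y j L * mapv Y (vt (j + 1)))"
      unfolding y_def by (rule mult_assoc_dim) (simp_all add: tj)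
    also have "pathm Q Y j L * mapv Y (vt (j + 1)) = pathm Q Y (j + 1) (Suc L)"
      using pathm_Suc_right[OF Ys, of "j + 1" L] by simp
    also have "j + 1 = t + int (Suc L)" by (simp add: j_def)
    finally show ?thesis using max by (simp add: j_def algebra_simps)
  qed
  have cj: "cyc j"
  proof (rule ccontr)
    assume "\<not> cyc j"
    then have "rinv (mapv Y (vt (j + 1)))" using in_F_arrow_inv(1)[OF YF, of "j + 1"] by simp
    then have "y = 0\<^sub>m 1 (dimv Y (vt j))"
      by (rule rinv_cancel) (use yA in simp_all)
    with ynz show False ..
  qed
  \<comment> \<open>\<open>K\<close> is chosen so that \<open>j - K - 1\<close> is the nearest
    cyclic position below \<open>j\<close>. As \<open>st j - 1\<close> is cyclic, \<open>K\<close>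
    is at most \<open>j - st j\<close>, which makes \<open>Mt i j\<close> with
    \<open>i = j - K\<close> a module.\<close>
  define K where "K = (LEAST K. cyc (j - int K - 1))"
  have K0: "cyc (j - int (nat (j - st j)) - 1)" using cyc_step[OF cj] st_window(1)[of j] by simp
  have cK: "cyc (j - int K - 1)" unfolding K_def by (rule LeastI[where P = "\<lambda>K. cyc (j - int K - 1)", OF K0])
  have Kle: "K \<le> nat (j - st j)" unfolding K_def by (rule Least_le) (rule K0)
  have nc: "\<not> cyc s" if "j - int K \<le> s" "s < j" for s
  proof
    assume "cyc s"
    then have "cyc (j - int (nat (j - 1 - s)) - 1)" using that by simp
    then have "K \<le> nat (j - 1 - s)" unfolding K_def by (rule Least_le)
    with that show False by linarith
  qed
  define i where "i = j - int K"
  have ij: "i \<le> j" "st j \<le> i" "nat (j - i) = K" using Kle st_window(1)[of j] unfolding i_def by auto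
  have ijw: "j < i + int (mm Q)" using ij(2) st_gt[of j] by simp
  let ?Z = "Mt Q i j :: 'k rep"
  have Zs: "shaped ?Z" by (rule shaped_Mt[OF ij(1) ijw])
  have ZF: "in_F Q ?Z"
    using Mt_in_Xc_iff[OF ij(1,2)] cj cK in_Xc_in_F unfolding i_def by blast
  have vi [simp]: "vt (j - int K) = vt i" by (simp add: i_def)
  \<comment> \<open>The two sides play different roles: a left inverse on \<open>Y\<close> extends
    \<open>y\<close> to a functional \<open>z\<close> at \<open>i\<close>, and a right inverse on
    \<open>X\<close> lets \<open>z g = 0\<close> be deduced from \<open>y g = 0\<close>.\<close>
  have invY: "linv (pathm Q Y j K)" and invX: "rinv (pathm Q X j K)"
    using in_F_path_inv[OF YF, of j K] in_F_path_inv[OF XF, of j K] nc by blast+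
  obtain B where B: "B \<in> carrier_mat (dimv Y (vt j)) (dimv Y (vt i))" "B * pathm Q Y j K = 1\<^sub>m (dimv Y (vt j))"
    using invY unfolding linv_def by auto
  have [simp]: "dim_row B = dimv Y (vt j)" "dim_col B = dimv Y (vt i)" using B(1) by auto
  define z where "z = y * B"
  have z: "z \<in> carrier_mat 1 (dimv Y (vt i))" unfolding z_def by (rule carrier_matI) simp_all
  have [simp]: "dim_row z = 1" "dim_col z = dimv Y (vt i)" using z by auto
  have zp: "z * pathm Q Y j K = y"
  proof -
    have "z * pathm Q Y j K = y * (B * pathm Q Y j K)" unfolding z_def by (rule mult_assoc_dim) simp_all
    then show ?thesis unfolding B(2) by simp
  qed
  have "z * pathm Q Y (j + 1) (Suc (nat (j - i))) = z * pathm Q Y j K * mapv Y (vt (j + 1))"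
    unfolding ij(3) pathm_Suc_right[OF Ys] by (simp add: mult_assoc_dim)
  then have "z * pathm Q Y (j + 1) (Suc (nat (j - i))) = 0\<^sub>m 1 (dimv Y (vt (j + 1)))"
    unfolding zp yA .
  then have h: "morph Q (hom_to Y i j z) Y ?Z" by (rule morph_hom_to[OF ij(1) ijw Ys z])
  have zg: "z * g (vt i) = 0\<^sub>m 1 (dimv X (vt i))"
  proof (rule rinv_cancel)
    show "rinv (pathm Q X j K)" by (rule invX)
    have "z * g (vt i) * pathm Q X j K = z * (g (vt i) * pathm Q X j K)" by (rule mult_assoc_dim) simp_all
    also have "g (vt i) * pathm Q X j K = pathm Q Y j K * g (vt j)"
      using morph_pathm[OF Xs Ys g, of j K] by simp
    also have "z * (pathm Q Y j K * g (vt j)) = z * pathm Q Y j K * g (vt j)"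
      by (rule mult_assoc_dim[symmetric]) simp_all
    also have "\<dots> = 0\<^sub>m 1 (dimv X (vt j))" unfolding zp yg ..
    finally show "z * g (vt i) * pathm Q X j K = 0\<^sub>m 1 (dimv X (vt i)) * pathm Q X j K" by simp
  qed simp_all
  let ?o = "\<lambda>v. 0\<^sub>m (dimv ?Z v) (dimv Y v) :: 'k mat"
  have o: "morph Q ?o Y ?Z" unfolding morph_iff by (simp add: shaped_dim[OF Zs])
  have "eqon Q (comp (hom_to Y i j z) g) (comp ?o g)"
  proof (rule eqon_windowI[of i])
    fix s assume s: "i \<le> s" "s < i + int (mm Q)"
    show "comp (hom_to Y i j z) g (vt s) = comp ?o g (vt s)"
    proof (cases "s \<le> j")
      case True
      let ?b = "nat (s - i)"
      have b [simp]: "s - int ?b = i" using s by simp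
      have "hom_to Y i j z (vt s) * g (vt s) = z * pathm Q Y s ?b * g (vt s)"
        using hom_to_window[OF ij(1) ijw s, of Y z] True by simp
      also have "\<dots> = z * (pathm Q Y s ?b * g (vt s))" by (rule mult_assoc_dim) (simp_all add: s)
      also have "pathm Q Y s ?b * g (vt s) = g (vt i) * pathm Q X s ?b"
        using morph_pathm[OF Xs Ys g, of s ?b] unfolding b by simp
      also have "z * (g (vt i) * pathm Q X s ?b) = z * g (vt i) * pathm Q X s ?b"
        by (rule mult_assoc_dim[symmetric]) (simp_all add: s)
      also have "\<dots> = 0\<^sub>m 1 (dimv X (vt s))" unfolding zg by (simp add: s)
      finally show ?thesis using Mt_dim[OF ij(1) ijw s, where 'k='k] True by (simp add: comp_def)
    next
      case False
      then show ?thesis using Mt_dim[OF ij(1) ijw s, where 'k='k]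
        by (intro mat_eq_no_rows) (simp_all add: comp_def morph_dim[OF h])
    qed
  qed
  from cancel[OF ZF h o this] have "hom_to Y i j z (vt j) = 0\<^sub>m 1 (dimv Y (vt j))"
    unfolding eqon_iff using Mt_dim_top[OF ij(1) ijw, where 'k='k] by simp
  moreover have "hom_to Y i j z (vt j) = y"
    using hom_to_window[OF ij(1) ijw ij(1) ijw, of Y z] zp ij(3) by simp
  ultimately show False using ynz by simp
qed

text \<open>The cover is itself in \<open>F\<close>, because \<open>st j - 1\<close> is the
  successor of the cyclic vertex \<open>j\<close>.\<close>

lemma epi_F_quotient:
  assumes "st j \<le> i" "i \<le> j" "cyc j" "cyc (i - 1)"
  shows "epi_F Q (hom_from (Mt Q i j :: 'k rep) (st j) j (1\<^sub>m 1)) (PP j) (Mt Q i j)"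
proof -
  note q = quotient_hom[OF assms(1,2) st_window(2)]
  have F: "in_F Q (PP j)" "in_F Q (Mt Q i j :: 'k rep)"
    using Mt_in_Xc_iff[OF assms(2,1)] Mt_in_Xc_iff[OF st_window(1) order_refl] assms(3,4) cyc_step[OF assms(3)]
      in_Xc_in_F by blast+
  have "eqon Q h1 h2" if h: "morph Q h1 (Mt Q i j) Z" "morph Q h2 (Mt Q i j) Z"
    "eqon Q (comp h1 (hom_from (Mt Q i j) (st j) j (1\<^sub>m 1))) (comp h2 (hom_from (Mt Q i j) (st j) j (1\<^sub>m 1)))"
    for Z :: "'k rep" and h1 h2
    unfolding eqon_iff
  proof
    fix t
    have "rinv (hom_from (Mt Q i j :: 'k rep) (st j) j (1\<^sub>m 1) (vt t))" using q(2) surj_m_iff[OF q(1)] by blast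
    then show "h1 (vt t) = h2 (vt t)"
      by (rule rinv_cancel) (use h(3) in \<open>simp_all add: eqon_iff comp_def morph_dim[OF q(1)] morph_dim[OF h(1)] morph_dim[OF h(2)] del: One_nat_def\<close>)
  qed
  then show ?thesis unfolding epi_F_def using F q(1) by blast
qed

lemma proj_in_F_PP:
  assumes "in_F Q (M :: 'k rep)" "iso Q M (PP j)" shows "proj_in_F Q M"
  unfolding proj_in_F_def
proof (intro conjI allI impI assms(1))
  fix X Y :: "'k rep" and g f assume a: "epi_F Q g X Y \<and> morph Q f M Y"
  then have X: "is_mod Q X" and Y: "is_mod Q Y" and g: "morph Q g X Y" and f: "morph Q f M Y"
    unfolding epi_F_def in_F_def by auto
  note s = is_mod_shaped[OF X] is_mod_shaped[OF Y] iso_shaped[OF assms(2)]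
  from assms(2) obtain a b where ab: "morph Q a M (PP j)" "morph Q b (PP j) M" "eqon Q (comp b a) (idm M)"
    unfolding iso_def by blast
  have "rinv (g (vt j))" using a epi_F_surj by blast
  from proj_lift[OF X s(2) g morph_comp[OF s(4,3,2) ab(2) f] this]
  obtain h where h: "morph Q h (PP j) X" "eqon Q (comp g h) (comp f b)" by blast
  note [simp] = g[THEN morph_dim(1)] g[THEN morph_dim(2)] f[THEN morph_dim(1)] f[THEN morph_dim(2)]
    ab(1,2)[THEN morph_dim(1)] ab(1,2)[THEN morph_dim(2)] h(1)[THEN morph_dim(1)] h(1)[THEN morph_dim(2)]
  have "eqon Q (comp g (comp h a)) f"
    unfolding eqon_iff
  proof
    fix t
    have "comp g (comp h a) (vt t) = g (vt t) * h (vt t) * a (vt t)"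
      unfolding comp_def by (rule mult_assoc_dim[symmetric]) simp_all
    also have "\<dots> = f (vt t) * b (vt t) * a (vt t)" using h(2) unfolding eqon_iff comp_def by simp
    also have "\<dots> = f (vt t) * (b (vt t) * a (vt t))" by (rule mult_assoc_dim) simp_all
    also have "\<dots> = f (vt t)" using ab(3) unfolding eqon_comp_idm by simp
    finally show "comp g (comp h a) (vt t) = f (vt t)" .
  qed
  then show "\<exists>h. morph Q h M X \<and> eqon Q (comp g h) f"
    using morph_comp[OF s(3,4,1) ab(1) h(1)] by blast
qed

text \<open>Projectivity would split the cover by \<open>PP j\<close>. If \<open>i\<close> differs
  from \<open>st j\<close>, the path of length \<open>j - i + 1\<close> kills the top of
  \<open>Mt i j\<close> but acts as the identity on that of \<open>PP j\<close>, so a section would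
  be zero at the top.\<close>

lemma proj_in_F_Mt:
  assumes "proj_in_F Q (M :: 'k rep)" "iso Q M (Mt Q i j)" "st j \<le> i" "i \<le> j" "cyc j" "cyc (i - 1)"
  shows "i = st j"
proof (rule ccontr)
  assume "i \<noteq> st j"
  then have lt: "st j \<le> i - 1" using assms(3) by simp
  let ?g = "hom_from (Mt Q i j :: 'k rep) (st j) j (1\<^sub>m 1)"
  have ij: "i \<le> j" "j < i + int (mm Q)" using assms(3,4) st_gt[of j] by auto
  note q = quotient_hom[OF assms(3,4) st_window(2)]
  note s = iso_shaped[OF assms(2)] shaped_Mt[OF st_window, of j, where 'k='k]
  from assms(2) obtain a b where ab: "morph Q a M (Mt Q i j)" "morph Q b (Mt Q i j) M" "eqon Q (comp a b) (idm (Mt Q i j))"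
    unfolding iso_def by blast
  from assms(1) epi_F_quotient[OF assms(3-6)] ab(1)
  obtain h where h: "morph Q h M (PP j)" "eqon Q (comp ?g h) a" unfolding proj_in_F_def by blast
  have hb: "morph Q (comp h b) (Mt Q i j) (PP j)" by (rule morph_comp[OF s(2,1,3) ab(2) h(1)])
  note [simp] = ab(1,2)[THEN morph_dim(1)] ab(1,2)[THEN morph_dim(2)] h(1)[THEN morph_dim(1)] h(1)[THEN morph_dim(2)]
    morph_dim[OF q(1)] morph_dim[OF hb]
  note d = Mt_dim_top[OF ij, where 'k='k] Mt_dim_top[OF st_window, of j, where 'k='k]
  let ?L = "Suc (nat (j - i))"
  have "comp h b (vt (j - int ?L)) * pathm Q (Mt Q i j) j ?L = pathm Q (PP j) j ?L * comp h b (vt j)"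
    by (rule morph_pathm[OF s(2,3) hb])
  moreover have "kills Q (Mt Q i j :: 'k rep) j ?L" by (rule kills_Mt[OF ij ij(1) ij(2)]) (use ij in simp)
  moreover have "pathm Q (PP j) j ?L = 1\<^sub>m 1"
    by (rule pathm_Mt_id[OF st_window order_refl]) (use ij lt in simp)
  ultimately have z: "1\<^sub>m 1 * comp h b (vt j) = 0\<^sub>m (dimv (PP j) (vt (j - int ?L))) (dimv (Mt Q i j :: 'k rep) (vt j))"
    unfolding kills_def by (simp del: One_nat_def)
  have "1\<^sub>m 1 * comp h b (vt j) = comp h b (vt j)" using d by simp
  moreover have "?g (vt j) * comp h b (vt j) = 1\<^sub>m 1"
  proof -
    have "?g (vt j) * (h (vt j) * b (vt j)) = (?g (vt j) * h (vt j)) * b (vt j)"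
      by (rule mult_assoc_dim[symmetric]) (simp_all del: One_nat_def)
    also have "\<dots> = a (vt j) * b (vt j)" using h(2) unfolding eqon_iff comp_def by simp
    also have "\<dots> = 1\<^sub>m 1" using ab(3) d unfolding eqon_comp_idm by simp
    finally show ?thesis by (simp add: comp_def)
  qed
  ultimately have "comp h b (vt j) = 1\<^sub>m 1" unfolding q(3) by metis
  moreover have "dimv (PP j) (vt (j - int ?L)) = 1"
    using arg_cong[OF z, of dim_row] by simp
  ultimately show False using z d one_mat_neq_zero[of 1, where 'a='k] by simp
qed

lemma proj_in_F_iff:
  assumes "in_Xc Q (M :: 'k rep)"
  shows "proj_in_F Q M \<longleftrightarrow> (\<exists>j. 1 \<le> j \<and> j \<le> int (mm Q) \<and> cyc j \<and> iso Q M (PP j))"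
proof
  assume p: "proj_in_F Q M"
  from in_Xc_uniserial[OF assms] obtain i j where "1 \<le> j" "j \<le> int (mm Q)" "i \<le> j" "st j \<le> i" "cyc j" "cyc (i - 1)"
    "iso Q M (Mt Q i j)" by blast
  then show "\<exists>j. 1 \<le> j \<and> j \<le> int (mm Q) \<and> cyc j \<and> iso Q M (PP j)" using proj_in_F_Mt[OF p] by blast
next
  assume "\<exists>j. 1 \<le> j \<and> j \<le> int (mm Q) \<and> cyc j \<and> iso Q M (PP j)"
  then show "proj_in_F Q M" using proj_in_F_PP in_Xc_in_F[OF assms] by blast
qed

end

section \<open>The cyclic vertices\<close>

text \<open>By counting, \<open>f\<close> permutes the finite set \<open>S\<close>, so every point
  of \<open>S\<close> is periodic.\<close>

lemma finite_surj_trancl: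
  assumes fin: "finite S" and surj: "S \<subseteq> f ` S" and x: "x \<in> S"
    and R: "\<And>a. a \<in> S \<Longrightarrow> (a, f a) \<in> R"
  shows "(x, x) \<in> R\<^sup>+"
proof -
  have card: "card (f ` S) \<le> card S" by (rule card_image_le[OF fin])
  then have eq: "f ` S = S" using card_subset_eq[of "f ` S" S] surj fin card_mono[of "f ` S" S] by simp
  then have inj: "inj_on f S" using eq_card_imp_inj_on[OF fin, of f] by simp
  have mem: "(f ^^ n) x \<in> S" for n by (induction n) (use x eq in auto)
  have "\<not> inj (\<lambda>n. (f ^^ n) x)"
  proof
    assume "inj (\<lambda>n. (f ^^ n) x)"
    moreover have "finite (range (\<lambda>n. (f ^^ n) x))" by (rule finite_subset[OF _ fin]) (use mem in blast)
    ultimately show False using finite_imageD infinite_UNIV_nat by blast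
  qed
  then obtain a b where ab: "a < b" "(f ^^ a) x = (f ^^ b) x"
    unfolding inj_def by (metis linorder_less_linear)
  have "(f ^^ a) x = (f ^^ (a + d)) x \<Longrightarrow> x = (f ^^ d) x" for a d
  proof (induction a)
    case (Suc a)
    then have "f ((f ^^ a) x) = f ((f ^^ (a + d)) x)" by simp
    then show ?case using Suc.IH inj_onD[OF inj] mem by blast
  qed simp
  from this[of a "b - a"] ab have d: "x = (f ^^ (b - a)) x" by simp
  have "0 < n \<Longrightarrow> (x, (f ^^ n) x) \<in> R\<^sup>+" for n
  proof (induction n)
    case (Suc n)
    have "((f ^^ n) x, (f ^^ Suc n) x) \<in> R" using R[OF mem] by simp
    then show ?case using Suc by (cases n) (auto intro: trancl_into_trancl)
  qed simp
  from this[of "b - a"] ab(1) d show ?thesis by simp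
qed

section \<open>The self-gluing as a Nakayama algebra\<close>

locale pieces =
  fixes Q :: params and ty :: "'k::field itself"
  assumes r_pos: "1 \<le> rr Q" and m_first: "ms Q 1 = 0"
    and m_less: "\<And>k. 1 \<le> k \<Longrightarrow> k \<le> rr Q \<Longrightarrow> ms Q k < ms Q (Suc k)"
    and l_ge2: "\<And>k. 1 \<le> k \<Longrightarrow> k \<le> rr Q \<Longrightarrow> 2 \<le> ls Q k"
    and l_dvd: "\<And>k. 1 \<le> k \<Longrightarrow> k \<le> rr Q \<Longrightarrow> ls Q k dvd ms Q (Suc k) - ms Q k"
begin

lemma m_mono: "1 \<le> k \<Longrightarrow> k \<le> k' \<Longrightarrow> k' \<le> Suc (rr Q) \<Longrightarrow> ms Q k \<le> ms Q k'"
proof (induction k')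
  case (Suc k')
  then show ?case using m_less[of k'] by (cases "k = Suc k'") auto
qed simp

lemma l_le: "1 \<le> k \<Longrightarrow> k \<le> rr Q \<Longrightarrow> ls Q k \<le> ms Q (Suc k) - ms Q k"
  using l_dvd m_less by (simp add: dvd_imp_le)

text \<open>Half-open at the bottom: a junction belongs to the piece containing its outgoing
  arrow.\<close>

definition in_piece :: "nat \<Rightarrow> nat \<Rightarrow> bool" where
  "in_piece k v \<longleftrightarrow> 1 \<le> k \<and> k \<le> rr Q \<and> ms Q k < v \<and> v \<le> ms Q (Suc k)"

lemma in_piece_unique: "in_piece k v \<Longrightarrow> in_piece k' v \<Longrightarrow> k = k'"
proof (induction k k' rule: linorder_wlog)
  case (le a b)
  show ?case
  proof (rule ccontr)
    assume "a \<noteq> b"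
    then have "ms Q (Suc a) \<le> ms Q b" using le by (intro m_mono) (auto simp: in_piece_def)
    then show False using le unfolding in_piece_def by simp
  qed
qed auto

lemma in_piece_exists:
  assumes "1 \<le> v" "v \<le> mm Q" shows "\<exists>k. in_piece k v"
proof -
  let ?P = "\<lambda>k. 1 \<le> k \<and> v \<le> ms Q (Suc k)"
  define k where "k = (LEAST k. ?P k)"
  have r: "?P (rr Q)" using r_pos assms by (simp add: mm_def)
  have k: "?P k" unfolding k_def by (rule LeastI[where P = ?P, OF r])
  have kr: "k \<le> rr Q" unfolding k_def by (rule Least_le) (rule r)
  have "ms Q k < v"
  proof (cases "k = 1")
    case True then show ?thesis using m_first assms by simp
  next
    case False
    have "\<not> ?P (k - 1)"
    proof
      assume "?P (k - 1)"
      then have "k \<le> k - 1" unfolding k_def by (rule Least_le)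
      with k show False by linarith
    qed
    then show ?thesis using k False by auto
  qed
  then show ?thesis using k kr unfolding in_piece_def by blast
qed

lemma in_piece_le: "in_piece k v \<Longrightarrow> 1 \<le> v \<and> v \<le> mm Q"
  using m_mono[of "Suc k" "Suc (rr Q)"] unfolding in_piece_def mm_def by auto

text \<open>The shortest vanishing path from \<open>v\<close> is either a relation of length
  \<open>l_k\<close> or the path that goes one arrow beyond \<open>m_k\<close>, which takes
  \<open>v - m_k + 1\<close> arrows.\<close>

definition piece_len :: "nat \<Rightarrow> nat" where
  "piece_len v = (let k = (THE k. in_piece k v) in min (ls Q k) (v - ms Q k + 1))"

lemma piece_len_eq: "in_piece k v \<Longrightarrow> piece_len v = min (ls Q k) (v - ms Q k + 1)"
  unfolding piece_len_def using in_piece_unique by (simp add: the_equality)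

lemma cyclic_quiver: "cyclic_quiver Q"
  by unfold_locales (use in_piece_le m_less[of 1] m_mono[of 2 "Suc (rr Q)"] r_pos in \<open>auto simp: mm_def numeral_2_eq_2\<close>)

sublocale cyclic_quiver Q by (rule cyclic_quiver)

lemma vt_nat: "1 \<le> t \<Longrightarrow> t \<le> int (mm Q) \<Longrightarrow> vt t = nat t"
  using vt_of_V[of "nat t"] unfolding V_def by (auto simp: Suc_le_eq)

lemma vt_in_piece: "\<exists>k. in_piece k (vt t)"
  using in_piece_exists vt_in_V[of t] unfolding V_def by simp

lemma is_mod_piece_len:
  "is_mod Q (M :: 'k rep) \<longleftrightarrow>
      (\<forall>t. mapv M (vt t) \<in> carrier_mat (dimv M (vt (t - 1))) (dimv M (vt t))) \<and>
      (\<forall>t. kills Q M t (piece_len (vt t)))"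
proof
  assume M: "is_mod Q M"
  note Ms = is_mod_shaped[OF M]
  have "kills Q M t (piece_len (vt t))" for t
  proof -
    obtain k where k: "in_piece k (vt t)" using vt_in_piece by blast
    then have kr: "k \<in> {1..rr Q}" unfolding in_piece_def by simp
    define v where "v = vt t"
    have rel: "\<And>t. int (ms Q k + ls Q k) \<le> t \<Longrightarrow> t \<le> int (ms Q (Suc k)) \<Longrightarrow> kills Q M t (ls Q k)"
      "kills Q M (int (ms Q k) + 1) 2" using M kr unfolding is_mod_def by blast+
    have "kills Q M (int v) (piece_len v)"
    proof (cases "ms Q k + ls Q k \<le> v")
      case True
      then have "piece_len v = ls Q k" using piece_len_eq[OF k] by (simp add: v_def)
      then show ?thesis using rel(1)[of "int v"] True k unfolding in_piece_def v_def by simp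
    next
      case False
      then have "v - ms Q k + 1 \<le> ls Q k" using k unfolding in_piece_def v_def[symmetric] by arith
      then have "piece_len v = v - ms Q k + 1" using piece_len_eq[OF k] by (simp add: v_def)
      moreover have "ms Q k < v" using k unfolding in_piece_def v_def by blast
      \<comment> \<open>The path first reaches \<open>m_k + 1\<close> and then ends with the two
        arrows of the junction relation.\<close>
      ultimately have "piece_len v = (v - ms Q k - 1) + 2" by arith
      moreover have "int v - int (v - ms Q k - 1) = int (ms Q k) + 1" using k by (simp add: v_def in_piece_def)
      ultimately show ?thesis using pathm_zero_mono_end[OF Ms, of "int v" "v - ms Q k - 1" 2] rel(2) by (simp add: ac_simps)
    qed
    then show ?thesis unfolding v_def using kills_cong[OF int_vt, of M t] by simp
  qed
  then show "(\<forall>t. mapv M (vt t) \<in> carrier_mat (dimv M (vt (t - 1))) (dimv M (vt t))) \<and>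
      (\<forall>t. kills Q M t (piece_len (vt t)))" using Ms unfolding shaped_def by blast
next
  assume a: "(\<forall>t. mapv M (vt t) \<in> carrier_mat (dimv M (vt (t - 1))) (dimv M (vt t))) \<and>
      (\<forall>t. kills Q M t (piece_len (vt t)))"
  have len: "kills Q M t L" if "in_piece k (nat t)" "L = min (ls Q k) (nat t - ms Q k + 1)" for t k L
  proof -
    have "vt t = nat t" using in_piece_le[OF that(1)] by (intro vt_nat) auto
    moreover have "kills Q M t (piece_len (vt t))" using a by blast
    ultimately show ?thesis using piece_len_eq[OF that(1)] that(2) by simp
  qed
  have "kills Q M t (ls Q k)" if "1 \<le> k" "k \<le> rr Q" "int (ms Q k + ls Q k) \<le> t" "t \<le> int (ms Q (Suc k))" for k t
    by (rule len[of k]) (use that l_ge2[of k] in \<open>auto simp: in_piece_def\<close>)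
  moreover have "kills Q M (int (ms Q k) + 1) 2" if "1 \<le> k" "k \<le> rr Q" for k
  proof -
    \<comment> \<open>At \<open>m_k + 1\<close> the minimum defining \<open>piece_len\<close> is 2,
      because \<open>l_k\<close> is at least 2.\<close>
    have "nat (int (ms Q k) + 1) = Suc (ms Q k)" by simp
    then show ?thesis using len[of k "int (ms Q k) + 1" 2] that l_ge2[of k] m_less[of k]
      by (simp add: in_piece_def numeral_2_eq_2)
  qed
  ultimately show "is_mod Q M" unfolding is_mod_def ball_V using a by simp
qed

sublocale nakayama Q piece_len ty
proof unfold_locales
  fix t
  obtain k where k: "in_piece k (vt t)" using vt_in_piece by blast
  then have k': "1 \<le> k" "k \<le> rr Q" "ms Q k < vt t" "vt t \<le> ms Q (Suc k)" unfolding in_piece_def by auto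
  show "2 \<le> piece_len (vt t)" using piece_len_eq[OF k] l_ge2[OF k'(1,2)] k'(3) by simp
  show "piece_len (vt t) \<le> mm Q"
    using piece_len_eq[OF k] l_le[OF k'(1,2)] m_mono[of "Suc k" "Suc (rr Q)"] k' unfolding mm_def by simp
  obtain k1 where k1: "in_piece k1 (vt (t - 1))" using vt_in_piece by blast
  have two: "1 \<le> piece_len (vt (t - 1))"
    using piece_len_eq[OF k1] l_ge2[of k1] k1 unfolding in_piece_def by simp
  show "piece_len (vt t) \<le> piece_len (vt (t - 1)) + 1"
  proof (cases "ms Q k < vt t - 1")
    case True
    have "vt (t - 1) = vt (int (vt t) - 1)" by (rule vt_shift_minus) (simp add: int_vt)
    also have "\<dots> = vt t - 1" using True in_piece_le[OF k] by (subst vt_nat) auto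
    finally have e: "vt (t - 1) = vt t - 1" .
    then have "in_piece k (vt (t - 1))" using k True unfolding in_piece_def by auto
    from piece_len_eq[OF this] piece_len_eq[OF k] True e show ?thesis by (simp add: min_def) arith
  next
    \<comment> \<open>The vertex below may belong to another piece with an unrelated length, but at
      the lowest vertex of a piece the length is at most 2.\<close>
    case False
    then have "vt t = ms Q k + 1" using k'(3) by simp
    then have "piece_len (vt t) \<le> 2" using piece_len_eq[OF k] by simp
    then show ?thesis using two by simp
  qed
  fix M :: "'k rep"
  show "is_mod Q M \<longleftrightarrow>
      (\<forall>t. mapv M (vt t) \<in> carrier_mat (dimv M (vt (t - 1))) (dimv M (vt t))) \<and>
      (\<forall>t. kills Q M t (piece_len (vt t)))" by (rule is_mod_piece_len)
qed

section \<open>Blocks of length \<open>l_k\<close> and the vertices on cycles\<close>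

abbreviation len :: "nat \<Rightarrow> int" where "len k \<equiv> int (ls Q k)"

text \<open>A listed \<open>i\<close> starts the block of positions above \<open>i\<close> up to
  \<open>i + l_k\<close>. Divisibility makes the last block of a piece fit, so that
  \<open>i + l_k\<close> does not exceed \<open>m_(k+1)\<close>.\<close>

lemma listed_bounds:
  assumes "listed Q k i"
  shows "1 \<le> k" "k \<le> rr Q" "2 \<le> len k" "int (ms Q k) \<le> i" "i + len k \<le> int (ms Q (Suc k))" "0 \<le> i"
    "i + len k \<le> int (mm Q)" "len k dvd i - int (ms Q k)"
proof -
  from assms have k: "1 \<le> k" "k \<le> rr Q" "int (ms Q k) \<le> i" "i < int (ms Q (Suc k))"
    and md: "i mod len k = int (ms Q k) mod len k" unfolding listed_def by auto
  show "1 \<le> k" "k \<le> rr Q" "2 \<le> len k" "int (ms Q k) \<le> i" "0 \<le> i" using k l_ge2[OF k(1,2)] by auto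
  show dv: "len k dvd i - int (ms Q k)" using md by (simp add: mod_eq_dvd_iff)
  have "int (ls Q k) dvd int (ms Q (Suc k) - ms Q k)" using l_dvd[OF k(1,2)] by simp
  then have "len k dvd int (ms Q (Suc k)) - int (ms Q k)" using m_less[OF k(1,2)] by simp
  then have "len k dvd (int (ms Q (Suc k)) - int (ms Q k)) - (i - int (ms Q k))" using dv by (rule dvd_diff)
  then have "len k dvd int (ms Q (Suc k)) - i" by simp
  then have "len k \<le> int (ms Q (Suc k)) - i" using k by (intro zdvd_imp_le) auto
  then show 1: "i + len k \<le> int (ms Q (Suc k))" by simp
  have "ms Q (Suc k) \<le> mm Q" using m_mono[of "Suc k" "Suc (rr Q)"] k unfolding mm_def by simp
  with 1 show "i + len k \<le> int (mm Q)" by simp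
qed

lemma listed_piece:
  assumes "listed Q k i" "i < j" "j \<le> i + len k"
  shows "vt j = nat j" "in_piece k (vt j)" "1 \<le> j" "j \<le> int (mm Q)"
proof -
  note b = listed_bounds[OF assms(1)]
  show j: "1 \<le> j" "j \<le> int (mm Q)" using b assms by auto
  show v: "vt j = nat j" by (rule vt_nat[OF j])
  show "in_piece k (vt j)" unfolding v in_piece_def using b assms by auto
qed

lemma listed_st:
  assumes "listed Q k i" "i < j" "j \<le> i + len k"
  shows "st j = max (int (ms Q k)) (j - len k + 1)"
proof -
  note b = listed_bounds[OF assms(1)] and v = listed_piece(1)[OF assms]
  have "int (nat j - ms Q k + 1) = j - int (ms Q k) + 1" using b(4) assms(2) by (simp add: of_nat_diff)
  then have "int (piece_len (vt j)) = min (len k) (j - int (ms Q k) + 1)"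
    using piece_len_eq[OF listed_piece(2)[OF assms]] unfolding v by (simp only: of_nat_min)
  then show ?thesis unfolding st_def by (simp add: min_def max_def)
qed

text \<open>Hence \<open>PP (i + len k)\<close> is the module of type (4); the next lemma does the
  same for \<open>PP (i + len k - 1)\<close> and type (3).\<close>

lemma listed_st_top: "listed Q k i \<Longrightarrow> st (i + len k) = i + 1"
  using listed_st[of k i "i + len k"] listed_bounds[of k i] by simp

lemma listed_st_below_top: "listed Q k i \<Longrightarrow> st (i + len k - 1) = i"
  using listed_st[of k i "i + len k - 1"] listed_bounds[of k i] by simp

text \<open>The end of a block starts another one: in the same piece, in the next piece, or, after
  the last piece, at 0, which is the vertex \<open>m\<close>.\<close>

lemma listed_next:
  assumes "listed Q k i" shows "\<exists>k' i'. listed Q k' i' \<and> vt i' = vt (i + len k)"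
proof -
  note b = listed_bounds[OF assms]
  consider "i + len k < int (ms Q (Suc k))" | "i + len k = int (ms Q (Suc k))" "k < rr Q" |
    "i + len k = int (ms Q (Suc k))" "k = rr Q" using b by linarith
  then show ?thesis
  proof cases
    case 1
    then have "listed Q k (i + len k)" using assms b(3) unfolding listed_def by auto
    then show ?thesis by blast
  next
    case 2
    then have "listed Q (Suc k) (i + len k)" using m_less[of "Suc k"] unfolding listed_def by auto
    then show ?thesis by blast
  next
    case 3
    have "listed Q 1 0" using r_pos m_first m_less[of 1] unfolding listed_def by auto
    moreover have "vt 0 = vt (i + len k)" using 3 by (simp add: vt_eq_iff mm_def)
    ultimately show ?thesis by blast
  qed
qed

lemma listed_cover:
  assumes "1 \<le> j" "j \<le> int (mm Q)"
  shows "\<exists>k i. listed Q k i \<and> i < j \<and> j \<le> i + len k"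
proof -
  have v: "vt j = nat j" by (rule vt_nat[OF assms])
  obtain k where "in_piece k (vt j)" using vt_in_piece by blast
  then have k: "1 \<le> k" "k \<le> rr Q" "int (ms Q k) < j" "j \<le> int (ms Q (Suc k))" unfolding v in_piece_def by auto
  \<comment> \<open>The offset counts from \<open>j - 1\<close>, because a block contains its end
    but not its start.\<close>
  define a where "a = j - 1 - int (ms Q k)"
  define i where "i = j - 1 - a mod len k"
  have l: "2 \<le> len k" using l_ge2[OF k(1,2)] by simp
  have a: "0 \<le> a" using k by (simp add: a_def)
  have md: "0 \<le> a mod len k" "a mod len k < len k" "a mod len k \<le> a" using l a by (auto simp: zmod_le_nonneg_dividend)
  have "i - int (ms Q k) = a - a mod len k" by (simp add: i_def a_def)
  then have "len k dvd i - int (ms Q k)" by (simp add: dvd_minus_mod)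
  then have "listed Q k i" unfolding listed_def using k md by (auto simp: i_def a_def mod_eq_dvd_iff)
  then show ?thesis using md by (intro exI[of _ k] exI[of _ i]) (auto simp: i_def)
qed

lemma listed_separated:
  assumes "listed Q k i" "i < j" "j < i + len k" "listed Q k' i'" shows "vt j \<noteq> vt i'"
proof
  assume "vt j = vt i'"
  then have "int (mm Q) dvd j - i'" by (simp add: vt_eq_iff)
  moreover note b = listed_bounds[OF assms(1)] and b' = listed_bounds[OF assms(4)]
  have "\<bar>j - i'\<bar> < int (mm Q)" using b b' assms by auto
  ultimately have ji: "j = i'" by (metis dvd_imp_le_int abs_of_nat eq_iff_diff_eq_0 linorder_not_less)
  \<comment> \<open>The pieces are compared at \<open>j + 1\<close>: the start \<open>i'\<close> of
    a block may be a junction, which itself belongs to the piece below.\<close>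
  have "in_piece k (nat (j + 1))" "in_piece k' (nat (j + 1))"
    using b b' assms ji unfolding in_piece_def by auto
  then have "k = k'" by (rule in_piece_unique)
  then have "len k dvd (i' - int (ms Q k)) - (i - int (ms Q k))" using b(8) b'(8) by (simp only: dvd_diff)
  then have "len k dvd j - i" using ji by simp
  then have "len k \<le> j - i" using assms(2) by (intro zdvd_imp_le) auto
  then show False using assms(3) by simp
qed

definition cyc_set :: "nat set" where
  "cyc_set = {vt i | k i. listed Q k i} \<union> {vt (i - 1) | k i. listed Q k i}"

lemma cyc_set_I: "listed Q k i \<Longrightarrow> vt i \<in> cyc_set" "listed Q k i \<Longrightarrow> vt (i - 1) \<in> cyc_set"
  unfolding cyc_set_def by blast+

lemma cyc_set_top: "listed Q k i \<Longrightarrow> vt (i + len k) \<in> cyc_set" "listed Q k i \<Longrightarrow> vt (i + len k - 1) \<in> cyc_set"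
  using listed_next[of k i] cyc_set_I vt_shift_minus by metis+

text \<open>The arrows map \<open>i + l_k\<close> to \<open>i\<close> and \<open>i + l_k - 1\<close>
  to \<open>i - 1\<close>. Since a block end starts the next block, both sources lie in the set, so
  the map is onto it.\<close>

lemma cyc_set_cyclic: "v \<in> cyc_set \<Longrightarrow> cyclic_simple TYPE('k) Q v"
  unfolding cyclic_simple_def
proof (rule finite_surj_trancl[where f = "\<lambda>v. vt (st (int v) - 1)"])
  let ?f = "\<lambda>v. vt (st (int v) - 1)"
  have f: "?f (vt t) = vt (st t - 1)" for t
  proof -
    have "st (int (vt t)) - 1 - (st t - 1) = int (vt t) - t" using st_shift[OF int_vt, of t] by simp
    then show ?thesis using int_vt[of t] unfolding vt_eq_iff by simp
  qed
  have "cyc_set \<subseteq> V Q" unfolding cyc_set_def by auto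
  then show "finite cyc_set" unfolding V_def by (rule finite_subset) simp
  show "cyc_set \<subseteq> ?f ` cyc_set"
  proof
    fix v assume "v \<in> cyc_set"
    then obtain k i where ki: "listed Q k i" "v = vt i \<or> v = vt (i - 1)" unfolding cyc_set_def by blast
    have "vt i = ?f (vt (i + len k))" "vt (i - 1) = ?f (vt (i + len k - 1))"
      unfolding f using ki(1) by (simp_all add: listed_st_top listed_st_below_top)
    then show "v \<in> ?f ` cyc_set" using cyc_set_top[OF ki(1)] ki(2) by blast
  qed
  fix a assume "a \<in> cyc_set"
  then obtain t where "a = vt t" unfolding cyc_set_def by blast
  then show "(a, ?f a) \<in> {(a, b). res_arrow TYPE('k) Q a b}" unfolding f by (simp add: res_arrow_iff f)
qed

text \<open>The two highest vertices of a block and all vertices of the lowest block of a piece have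
  their image in \<open>cyc_set\<close>. In the remaining cases the map subtracts
  \<open>l_k\<close>, without wrapping around.\<close>

lemma res_arrow_decreases:
  assumes "res_arrow TYPE('k) Q a b" "b \<notin> cyc_set" shows "a \<notin> cyc_set \<and> b < a"
proof -
  have "a \<in> V Q" using assms(1) unfolding res_arrow_def by simp
  then have a: "a = vt (int a)" "1 \<le> int a" "int a \<le> int (mm Q)" using vt_of_V unfolding V_def by auto
  obtain k i where ki: "listed Q k i" "i < int a" "int a \<le> i + len k" using listed_cover[OF a(2,3)] by blast
  note b = listed_bounds[OF ki(1)]
  have bb: "b = vt (st (int a) - 1)" using assms(1) a(1) res_arrow_iff by metis
  have "int a \<noteq> i + len k"
  proof
    assume "int a = i + len k"
    then have "b = vt i" unfolding bb using listed_st_top[OF ki(1)] by simp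
    then show False using assms(2) cyc_set_I(1)[OF ki(1)] by simp
  qed
  moreover have ne: "int a \<noteq> i + len k - 1"
  proof
    assume "int a = i + len k - 1"
    then have "b = vt (i - 1)" unfolding bb using listed_st_below_top[OF ki(1)] by simp
    then show False using assms(2) cyc_set_I(2)[OF ki(1)] by simp
  qed
  ultimately have lt: "int a < i + len k - 1" using ki(3) by simp
  have "a \<notin> cyc_set"
  proof
    assume "a \<in> cyc_set"
    then obtain k' i' where "listed Q k' i'" "vt (int a) = vt i' \<or> vt (int a) = vt (i' - 1)"
      unfolding cyc_set_def using a(1) by force
    then show False
      using listed_separated[OF ki(1,2)] listed_separated[OF ki(1), of "int a + 1"] ki(2) lt vt_shift[of "int a" "i' - 1" 1] by auto
  qed
  moreover have "b < a"
  proof (cases "int (ms Q k) \<le> int a - len k + 1")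
    \<comment> \<open>The projective is cut off at the junction, so \<open>a\<close> lies in the
      lowest block and its image is \<open>m_k - 1\<close>.\<close>
    case False
    then have s: "st (int a) = int (ms Q k)" using listed_st[OF ki] by simp
    have "i = int (ms Q k)"
    proof (rule ccontr)
      assume "i \<noteq> int (ms Q k)"
      then have "len k \<le> i - int (ms Q k)" using b(4,8) by (intro zdvd_imp_le) auto
      then show False using False ki(2) by simp
    qed
    then have "b \<in> cyc_set" unfolding bb s using cyc_set_I(2)[OF ki(1)] by simp
    then show ?thesis using assms(2) by simp
  next
    case True
    then have s: "st (int a) = int a - len k + 1" using listed_st[OF ki] by simp
    \<comment> \<open>There is a block below the one of \<open>a\<close> in the same piece, hence
      \<open>a - l_k\<close> is still at least 1.\<close>
    have "len k \<le> i - int (ms Q k)" using lt True b(8) by (intro zdvd_imp_le) auto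
    then have 1: "1 \<le> int a - len k" using ki(2) by simp
    then have "b = nat (int a - len k)" unfolding bb s using a(3) b(3) by (subst vt_nat) auto
    then show ?thesis using 1 b(3) by simp
  qed
  ultimately show ?thesis by blast
qed

text \<open>Lying outside \<open>cyc_set\<close> propagates backwards along arrows, so the vertex
  number strictly drops along any path ending there, and such a path cannot close.\<close>

lemma cyclic_simple_iff: "cyclic_simple TYPE('k) Q v \<longleftrightarrow> v \<in> cyc_set"
proof
  let ?R = "{(a, b). res_arrow TYPE('k) Q a b}"
  have "(a, b) \<in> ?R\<^sup>+ \<Longrightarrow> b \<notin> cyc_set \<Longrightarrow> b < a" for a b
  proof (induction rule: trancl_induct)
    case (base b)
    then show ?case using res_arrow_decreases by blast
  next
    case (step b c)
    then show ?case using res_arrow_decreases[of b c] by fastforce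
  qed
  then show "cyclic_simple TYPE('k) Q v \<Longrightarrow> v \<in> cyc_set" unfolding cyclic_simple_def by blast
qed (rule cyc_set_cyclic)

section \<open>The four types of modules and the projective ones\<close>

lemma cyc_listed:
  assumes "listed Q k i"
  shows "cyc i" "cyc (i - 1)" "cyc (i + len k)" "cyc (i + len k - 1)"
  unfolding cyc_def cyclic_simple_iff using cyc_set_I[OF assms] cyc_set_top[OF assms] by auto

lemma not_cyc_between:
  assumes "listed Q k i" "i < j" "j < i + len k - 1" shows "\<not> cyc j"
proof
  assume "cyc j"
  then obtain k' i' where "listed Q k' i'" "vt j = vt i' \<or> vt j = vt (i' - 1)"
    unfolding cyc_def cyclic_simple_iff cyc_set_def by blast
  then show False
    using listed_separated[OF assms(1,2)] listed_separated[OF assms(1), of "j + 1"] assms(2,3) vt_shift[of j "i' - 1" 1] by auto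
qed

lemma cyc_top_cases:
  assumes "1 \<le> j" "j \<le> int (mm Q)" "cyc j"
  obtains k i where "listed Q k i" "j = i + len k \<or> j = i + len k - 1"
proof -
  obtain k i where ki: "listed Q k i" "i < j" "j \<le> i + len k" using listed_cover[OF assms(1,2)] by blast
  then show ?thesis using not_cyc_between[OF ki(1,2)] assms(3) that by force
qed

text \<open>For a cyclic top \<open>j\<close> in a block, \<open>a - 1\<close> has to be a cyclic
  position from \<open>st j - 1\<close> to \<open>j - 1\<close>. This leaves two choices for each of
  the two possible tops: types (4) and (1) for the end of the block, types (3) and (2) for the
  position below it.\<close>

lemma in_Xc_types:
  "in_Xc Q (M :: 'k rep) \<longleftrightarrow> (\<exists>k i. listed Q k i \<and>
     (iso Q M (Mt Q i i) \<or> iso Q M (Mt Q (i + 1) (i + len k - 1)) \<or>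
      iso Q M (Mt Q i (i + len k - 1)) \<or> iso Q M (Mt Q (i + 1) (i + len k))))"
proof
  assume "in_Xc Q M"
  from in_Xc_uniserial[OF this] obtain a j where j: "1 \<le> j" "j \<le> int (mm Q)" and aj: "a \<le> j" "st j \<le> a"
    and c: "cyc j" "cyc (a - 1)" and iso: "iso Q M (Mt Q a j)" by blast
  obtain k i where ki: "listed Q k i" "j = i + len k \<or> j = i + len k - 1" by (rule cyc_top_cases[OF j c(1)])
  note b = listed_bounds[OF ki(1)] and nb = not_cyc_between[OF ki(1), of "a - 1"]
  from ki(2) show "\<exists>k i. listed Q k i \<and>
     (iso Q M (Mt Q i i) \<or> iso Q M (Mt Q (i + 1) (i + len k - 1)) \<or>
      iso Q M (Mt Q i (i + len k - 1)) \<or> iso Q M (Mt Q (i + 1) (i + len k)))"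
  proof
    assume jt: "j = i + len k"
    then have "i \<le> a - 1" using aj(2) listed_st_top[OF ki(1)] by simp
    then consider "a = i + 1" | "a = j" using nb c(2) aj(1) jt by force
    then show ?thesis
    proof cases
      case 1 then show ?thesis using iso jt ki(1) by blast
    next
      case 2
      \<comment> \<open>The simple at the end of a block is of type (1) for the next block, possibly
        only after a shift by the period \<open>m\<close>.\<close>
      obtain k' i' where i': "listed Q k' i'" "vt i' = vt (i + len k)" using listed_next[OF ki(1)] by blast
      then have "Mt Q i' i' = (Mt Q a j :: 'k rep)" using 2 jt by (intro Mt_cong) auto
      then have "iso Q M (Mt Q i' i')" using iso by simp
      then show ?thesis using i'(1) by blast
    qed
  next
    assume jt: "j = i + len k - 1"
    then have "i \<le> a" using aj(2) listed_st_below_top[OF ki(1)] by simp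
    then consider "a = i" | "a = i + 1" using nb c(2) aj(1) jt by force
    then show ?thesis using iso jt ki(1) by cases blast+
  qed
next
  assume "\<exists>k i. listed Q k i \<and>
     (iso Q M (Mt Q i i) \<or> iso Q M (Mt Q (i + 1) (i + len k - 1)) \<or>
      iso Q M (Mt Q i (i + len k - 1)) \<or> iso Q M (Mt Q (i + 1) (i + len k)))"
  then obtain k i where ki: "listed Q k i" and or: "iso Q M (Mt Q i i) \<or> iso Q M (Mt Q (i + 1) (i + len k - 1)) \<or>
      iso Q M (Mt Q i (i + len k - 1)) \<or> iso Q M (Mt Q (i + 1) (i + len k))" by blast
  note b = listed_bounds[OF ki] and c = cyc_listed[OF ki] and s = listed_st_top[OF ki] listed_st_below_top[OF ki]
  have "in_Xc Q (Mt Q i i :: 'k rep)"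
    using c st_window(1)[of i] by (subst Mt_in_Xc_iff) auto
  moreover have "in_Xc Q (Mt Q (i + 1) (i + len k - 1) :: 'k rep)"
    using c s b by (subst Mt_in_Xc_iff) auto
  moreover have "in_Xc Q (Mt Q i (i + len k - 1) :: 'k rep)"
    using c s b by (subst Mt_in_Xc_iff) auto
  moreover have "in_Xc Q (Mt Q (i + 1) (i + len k) :: 'k rep)"
    using c s b by (subst Mt_in_Xc_iff) auto
  ultimately show "in_Xc Q M" using or in_Xc_iso by blast
qed

lemma proj_in_F_types:
  assumes "in_Xc Q (M :: 'k rep)"
  shows "proj_in_F Q M \<longleftrightarrow> (\<exists>k i. listed Q k i \<and>
     (iso Q M (Mt Q i (i + len k - 1)) \<or> iso Q M (Mt Q (i + 1) (i + len k))))"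
  unfolding proj_in_F_iff[OF assms]
proof
  assume "\<exists>j. 1 \<le> j \<and> j \<le> int (mm Q) \<and> cyc j \<and> iso Q M (PP j)"
  then obtain j where j: "1 \<le> j" "j \<le> int (mm Q)" "cyc j" and iso: "iso Q M (PP j)" by blast
  obtain k i where ki: "listed Q k i" "j = i + len k \<or> j = i + len k - 1" by (rule cyc_top_cases[OF j])
  then show "\<exists>k i. listed Q k i \<and>
     (iso Q M (Mt Q i (i + len k - 1)) \<or> iso Q M (Mt Q (i + 1) (i + len k)))"
    using iso listed_st_top[OF ki(1)] listed_st_below_top[OF ki(1)] by (intro exI[of _ k] exI[of _ i]) auto
next
  assume "\<exists>k i. listed Q k i \<and> (iso Q M (Mt Q i (i + len k - 1)) \<or> iso Q M (Mt Q (i + 1) (i + len k)))"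
  then obtain k i where ki: "listed Q k i"
    and or: "iso Q M (Mt Q i (i + len k - 1)) \<or> iso Q M (Mt Q (i + 1) (i + len k))" by blast
  note b = listed_bounds[OF ki]
  have "1 \<le> i + len k - 1" "i + len k - 1 \<le> int (mm Q)" "1 \<le> i + len k" using b(3,6,7) by linarith+
  moreover have "iso Q M (PP (i + len k - 1)) \<or> iso Q M (PP (i + len k))"
    using or listed_st_top[OF ki] listed_st_below_top[OF ki] by simp
  ultimately show "\<exists>j. 1 \<le> j \<and> j \<le> int (mm Q) \<and> cyc j \<and> iso Q M (PP j)"
    using cyc_listed(3,4)[OF ki] b(7) by blast
qed

end

theorem theorem5p11:
  fixes Q :: params and n :: nat
  assumes "n \<ge> 2" and "even n"
    and "rr Q \<ge> 1" and "ms Q 1 = 0"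
    and "\<forall>k\<in>{1..rr Q}. ms Q k < ms Q (Suc k)"
    and "\<forall>k\<in>{1..rr Q}. ls Q k \<ge> 2"
    and "\<forall>k\<in>{1..rr Q}. ls Q k dvd (ms Q (Suc k) - ms Q k)"
    and "\<forall>k\<in>{1..rr Q}. n * ls Q k = 2 * (ms Q (Suc k) - ms Q k)"
    and "\<exists>k\<in>{1..rr Q}. ls Q k \<ge> 3"
  shows "(\<forall>M :: 'k::field rep. in_Xc Q M \<longleftrightarrow>
            (\<exists>k i. listed Q k i \<and>
               (iso Q M (Mt Q i i) \<or>
                iso Q M (Mt Q (i + 1) (i + int (ls Q k) - 1)) \<or>
                iso Q M (Mt Q i (i + int (ls Q k) - 1)) \<or>
                iso Q M (Mt Q (i + 1) (i + int (ls Q k))))))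
       \<and> (\<forall>i j. i \<le> j \<longrightarrow> in_Xc Q (Mt Q i j :: 'k rep) \<longrightarrow>
            (proj_in_F Q (Mt Q i j :: 'k rep) \<longleftrightarrow>
              (\<exists>k i'. listed Q k i' \<and>
                 (iso Q (Mt Q i j :: 'k rep) (Mt Q i' (i' + int (ls Q k) - 1)) \<or>
                  iso Q (Mt Q i j :: 'k rep) (Mt Q (i' + 1) (i' + int (ls Q k)))))))"
proof -
  interpret pieces Q "TYPE('k)"
    by unfold_locales (use assms in auto)
  show ?thesis using in_Xc_types proj_in_F_types by blast
qed

end
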